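(* Let $J\subsetneq I\subsetneq R$ be ideals of a Noetherian ring $R$. (a) If $J$ contains a regular element (of $R$), then $\dim \mathcal{A}_{R\twoheadrightarrow R/J}(I/J)\leq \dim R$. (b) If $I/J$ contains a regular element (of $R/J$), then $$\min\{\dim R+1,\ \dim \mathcal{S}_{R/J}(I/J)\}\ \geq\ \dim \mathcal{A}_{R\twoheadrightarrow R/J}(I/J)\ \geq\ \dim R/J+1.$$
   Context: Rings are commutative with $1$; $\dim$ is Krull dimension. $\mathcal{S}$ denotes the symmetric algebra and $\mathcal{R}_R(I)=\bigoplus_{t\ge 0}I^tu^t\subset R[u]$ the Rees algebra. For ideals $J\subset I\subset R$, the ($R$-embedded) Aluffi algebra of $I/J$ is $$\mathcal{A}_{R\twoheadrightarrow R/J}(I/J):=\mathcal{S}_{R/J}(I/J)\otimes_{\mathcal{S}_R(I)}\mathcal{R}_R(I)\simeq \mathcal{R}_R(I)/(J,\widetilde J)\mathcal{R}_R(I)\simeq\bigoplus_{t\ge0}I^t/JI^{t-1}$$ (degree-zero part $R/J$), where $J$ is placed in degree $0$ and $\widetilde J=Ju$ in degree $1$. *)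

theory Defs
  imports "HOL-Library.Extended_Nat" "HOL-Algebra.Algebra"
begin

text \<open>
  Krull dimension: the supremum of the lengths \<open>n\<close> of chains
  \<open>P 0 \<subset> P 1 \<subset> \<dots> \<subset> P n\<close> of prime ideals, possibly \<open>\<infinity>\<close>. Since the values are in
  \<^typ>\<open>enat\<close>, the zero ring gets the value \<open>0\<close> (instead of \<open>-1\<close> or \<open>-\<infinity>\<close>); the dimension should
  only be used for nonzero rings.
\<close>

definition prime_chain :: "('a, 'm) ring_scheme \<Rightarrow> nat \<Rightarrow> (nat \<Rightarrow> 'a set) \<Rightarrow> bool"
  where "prime_chain R n P \<longleftrightarrow>
    (\<forall>i\<le>n. primeideal (P i) R) \<and> (\<forall>i<n. P i \<subset> P (Suc i))"

definition krull_dim :: "('a, 'm) ring_scheme \<Rightarrow> enat"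
  where "krull_dim R = (SUP n \<in> {n. \<exists>P. prime_chain R n P}. enat n)"

definition regular_element :: "('a, 'm) ring_scheme \<Rightarrow> 'a \<Rightarrow> bool"
  where "regular_element R a \<longleftrightarrow>
    a \<in> carrier R \<and> (\<forall>x\<in>carrier R. a \<otimes>\<^bsub>R\<^esub> x = \<zero>\<^bsub>R\<^esub> \<longrightarrow> x = \<zero>\<^bsub>R\<^esub>)"


section \<open>Monoid rings\<close>

text \<open>
  The monoid ring \<open>R[G]\<close> of finitely supported functions on \<open>G\<close> with the convolution product. As an
  \<open>R\<close>-module it is free on \<open>carrier G\<close>. It serves both as the polynomial ring in an arbitrary set of
  variables (\<open>G\<close> a free commutative monoid) and as the free module in the construction of the tensor
  product of two algebras.
\<close>

definition monoid_ring ::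
    "('a, 'm) ring_scheme \<Rightarrow> ('g, 'n) monoid_scheme \<Rightarrow> ('g \<Rightarrow> 'a) ring"
  where "monoid_ring R G = \<lparr>
    carrier = {p. (\<forall>g\<in>carrier G. p g \<in> carrier R) \<and> (\<forall>g. g \<notin> carrier G \<longrightarrow> p g = \<zero>\<^bsub>R\<^esub>) \<and>
                  finite {g. p g \<noteq> \<zero>\<^bsub>R\<^esub>}},
    monoid.mult = (\<lambda>p q g. finsum R (\<lambda>(h, k). p h \<otimes>\<^bsub>R\<^esub> q k)
              {(h, k). p h \<noteq> \<zero>\<^bsub>R\<^esub> \<and> q k \<noteq> \<zero>\<^bsub>R\<^esub> \<and> h \<otimes>\<^bsub>G\<^esub> k = g}),
    one = (\<lambda>g. if g = \<one>\<^bsub>G\<^esub> then \<one>\<^bsub>R\<^esub> else \<zero>\<^bsub>R\<^esub>),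
    ring.zero = (\<lambda>g. \<zero>\<^bsub>R\<^esub>),
    add = (\<lambda>p q g. p g \<oplus>\<^bsub>R\<^esub> q g)\<rparr>"

definition mr_single :: "('a, 'm) ring_scheme \<Rightarrow> 'a \<Rightarrow> 'g \<Rightarrow> ('g \<Rightarrow> 'a)"
  where "mr_single R a g = (\<lambda>h. if h = g then a else \<zero>\<^bsub>R\<^esub>)"

definition free_comm_monoid :: "'x set \<Rightarrow> 'x multiset monoid"
  where "free_comm_monoid V = \<lparr>carrier = {m. set_mset m \<subseteq> V}, monoid.mult = (+), one = {#}\<rparr>"


section \<open>The symmetric algebra of a module\<close>

text \<open>
  \<open>sym_poly R M\<close> is the polynomial ring over \<open>R\<close> with one variable \<open>X\<^sub>x\<close> for each \<open>x \<in> M\<close>. The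
  symmetric algebra is its quotient by the ideal generated by all \<open>X\<^bsub>x + y\<^esub> - (X\<^sub>x + X\<^sub>y)\<close> and all
  \<open>X\<^bsub>r x\<^esub> - r X\<^sub>x\<close>. (Dividing the tensor algebra by its commutators gives the same algebra.)
\<close>

definition sym_poly ::
    "('a, 'm) ring_scheme \<Rightarrow> ('a, 'x, 'n) module_scheme \<Rightarrow> ('x multiset \<Rightarrow> 'a) ring"
  where "sym_poly R M = monoid_ring R (free_comm_monoid (carrier M))"

definition sym_ideal ::
    "('a, 'm) ring_scheme \<Rightarrow> ('a, 'x, 'n) module_scheme \<Rightarrow> ('x multiset \<Rightarrow> 'a) set"
  where "sym_ideal R M = Idl\<^bsub>sym_poly R M\<^esub>
    ({mr_single R \<one>\<^bsub>R\<^esub> {#x \<oplus>\<^bsub>M\<^esub> y#} \<ominus>\<^bsub>sym_poly R M\<^esub>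
        (mr_single R \<one>\<^bsub>R\<^esub> {#x#} \<oplus>\<^bsub>sym_poly R M\<^esub> mr_single R \<one>\<^bsub>R\<^esub> {#y#})
        | x y. x \<in> carrier M \<and> y \<in> carrier M} \<union>
     {mr_single R \<one>\<^bsub>R\<^esub> {#r \<odot>\<^bsub>M\<^esub> x#} \<ominus>\<^bsub>sym_poly R M\<^esub> mr_single R r {#x#}
        | r x. r \<in> carrier R \<and> x \<in> carrier M})"

definition sym_alg ::
    "('a, 'm) ring_scheme \<Rightarrow> ('a, 'x, 'n) module_scheme \<Rightarrow> ('x multiset \<Rightarrow> 'a) set ring"
  where "sym_alg R M = sym_poly R M Quot sym_ideal R M"

definition sym_scalar ::
    "('a, 'm) ring_scheme \<Rightarrow> ('a, 'x, 'n) module_scheme \<Rightarrow> 'a \<Rightarrow> ('x multiset \<Rightarrow> 'a) set"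
  where "sym_scalar R M r = sym_ideal R M +>\<^bsub>sym_poly R M\<^esub> mr_single R r {#}"

definition sym_gen ::
    "('a, 'm) ring_scheme \<Rightarrow> ('a, 'x, 'n) module_scheme \<Rightarrow> 'x \<Rightarrow> ('x multiset \<Rightarrow> 'a) set"
  where "sym_gen R M x = sym_ideal R M +>\<^bsub>sym_poly R M\<^esub> mr_single R \<one>\<^bsub>R\<^esub> {#x#}"

text \<open>
  The homomorphism from \<open>sym_alg R M\<close> to a commutative ring \<open>S\<close> that is induced by a ring
  homomorphism \<open>h\<close> from \<open>R\<close> to \<open>S\<close> and an \<open>h\<close>-linear map \<open>v\<close> from \<open>M\<close> to \<open>S\<close>: evaluate a
  representative at \<open>v\<close>. The evaluation is constant on the residue classes \<open>c\<close>, hence \<open>the_elem\<close>.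
\<close>

definition sym_eval ::
    "('a, 'm) ring_scheme \<Rightarrow> ('s, 'k) ring_scheme \<Rightarrow> ('a \<Rightarrow> 's) \<Rightarrow> ('x \<Rightarrow> 's) \<Rightarrow>
      ('x multiset \<Rightarrow> 'a) \<Rightarrow> 's"
  where "sym_eval R S h v p =
    (\<Oplus>\<^bsub>S\<^esub>m\<in>{m. p m \<noteq> \<zero>\<^bsub>R\<^esub>}. h (p m) \<otimes>\<^bsub>S\<^esub> (\<Otimes>\<^bsub>S\<^esub>x\<in>set_mset m. v x [^]\<^bsub>S\<^esub> count m x))"

definition sym_lift ::
    "('a, 'm) ring_scheme \<Rightarrow> ('s, 'k) ring_scheme \<Rightarrow> ('a \<Rightarrow> 's) \<Rightarrow> ('x \<Rightarrow> 's) \<Rightarrow>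
      ('x multiset \<Rightarrow> 'a) set \<Rightarrow> 's"
  where "sym_lift R S h v c = the_elem (sym_eval R S h v ` c)"


section \<open>Tensor products of commutative algebras\<close>

text \<open>
  For ring homomorphisms \<open>f\<close> from \<open>A\<close> to \<open>B\<close> and \<open>g\<close> from \<open>A\<close> to \<open>C\<close>, the tensor product over \<open>A\<close>
  is the free \<open>A\<close>-module on \<open>B \<times> C\<close> modulo the usual bilinearity relations, with
  \<open>(b \<otimes> c) (b' \<otimes> c') = b b' \<otimes> c c'\<close>. The submodule generated by the relations is stable under
  multiplication by basis elements \<open>(b, c)\<close>, so it coincides with the ideal generated by them in
  the monoid ring \<open>A[B \<times> C]\<close>.
\<close>

definition tensor_free ::
    "('a, 'm) ring_scheme \<Rightarrow> ('b, 'n) ring_scheme \<Rightarrow> ('c, 'k) ring_scheme \<Rightarrow> ('b \<times> 'c \<Rightarrow> 'a) ring"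
  where "tensor_free A B C = monoid_ring A (B \<times>\<times> C)"

definition tensor_ideal ::
    "('a, 'm) ring_scheme \<Rightarrow> ('b, 'n) ring_scheme \<Rightarrow> ('c, 'k) ring_scheme \<Rightarrow>
      ('a \<Rightarrow> 'b) \<Rightarrow> ('a \<Rightarrow> 'c) \<Rightarrow> ('b \<times> 'c \<Rightarrow> 'a) set"
  where "tensor_ideal A B C f g = Idl\<^bsub>tensor_free A B C\<^esub>
    ({mr_single A \<one>\<^bsub>A\<^esub> (b \<oplus>\<^bsub>B\<^esub> b', c) \<ominus>\<^bsub>tensor_free A B C\<^esub>
        (mr_single A \<one>\<^bsub>A\<^esub> (b, c) \<oplus>\<^bsub>tensor_free A B C\<^esub> mr_single A \<one>\<^bsub>A\<^esub> (b', c))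
        | b b' c. b \<in> carrier B \<and> b' \<in> carrier B \<and> c \<in> carrier C} \<union>
     {mr_single A \<one>\<^bsub>A\<^esub> (b, c \<oplus>\<^bsub>C\<^esub> c') \<ominus>\<^bsub>tensor_free A B C\<^esub>
        (mr_single A \<one>\<^bsub>A\<^esub> (b, c) \<oplus>\<^bsub>tensor_free A B C\<^esub> mr_single A \<one>\<^bsub>A\<^esub> (b, c'))
        | b c c'. b \<in> carrier B \<and> c \<in> carrier C \<and> c' \<in> carrier C} \<union>
     {mr_single A \<one>\<^bsub>A\<^esub> (f a \<otimes>\<^bsub>B\<^esub> b, c) \<ominus>\<^bsub>tensor_free A B C\<^esub> mr_single A a (b, c)
        | a b c. a \<in> carrier A \<and> b \<in> carrier B \<and> c \<in> carrier C} \<union>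
     {mr_single A \<one>\<^bsub>A\<^esub> (b, g a \<otimes>\<^bsub>C\<^esub> c) \<ominus>\<^bsub>tensor_free A B C\<^esub> mr_single A a (b, c)
        | a b c. a \<in> carrier A \<and> b \<in> carrier B \<and> c \<in> carrier C})"

definition tensor_alg ::
    "('a, 'm) ring_scheme \<Rightarrow> ('b, 'n) ring_scheme \<Rightarrow> ('c, 'k) ring_scheme \<Rightarrow>
      ('a \<Rightarrow> 'b) \<Rightarrow> ('a \<Rightarrow> 'c) \<Rightarrow> ('b \<times> 'c \<Rightarrow> 'a) set ring"
  where "tensor_alg A B C f g = tensor_free A B C Quot tensor_ideal A B C f g"


section \<open>Rees algebra and Aluffi algebra\<close>

text \<open>
  The powers \<open>I\<^sup>t\<close> are taken in the semiring of ideals; in particular \<open>I\<^sup>0 = R\<close>.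
\<close>

definition rees_algebra :: "('a, 'm) ring_scheme \<Rightarrow> 'a set \<Rightarrow> ('a, nat \<Rightarrow> 'a) up_ring"
  where "rees_algebra R I =
    (UP R)\<lparr>carrier := {p \<in> carrier (UP R). \<forall>t. coeff (UP R) p t \<in> I [^]\<^bsub>ideals_set R\<^esub> t}\<rparr>"

text \<open>An ideal as a module; the \<open>mult\<close> and \<open>one\<close> fields play no role in a module.\<close>

definition ideal_module :: "('a, 'm) ring_scheme \<Rightarrow> 'a set \<Rightarrow> ('a, 'a) module"
  where "ideal_module R I = \<lparr>carrier = I, monoid.mult = monoid.mult R, one = \<one>\<^bsub>R\<^esub>, ring.zero = \<zero>\<^bsub>R\<^esub>, add = add R,
    smult = monoid.mult R\<rparr>"

text \<open>The ideal \<open>I/J\<close> of \<open>R/J\<close>.\<close>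

definition quot_ideal :: "('a, 'm) ring_scheme \<Rightarrow> 'a set \<Rightarrow> 'a set \<Rightarrow> 'a set set"
  where "quot_ideal R I J = (\<lambda>x. J +>\<^bsub>R\<^esub> x) ` I"

definition sym_ideal_alg :: "('a, 'm) ring_scheme \<Rightarrow> 'a set \<Rightarrow> ('a multiset \<Rightarrow> 'a) set ring"
  where "sym_ideal_alg R I = sym_alg R (ideal_module R I)"

definition sym_quot_alg ::
    "('a, 'm) ring_scheme \<Rightarrow> 'a set \<Rightarrow> 'a set \<Rightarrow> ('a set multiset \<Rightarrow> 'a set) set ring"
  where "sym_quot_alg R I J = sym_ideal_alg (R Quot J) (quot_ideal R I J)"

text \<open>The natural maps from \<open>S\<^sub>R(I)\<close> to \<open>S\<^bsub>R/J\<^esub>(I/J)\<close> and to the Rees algebra.\<close>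

definition sym_to_sym_quot ::
    "('a, 'm) ring_scheme \<Rightarrow> 'a set \<Rightarrow> 'a set \<Rightarrow>
      ('a multiset \<Rightarrow> 'a) set \<Rightarrow> ('a set multiset \<Rightarrow> 'a set) set"
  where "sym_to_sym_quot R I J = sym_lift R (sym_quot_alg R I J)
    (\<lambda>r. sym_scalar (R Quot J) (ideal_module (R Quot J) (quot_ideal R I J)) (J +>\<^bsub>R\<^esub> r))
    (\<lambda>x. sym_gen (R Quot J) (ideal_module (R Quot J) (quot_ideal R I J)) (J +>\<^bsub>R\<^esub> x))"

definition sym_to_rees ::
    "('a, 'm) ring_scheme \<Rightarrow> 'a set \<Rightarrow> ('a multiset \<Rightarrow> 'a) set \<Rightarrow> (nat \<Rightarrow> 'a)"
  where "sym_to_rees R I = sym_lift R (rees_algebra R I)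
    (\<lambda>r. monom (UP R) r 0) (\<lambda>x. monom (UP R) x 1)"

definition aluffi_algebra ::
    "('a, 'm) ring_scheme \<Rightarrow> 'a set \<Rightarrow> 'a set \<Rightarrow>
      ((('a set multiset \<Rightarrow> 'a set) set \<times> (nat \<Rightarrow> 'a)) \<Rightarrow> ('a multiset \<Rightarrow> 'a) set) set ring"
  where "aluffi_algebra R I J =
    tensor_alg (sym_ideal_alg R I) (sym_quot_alg R I J) (rees_algebra R I)
      (sym_to_sym_quot R I J) (sym_to_rees R I)"

end

theory Submission
  imports Defs
begin

text \<open>
  Both upper bounds by \<open>dim R\<close> come from \<open>dim \<R>\<^sub>R(I) \<le> dim R + 1\<close>, because the Aluffi algebra is a
  quotient of the Rees algebra by an ideal that contains \<open>J\<close>. Let \<open>Q\<close> be the bottom of a chain of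
  primes of \<open>\<R>\<^sub>R(I)\<close>. Some prime \<open>p\<close> of \<open>R[u]\<close> satisfies \<open>p \<inter> \<R>\<^sub>R(I) \<subseteq> Q\<close>, and \<open>p\<close> can be chosen to
  avoid a given regular element of \<open>R\<close>; if this element is in \<open>J \<subseteq> Q\<close>, the chain can be prolonged
  downwards, which gives the better bound in (a). Now write \<open>\<R>\<^sub>R(I) = R[f\<^sub>1 u, \<dots>, f\<^sub>k u]\<close>, with
  \<open>f\<^sub>1 \<notin> p\<close> if \<open>I\<close> is not contained in \<open>p\<close>, and contract the chain one generator at a time. For Noetherian \<open>A\<close>, the
  contraction from \<open>A[x]\<close> to \<open>A\<close> loses at most one step by the principal ideal theorem, and none if
  \<open>x\<close> is algebraic over \<open>A\<close> modulo the bottom of the chain. The latter holds for \<open>f\<^sub>i u\<close> with \<open>i > 1\<close>,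
  since \<open>f\<^sub>1 (f\<^sub>i u) = f\<^sub>i (f\<^sub>1 u)\<close>.

  For the lower bound, map the Aluffi algebra to \<open>(R/J)[u]\<close>. Given a chain \<open>P\<^sub>0 \<subset> \<dots> \<subset> P\<^sub>n\<close> of primes of
  \<open>R/J\<close>, pull back the primes \<open>{F. F(0) \<in> P\<^sub>i}\<close> and, below them, \<open>p (R/J)[u]\<close>, where \<open>p \<subseteq> P\<^sub>0\<close> is a
  prime that does not contain the regular element \<open>b\<close> of \<open>I/J\<close>: the class of \<open>b u\<close> shows that the first
  inclusion is strict.
\<close>

section \<open>The principal ideal theorem\<close>

text \<open>The classical dimension inequality compares transcendence degrees of domains. Here no
  residue domain and no field of fractions is formed: every statement concerns a chain of primes and
  is read modulo its bottom, and this is why each contraction lemma also records the bottom of the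
  chain that it produces. The obstacle is that a prime of \<open>A\<close> may carry two members of
  a chain of \<open>A[X]\<close>, and this could happen repeatedly. The principal ideal theorem
  supplies an additional prime of \<open>A\<close> after each such coincidence that is followed by a
  return to an extended prime, so only one coincidence remains unpaid. The Aluffi algebra is handled
  as the tensor product that defines it, and its presentation as a quotient of the Rees algebra by
  \<open>(J, Ju)\<close> is never derived: the base changes of the two surjections from
  \<open>S_R(I)\<close> give the upper bounds, and the universal property gives the map to
  \<open>(R/J)[u]\<close>.\<close>

lemma (in noetherian_ring) ideal_maximal_element:
  assumes "ideal E R" "\<phi> E"
  shows "\<exists>M. ideal M R \<and> \<phi> M \<and> (\<forall>F. ideal F R \<longrightarrow> \<phi> F \<longrightarrow> M \<subseteq> F \<longrightarrow> F = M)"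
proof -
  let ?F = "{E. ideal E R \<and> \<phi> E}"
  have "\<exists>M\<in>?F. \<forall>E\<in>?F. M \<subseteq> E \<longrightarrow> E = M"
  proof (rule subset_Zorn)
    fix C assume C: "subset.chain ?F C"
    show "\<exists>U\<in>?F. \<forall>E\<in>C. E \<subseteq> U"
    proof (cases "C = {}")
      case True
      then show ?thesis using assms by blast
    next
      case False
      have "subset.chain {I. ideal I R} C"
        using C unfolding subset_chain_def by auto
      then have "\<Union>C \<in> C" using ideal_chain_is_trivial[OF False] by simp
      then show ?thesis using C unfolding subset_chain_def by (intro bexI[of _ "\<Union>C"]) auto
    qed
  qed
  then show ?thesis by auto
qed

lemma (in ideal) minus_mem: "x \<in> I \<Longrightarrow> y \<in> I \<Longrightarrow> x \<ominus> y \<in> I"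
  unfolding a_minus_def by (simp add: a_closed a_inv_closed)

lemma (in cring) idealI_comm:
  assumes "E \<subseteq> carrier R" "\<zero> \<in> E" "\<And>x y. x \<in> E \<Longrightarrow> y \<in> E \<Longrightarrow> x \<oplus> y \<in> E"
    and "\<And>x r. x \<in> E \<Longrightarrow> r \<in> carrier R \<Longrightarrow> r \<otimes> x \<in> E"
  shows "ideal E R"
proof (rule idealI)
  show "ring R" by (rule ring_axioms)
  show "subgroup E (add_monoid R)"
  proof (rule add.subgroupI)
    show "E \<noteq> {}" using assms(2) by blast
    fix x assume x: "x \<in> E"
    have "(\<ominus> \<one>) \<otimes> x = \<ominus> x" using x assms(1) by (simp add: l_minus subsetD)
    then show "\<ominus> x \<in> E" using assms(4)[OF x, of "\<ominus> \<one>"] by simp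
  qed (use assms in auto)
  fix x r assume "x \<in> E" "r \<in> carrier R"
  then show "r \<otimes> x \<in> E" "x \<otimes> r \<in> E"
    using assms(4)[of x r] m_comm[of x r] assms(1) by auto
qed

section \<open>Sums, colon ideals and saturations of ideals\<close>

definition ideal_adjoin :: "('a, 'm) ring_scheme \<Rightarrow> 'a set \<Rightarrow> 'a \<Rightarrow> 'a set"
  where "ideal_adjoin R E a = {e \<oplus>\<^bsub>R\<^esub> a \<otimes>\<^bsub>R\<^esub> x | e x. e \<in> E \<and> x \<in> carrier R}"

definition ideal_colon :: "('a, 'm) ring_scheme \<Rightarrow> 'a set \<Rightarrow> 'a \<Rightarrow> 'a set"
  where "ideal_colon R E a = {x \<in> carrier R. a \<otimes>\<^bsub>R\<^esub> x \<in> E}"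

text \<open>For a multiplicative set \<open>S\<close> and an ideal \<open>E\<close> this is the
  contraction to \<open>R\<close> of the extension of \<open>E\<close> to the localization at
  \<open>S\<close>. Inclusions between localized ideals can thus be stated inside
  \<open>R\<close>.\<close>

definition saturation :: "('a, 'm) ring_scheme \<Rightarrow> 'a set \<Rightarrow> 'a set \<Rightarrow> 'a set"
  where "saturation R S E = {x \<in> carrier R. \<exists>s\<in>S. s \<otimes>\<^bsub>R\<^esub> x \<in> E}"

lemma saturationI: "x \<in> carrier R \<Longrightarrow> s \<in> S \<Longrightarrow> s \<otimes>\<^bsub>R\<^esub> x \<in> E \<Longrightarrow> x \<in> saturation R S E"
  unfolding saturation_def by blast

context cring
begin

lemma ideal_adjoin_ideal:
  assumes "ideal E R" "a \<in> carrier R"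
  shows "ideal (ideal_adjoin R E a) R"
proof -
  interpret E: ideal E R by fact
  show ?thesis
  proof (rule idealI_comm)
    show "ideal_adjoin R E a \<subseteq> carrier R"
      using assms(2) E.Icarr unfolding ideal_adjoin_def by auto
    have "\<zero> = \<zero> \<oplus> a \<otimes> \<zero>" using assms(2) by simp
    then show "\<zero> \<in> ideal_adjoin R E a"
      unfolding ideal_adjoin_def using E.zero_closed by blast
  next
    fix x y assume "x \<in> ideal_adjoin R E a" "y \<in> ideal_adjoin R E a"
    then obtain e u f v where *: "x = e \<oplus> a \<otimes> u" "y = f \<oplus> a \<otimes> v" "e \<in> E" "f \<in> E"
      "u \<in> carrier R" "v \<in> carrier R" unfolding ideal_adjoin_def by auto
    then have "x \<oplus> y = (e \<oplus> f) \<oplus> a \<otimes> (u \<oplus> v)"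
      using E.Icarr assms(2) by (simp add: r_distr a_ac)
    then show "x \<oplus> y \<in> ideal_adjoin R E a"
      unfolding ideal_adjoin_def using * E.a_closed by blast
  next
    fix x r assume "x \<in> ideal_adjoin R E a" and r: "r \<in> carrier R"
    then obtain e u where *: "x = e \<oplus> a \<otimes> u" "e \<in> E" "u \<in> carrier R"
      unfolding ideal_adjoin_def by auto
    then have "r \<otimes> x = r \<otimes> e \<oplus> a \<otimes> (r \<otimes> u)"
      using E.Icarr assms(2) r by (simp add: r_distr m_ac)
    then show "r \<otimes> x \<in> ideal_adjoin R E a"
      unfolding ideal_adjoin_def using * r E.I_l_closed by blast
  qed
qed

lemma ideal_adjoin_contains:
  assumes "ideal E R" "a \<in> carrier R"
  shows "E \<subseteq> ideal_adjoin R E a" "a \<in> ideal_adjoin R E a"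
proof -
  interpret E: ideal E R by fact
  show "E \<subseteq> ideal_adjoin R E a"
  proof
    fix e assume "e \<in> E"
    moreover from this have "e = e \<oplus> a \<otimes> \<zero>" using assms(2) E.Icarr by simp
    ultimately show "e \<in> ideal_adjoin R E a" unfolding ideal_adjoin_def by blast
  qed
  have "a = \<zero> \<oplus> a \<otimes> \<one>" using assms(2) by simp
  then show "a \<in> ideal_adjoin R E a"
    unfolding ideal_adjoin_def using E.zero_closed by blast
qed

lemma ideal_adjoin_mono: "D \<subseteq> E \<Longrightarrow> ideal_adjoin R D a \<subseteq> ideal_adjoin R E a"
  unfolding ideal_adjoin_def by blast

lemma ideal_adjoin_minimal:
  assumes "ideal E R" "D \<subseteq> E" "a \<in> E"
  shows "ideal_adjoin R D a \<subseteq> E"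
proof -
  interpret E: ideal E R by fact
  show ?thesis unfolding ideal_adjoin_def
    using assms(2,3) E.I_r_closed E.a_closed by blast
qed

lemma ideal_colon_ideal:
  assumes "ideal E R" "a \<in> carrier R"
  shows "ideal (ideal_colon R E a) R"
proof -
  interpret E: ideal E R by fact
  show ?thesis
    by (rule idealI_comm)
      (auto simp: ideal_colon_def assms(2) r_distr m_lcomm intro: E.a_closed E.I_l_closed)
qed

lemma ideal_colon_contains:
  assumes "ideal E R" "a \<in> carrier R"
  shows "E \<subseteq> ideal_colon R E a"
  unfolding ideal_colon_def using assms ideal.I_l_closed ideal.Icarr by fastforce

text \<open>An ideal \<open>P\<close> that is maximal among those above \<open>E\<close> and
  disjoint from \<open>S\<close> is prime: for \<open>a\<close> and \<open>b\<close> outside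
  \<open>P\<close>, both \<open>P + a R\<close> and \<open>P + b R\<close> meet \<open>S\<close>,
  and the product of two such meeting points lies in \<open>P + a b R\<close>.\<close>

lemma prime_ideal_avoiding:
  assumes "noetherian_ring R" "ideal E R" "submonoid S R" "E \<inter> S = {}"
  shows "\<exists>P. primeideal P R \<and> E \<subseteq> P \<and> P \<inter> S = {}"
proof -
  interpret noetherian_ring R by fact
  interpret S: submonoid S R by fact
  obtain P where P: "ideal P R" "E \<subseteq> P" "P \<inter> S = {}"
    and max: "\<And>F. ideal F R \<Longrightarrow> E \<subseteq> F \<Longrightarrow> F \<inter> S = {} \<Longrightarrow> P \<subseteq> F \<Longrightarrow> F = P"
    using ideal_maximal_element[OF assms(2), of "\<lambda>F. E \<subseteq> F \<and> F \<inter> S = {}"] assms(4) by auto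
  interpret P: ideal P R by fact
  have "primeideal P R"
  proof (rule primeidealI)
    show "ideal P R" by fact
    show "cring R" by (rule cring_axioms)
    show "carrier R \<noteq> P" using P(3) S.one_closed one_closed by blast
    fix a b assume ab: "a \<in> carrier R" "b \<in> carrier R" "a \<otimes> b \<in> P"
    show "a \<in> P \<or> b \<in> P"
    proof (rule ccontr)
      assume nab: "\<not> (a \<in> P \<or> b \<in> P)"
      have meet: "ideal_adjoin R P c \<inter> S \<noteq> {}" if "c \<in> carrier R" "c \<notin> P" for c
        using max[OF ideal_adjoin_ideal[OF P(1) that(1)]] that P(2)
          ideal_adjoin_contains[OF P(1) that(1)] by blast
      obtain s t where st: "s \<in> S" "t \<in> S" "s \<in> ideal_adjoin R P a" "t \<in> ideal_adjoin R P b"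
        using meet ab nab by blast
      then obtain e u f v where *: "s = e \<oplus> a \<otimes> u" "t = f \<oplus> b \<otimes> v" "e \<in> P" "f \<in> P"
        "u \<in> carrier R" "v \<in> carrier R" unfolding ideal_adjoin_def by auto
      have "s \<otimes> t = e \<otimes> t \<oplus> ((a \<otimes> u) \<otimes> f \<oplus> (a \<otimes> b) \<otimes> (u \<otimes> v))"
        unfolding *(1) *(2) using ab * P.Icarr by (simp add: l_distr r_distr m_ac a_ac)
      moreover have "t \<in> carrier R" using st S.subset by blast
      ultimately have "s \<otimes> t \<in> P"
        using * ab P.a_closed P.I_r_closed P.I_l_closed by (metis m_closed)
      then show False using st S.m_closed P(3) by blast
    qed
  qed
  then show ?thesis using P by blast
qed

lemma primeideal_compl_submonoid:
  assumes "primeideal P R"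
  shows "submonoid (carrier R - P) R"
proof -
  interpret P: primeideal P R by fact
  show ?thesis
    by unfold_locales (use P.I_prime P.I_notcarr P.one_imp_carrier in auto)
qed

text \<open>This says that the localization of \<open>R/E\<close> at \<open>Q\<close> is Artinian if \<open>Q\<close> is its only prime ideal. An
  ideal \<open>B\<close> that is maximal among the counterexamples is not prime; if \<open>u v \<in> B\<close> with \<open>u, v \<notin> B\<close>, then
  the chain is controlled by its images above \<open>B + (u)\<close> and \<open>(B : u)\<close>.\<close>

lemma saturated_dcc:
  assumes "noetherian_ring R" "primeideal Q R" "ideal E R"
    and "\<And>P. primeideal P R \<Longrightarrow> E \<subseteq> P \<Longrightarrow> P \<subseteq> Q \<Longrightarrow> P = Q"
    and "\<And>n. ideal (D n) R" "\<And>n. E \<subseteq> D n" "decseq D"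
  shows "\<exists>n. \<forall>m\<ge>n. D n \<subseteq> saturation R (carrier R - Q) (D m)"
proof (rule ccontr)
  interpret noetherian_ring R by fact
  interpret Q: primeideal Q R by fact
  define S where "S = carrier R - Q"
  interpret S: submonoid S R unfolding S_def by (rule primeideal_compl_submonoid) fact
  \<comment> \<open>Quantifying over all chains above \<open>F\<close> turns the claim into a
    property of a single ideal, so that a maximal counterexample exists.\<close>
  define good where "good F \<longleftrightarrow> (\<forall>D. (\<forall>n. ideal (D n) R \<and> F \<subseteq> D n) \<and> decseq D \<longrightarrow>
    (\<exists>n. \<forall>m\<ge>n. D n \<subseteq> saturation R S (D m)))" for F
  assume "\<nexists>n. \<forall>m\<ge>n. D n \<subseteq> saturation R (carrier R - Q) (D m)"
  then have "\<not> good E" unfolding good_def S_def using assms(5-7) by blast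
  then obtain B where B: "ideal B R" "E \<subseteq> B" "\<not> good B"
    and max: "\<And>F. ideal F R \<Longrightarrow> E \<subseteq> F \<Longrightarrow> \<not> good F \<Longrightarrow> B \<subseteq> F \<Longrightarrow> F = B"
    using ideal_maximal_element[OF assms(3), of "\<lambda>F. E \<subseteq> F \<and> \<not> good F"] \<open>\<not> good E\<close> by auto
  interpret B: ideal B R by fact
  have unit: "carrier R = saturation R S F" if "ideal F R" "F \<inter> S \<noteq> {}" for F
    using that ideal.I_r_closed[OF that(1)] unfolding saturation_def by blast
  from B(3) obtain D where D': "(\<forall>n. ideal (D n) R \<and> B \<subseteq> D n) \<and> decseq D"
    and bad': "\<not> (\<exists>n. \<forall>m\<ge>n. D n \<subseteq> saturation R S (D m))"
    unfolding good_def not_all not_imp by (elim exE conjE) simp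
  from D' have D: "\<And>n. ideal (D n) R" "\<And>n. B \<subseteq> D n" "decseq D" by simp_all
  from bad' have bad: "\<And>n. \<exists>m\<ge>n. \<not> D n \<subseteq> saturation R S (D m)" by simp
  have Dc: "D n \<subseteq> carrier R" for n using ideal.Icarr[OF D(1)] by blast
  have Dmono: "D m \<subseteq> D n" if "n \<le> m" for n m
    using decseqD[OF D(3) that] .
  have self: "D n \<subseteq> saturation R S (D n)" for n
  proof
    fix x assume "x \<in> D n"
    then show "x \<in> saturation R S (D n)"
      using Dc[of n] by (intro saturationI[OF _ S.one_closed]) auto
  qed
  \<comment> \<open>An ideal that meets \<open>S\<close> saturates to all of \<open>R\<close>, so a
    bad chain has a term inside \<open>Q\<close>. From there on the chain is squeezed between
    \<open>B\<close> and \<open>Q\<close>.\<close>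
  obtain N where N: "D N \<inter> S = {}"
  proof -
    obtain m where "\<not> D 0 \<subseteq> saturation R S (D m)" using bad[of 0] by blast
    then have "D m \<inter> S = {}" using unit[OF D(1)[of m]] Dc[of 0] by blast
    then show ?thesis using that by blast
  qed
  then have "D N \<subseteq> Q" unfolding S_def using Dc by blast
  have "B \<noteq> Q"
  proof
    assume "B = Q"
    then have "D m = Q" if "m \<ge> N" for m
      using Dmono[OF that] D(2)[of m] \<open>D N \<subseteq> Q\<close> by blast
    then show False using bad[of N] self by (metis order_refl)
  qed
  then have "\<not> primeideal B R" using assms(4)[of B] B(2) D(2)[of N] \<open>D N \<subseteq> Q\<close> by blast
  moreover have "carrier R \<noteq> B" using D(2)[of N] N S.one_closed by blast
  ultimately obtain u v where uv: "u \<in> carrier R" "v \<in> carrier R" "u \<otimes> v \<in> B" "u \<notin> B" "v \<notin> B"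
    using primeidealI[OF B(1) cring_axioms] by blast
  let ?adj = "\<lambda>F. ideal_adjoin R F u" and ?col = "\<lambda>F. ideal_colon R F u"
  have "good (?adj B)"
    using max[OF ideal_adjoin_ideal[OF B(1) uv(1)]] ideal_adjoin_contains[OF B(1) uv(1)] B(2) uv(4)
    by blast
  moreover have "\<And>n. ideal (?adj (D n)) R" "\<And>n. ?adj B \<subseteq> ?adj (D n)" "decseq (\<lambda>n. ?adj (D n))"
    using ideal_adjoin_ideal[OF D(1) uv(1)] ideal_adjoin_mono D(2) Dmono
    by (auto simp: decseq_def)
  ultimately obtain n1 where n1: "\<And>m. m \<ge> n1 \<Longrightarrow> ?adj (D n1) \<subseteq> saturation R S (?adj (D m))"
    unfolding good_def by meson
  have "v \<in> ?col B" unfolding ideal_colon_def using uv by blast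
  then have "good (?col B)"
    using max[OF ideal_colon_ideal[OF B(1) uv(1)]] ideal_colon_contains[OF B(1) uv(1)] B(2) uv(5)
    by blast
  moreover have "\<And>n. ideal (?col (D n)) R" "\<And>n. ?col B \<subseteq> ?col (D n)" "decseq (\<lambda>n. ?col (D n))"
    using ideal_colon_ideal[OF D(1) uv(1)] D(2) subsetD[OF Dmono]
    unfolding decseq_def ideal_colon_def by auto
  ultimately obtain n2 where n2: "\<And>m. m \<ge> n2 \<Longrightarrow> ?col (D n2) \<subseteq> saturation R S (?col (D m))"
    unfolding good_def by meson
  \<comment> \<open>The two stationary images combine along the exact sequence
    \<open>0 -> R/(F : u) -> R/F -> R/(F + u R) -> 0\<close>: an element of \<open>D n\<close> is
    moved into \<open>D m + u R\<close> first, and the coefficient of \<open>u\<close> is then moved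
    into \<open>(D m : u)\<close>.\<close>
  define n where "n = max n1 n2"
  obtain m where m: "m \<ge> n" "\<not> D n \<subseteq> saturation R S (D m)" using bad by blast
  have "D n \<subseteq> saturation R S (D m)"
  proof
    fix y assume y: "y \<in> D n"
    then have yc: "y \<in> carrier R" using Dc by blast
    have "y \<in> ?adj (D n1)"
      using y Dmono[of n1 n] ideal_adjoin_contains(1)[OF D(1) uv(1)] unfolding n_def by auto
    then obtain s where s: "s \<in> S" "s \<otimes> y \<in> ?adj (D m)"
      using n1[of m] m(1) unfolding n_def saturation_def by auto
    then obtain d c where dc: "s \<otimes> y = d \<oplus> u \<otimes> c" "d \<in> D m" "c \<in> carrier R"
      unfolding ideal_adjoin_def by auto
    have sc: "s \<in> carrier R" using s S.subset by blast
    have dcar: "d \<in> carrier R" using dc Dc by blast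
    have "u \<otimes> c = s \<otimes> y \<ominus> d" unfolding dc(1) using dcar dc(3) uv(1) by algebra
    also have "\<dots> \<in> D n"
      using ideal.minus_mem[OF D(1)] ideal.I_l_closed[OF D(1) y sc] dc(2) Dmono[OF m(1)] by blast
    finally have "c \<in> ?col (D n2)"
      using Dmono[of n2 n] dc(3) unfolding ideal_colon_def n_def by auto
    then obtain t where t: "t \<in> S" "t \<otimes> c \<in> ?col (D m)"
      using n2[of m] m(1) unfolding n_def saturation_def by auto
    have tc: "t \<in> carrier R" using t S.subset by blast
    have "(t \<otimes> s) \<otimes> y = t \<otimes> (s \<otimes> y)" using tc sc yc by (simp add: m_assoc)
    also have "\<dots> = t \<otimes> d \<oplus> u \<otimes> (t \<otimes> c)"
      unfolding dc(1) using tc dcar dc(3) uv(1) by (simp add: r_distr m_ac)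
    also have "\<dots> \<in> D m"
      using t(2) ideal.I_l_closed[OF D(1) dc(2) tc]
        additive_subgroup.a_closed[OF ideal.axioms(1)[OF D(1)]]
      unfolding ideal_colon_def by blast
    finally show "y \<in> saturation R S (D m)"
      unfolding saturation_def using yc S.m_closed[OF t(1) s(1)] by blast
  qed
  then show False using m(2) by blast
qed

text \<open>The ideals \<open>P + b\<^sup>n R\<close>, saturated with respect to \<open>R - Q\<close>, replace the symbolic powers of \<open>Q\<close>.\<close>

theorem principal_ideal_theorem:
  assumes "noetherian_ring R" "primeideal P R" "primeideal Q R" "primeideal Q' R"
    and "P \<subset> Q" "Q \<subset> Q'" "a \<in> Q'"
  shows "\<exists>T. primeideal T R \<and> P \<subseteq> T \<and> T \<subset> Q' \<and> a \<in> T"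
proof (rule ccontr)
  \<comment> \<open>Now \<open>Q'\<close> is the only prime between \<open>P + a R\<close> and
    \<open>Q'\<close>, which is what \<open>saturated_dcc\<close> asks for, while \<open>Q\<close>
    is a prime strictly in between \<open>P\<close> and \<open>Q'\<close> that misses
    \<open>a\<close>.\<close>
  assume neg: "\<not> ?thesis"
  interpret noetherian_ring R by fact
  interpret P: primeideal P R by fact
  interpret Q: primeideal Q R by fact
  interpret Q': primeideal Q' R by fact
  define S where "S = carrier R - Q'"
  interpret S: submonoid S R unfolding S_def by (rule primeideal_compl_submonoid) fact
  interpret SQ: submonoid "carrier R - Q" R by (rule primeideal_compl_submonoid) fact
  have S_SQ: "S \<subseteq> carrier R - Q" unfolding S_def using assms(6) by blast
  have a: "a \<in> carrier R" using assms(7) Q'.Icarr by blast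
  have "a \<notin> Q" using neg assms(3,5,6) by blast
  obtain b where b: "b \<in> Q" "b \<notin> P" using assms(5) by blast
  have bc: "b \<in> carrier R" using b Q.Icarr by blast
  have bn: "b [^] n \<in> carrier R" "b [^] n \<notin> P" for n :: nat
  proof -
    show "b [^] n \<in> carrier R" using bc by simp
    show "b [^] n \<notin> P"
    proof (induction n)
      case 0
      then show ?case using P.one_imp_carrier P.I_notcarr by auto
    next
      case (Suc n)
      then show ?case using P.I_prime[of "b [^] n" b] bc b(2) by auto
    qed
  qed
  define D where "D n = {y \<in> carrier R. \<exists>s\<in>carrier R - Q. \<exists>c\<in>carrier R. s \<otimes> y \<ominus> b [^] n \<otimes> c \<in> P}"
    for n :: nat
  have DI: "y \<in> D n" if "y \<in> carrier R" "s \<in> carrier R - Q" "c \<in> carrier R"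
    "s \<otimes> y \<ominus> b [^] n \<otimes> c \<in> P" for y s c n
    unfolding D_def using that by blast
  have Dsat: "y \<in> D n" if y: "y \<in> carrier R" "s \<in> carrier R - Q" "s \<otimes> y \<in> D n" for y s n
  proof -
    obtain t c where *: "t \<in> carrier R - Q" "c \<in> carrier R" "t \<otimes> (s \<otimes> y) \<ominus> b [^] n \<otimes> c \<in> P"
      using y(3) unfolding D_def by blast
    have "(t \<otimes> s) \<otimes> y \<ominus> b [^] n \<otimes> c \<in> P" using * y by (simp add: m_assoc)
    then show ?thesis using y(1) *(2) SQ.m_closed[OF *(1) y(2)] by (intro DI)
  qed
  have D: "ideal (D n) R" for n
  proof (rule idealI_comm)
    show "D n \<subseteq> carrier R" unfolding D_def by blast
    have "\<one> \<otimes> \<zero> \<ominus> b [^] n \<otimes> \<zero> = \<zero>" using bn(1)[of n] by algebra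
    then have "\<one> \<otimes> \<zero> \<ominus> b [^] n \<otimes> \<zero> \<in> P" using P.zero_closed by (simp only:)
    then show "\<zero> \<in> D n" by (rule DI[OF zero_closed SQ.one_closed zero_closed])
  next
    fix x y assume "x \<in> D n" "y \<in> D n"
    then obtain s c t d where *: "x \<in> carrier R" "y \<in> carrier R" "s \<in> carrier R - Q" "t \<in> carrier R - Q"
      "c \<in> carrier R" "d \<in> carrier R" "s \<otimes> x \<ominus> b [^] n \<otimes> c \<in> P" "t \<otimes> y \<ominus> b [^] n \<otimes> d \<in> P"
      unfolding D_def mem_Collect_eq by (elim conjE bexE) (rule that)
    have sc: "s \<in> carrier R" "t \<in> carrier R" using * by auto
    have "t \<otimes> (s \<otimes> x \<ominus> b [^] n \<otimes> c) \<oplus> s \<otimes> (t \<otimes> y \<ominus> b [^] n \<otimes> d) \<in> P"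
      by (intro P.a_closed P.I_l_closed * sc)
    also have "t \<otimes> (s \<otimes> x \<ominus> b [^] n \<otimes> c) \<oplus> s \<otimes> (t \<otimes> y \<ominus> b [^] n \<otimes> d) =
      (s \<otimes> t) \<otimes> (x \<oplus> y) \<ominus> b [^] n \<otimes> (t \<otimes> c \<oplus> s \<otimes> d)"
      using * sc bn(1)[of n] by algebra
    finally show "x \<oplus> y \<in> D n" using * sc by (intro DI[OF _ SQ.m_closed[OF *(3,4)]]) auto
  next
    fix x r assume "x \<in> D n" and r: "r \<in> carrier R"
    then obtain s c where *: "x \<in> carrier R" "s \<in> carrier R - Q"
      "c \<in> carrier R" "s \<otimes> x \<ominus> b [^] n \<otimes> c \<in> P"
      unfolding D_def by blast
    have sc: "s \<in> carrier R" using * by auto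
    have "r \<otimes> (s \<otimes> x \<ominus> b [^] n \<otimes> c) \<in> P" by (intro P.I_l_closed * r)
    also have "r \<otimes> (s \<otimes> x \<ominus> b [^] n \<otimes> c) = s \<otimes> (r \<otimes> x) \<ominus> b [^] n \<otimes> (r \<otimes> c)"
      using * sc r bn(1)[of n] by algebra
    finally show "r \<otimes> x \<in> D n" using * r by (intro DI[OF _ *(2)]) auto
  qed
  have PD: "P \<subseteq> D n" for n
  proof
    fix x assume x: "x \<in> P"
    have "\<one> \<otimes> x \<ominus> b [^] n \<otimes> \<zero> = x" using bn(1)[of n] P.Icarr[OF x] by algebra
    then have "\<one> \<otimes> x \<ominus> b [^] n \<otimes> \<zero> \<in> P" using x by (simp only:)
    then show "x \<in> D n" by (rule DI[OF P.Icarr[OF x] SQ.one_closed zero_closed])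
  qed
  have Dsuc: "D (Suc n) \<subseteq> D n" for n
  proof
    fix x assume "x \<in> D (Suc n)"
    then obtain s c where *: "x \<in> carrier R" "s \<in> carrier R - Q"
      "c \<in> carrier R" "s \<otimes> x \<ominus> b [^] Suc n \<otimes> c \<in> P"
      unfolding D_def by blast
    have "b [^] Suc n \<otimes> c = b [^] n \<otimes> (b \<otimes> c)" using * bc by (simp add: m_assoc)
    then show "x \<in> D n" using * bc by (intro DI[OF _ *(2), of _ "b \<otimes> c"]) auto
  qed
  then have Ddec: "decseq D" by (rule decseq_SucI)
  define A where "A n = ideal_adjoin R (D n) a" for n
  have A: "\<exists>n. \<forall>m\<ge>n. A n \<subseteq> saturation R S (A m)"
    unfolding S_def
  proof (rule saturated_dcc)
    show "noetherian_ring R" "primeideal Q' R" by fact+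
    show "ideal (ideal_adjoin R P a) R" using ideal_adjoin_ideal[OF P.is_ideal a] .
    show "T = Q'" if "primeideal T R" "ideal_adjoin R P a \<subseteq> T" "T \<subseteq> Q'" for T
      using neg that ideal_adjoin_contains[OF P.is_ideal a] by blast
    show "ideal (A n) R" for n unfolding A_def by (rule ideal_adjoin_ideal[OF D a])
    show "ideal_adjoin R P a \<subseteq> A n" for n unfolding A_def by (rule ideal_adjoin_mono[OF PD])
    show "decseq A" unfolding A_def decseq_def using ideal_adjoin_mono decseqD[OF Ddec] by blast
  qed
  then obtain n where n: "A n \<subseteq> saturation R S (A (Suc n))" using le_SucI by blast
  \<comment> \<open>The coefficient of \<open>a\<close> falls back into \<open>D n\<close>, because
    \<open>D n\<close> is saturated with respect to \<open>R - Q\<close> and \<open>a\<close> is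
    outside \<open>Q\<close>. After localization at \<open>Q'\<close> this reads
    \<open>D n = D (n+1) + a (D n)\<close>, the situation of Nakayama's lemma.\<close>
  have step: "\<exists>s\<in>S. \<exists>z\<in>D (Suc n). \<exists>c\<in>D n. s \<otimes> y = z \<oplus> a \<otimes> c" if y: "y \<in> D n" for y
  proof -
    have "y \<in> A n" using y ideal_adjoin_contains(1)[OF D a] unfolding A_def by blast
    then obtain s z c where *: "s \<in> S" "z \<in> D (Suc n)" "c \<in> carrier R" "s \<otimes> y = z \<oplus> a \<otimes> c"
      using n unfolding A_def ideal_adjoin_def saturation_def by blast
    have zc: "z \<in> carrier R" using * ideal.Icarr[OF D] by blast
    have "a \<otimes> c = s \<otimes> y \<ominus> z" unfolding *(4) using zc a *(3) by algebra
    also have "\<dots> \<in> D n"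
      using ideal.minus_mem[OF D ideal.I_l_closed[OF D y S.mem_carrier] subsetD[OF Dsuc]] * by blast
    finally have "c \<in> D n" using Dsat[OF *(3)] a \<open>a \<notin> Q\<close> by blast
    then show ?thesis using * by blast
  qed
  have "D n \<subseteq> saturation R S (D (Suc n))"
  proof (rule ccontr)
    assume not: "\<not> D n \<subseteq> saturation R S (D (Suc n))"
    \<comment> \<open>a substitute for Nakayama's lemma: a maximal proper saturated ideal \<open>E\<close> between the two
      cannot satisfy \<open>D n = E + a (D n)\<close> up to saturation\<close>
    let ?\<phi> = "\<lambda>E. D (Suc n) \<subseteq> E \<and> E \<subseteq> D n \<and> \<not> D n \<subseteq> saturation R S E"
    have "?\<phi> (D (Suc n))" using Dsuc not by simp
    from ideal_maximal_element[where \<phi> = ?\<phi>, OF D this] obtain E where E': "ideal E R" "?\<phi> E"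
      and max': "\<forall>F. ideal F R \<longrightarrow> ?\<phi> F \<longrightarrow> E \<subseteq> F \<longrightarrow> F = E" by (elim exE conjE) simp
    from E' have E: "ideal E R" "D (Suc n) \<subseteq> E" "E \<subseteq> D n" "\<not> D n \<subseteq> saturation R S E" by simp_all
    from max' have max: "\<And>F. ideal F R \<Longrightarrow> D (Suc n) \<subseteq> F \<Longrightarrow> F \<subseteq> D n \<Longrightarrow>
      \<not> D n \<subseteq> saturation R S F \<Longrightarrow> E \<subseteq> F \<Longrightarrow> F = E" by simp
    interpret E: ideal E R by fact
    obtain w where w: "w \<in> D n" "w \<notin> saturation R S E" using E(4) by blast
    have wc: "w \<in> carrier R" using w ideal.Icarr[OF D] by blast
    obtain s z y where *: "s \<in> S" "z \<in> D (Suc n)" "y \<in> D n" "s \<otimes> w = z \<oplus> a \<otimes> y"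
      using step[OF w(1)] by blast
    have yc: "y \<in> carrier R" using * ideal.Icarr[OF D] by blast
    have ay: "a \<otimes> y \<in> carrier R" using a yc by simp
    have sat: "a \<otimes> y \<notin> saturation R S E"
    proof
      assume "a \<otimes> y \<in> saturation R S E"
      then obtain t where t: "t \<in> S" "t \<otimes> (a \<otimes> y) \<in> E" unfolding saturation_def by blast
      have "(t \<otimes> s) \<otimes> w = t \<otimes> z \<oplus> t \<otimes> (a \<otimes> y)"
        using * t S.mem_carrier wc ay ideal.Icarr[OF D *(2)] by (simp add: m_assoc r_distr)
      then have "(t \<otimes> s) \<otimes> w \<in> E" using E.a_closed[OF E.I_l_closed[OF subsetD[OF E(2) *(2)] S.mem_carrier[OF t(1)]] t(2)] by simp
      then show False using w(2) wc S.m_closed[OF t(1) *(1)] unfolding saturation_def by blast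
    qed
    then have "a \<otimes> y \<notin> E"
      using saturationI[OF ay S.one_closed] ay by auto
    then have "ideal_adjoin R E (a \<otimes> y) \<noteq> E" using ideal_adjoin_contains(2)[OF E(1) ay] by blast
    moreover have "ideal_adjoin R E (a \<otimes> y) \<subseteq> D n"
      using ideal_adjoin_minimal[OF D E(3)] ideal.I_l_closed[OF D *(3) a] by blast
    ultimately have "D n \<subseteq> saturation R S (ideal_adjoin R E (a \<otimes> y))"
      using max[OF ideal_adjoin_ideal[OF E(1) ay]] ideal_adjoin_contains(1)[OF E(1) ay] E(2) by blast
    then obtain t e c where t: "t \<in> S" "e \<in> E" "c \<in> carrier R" "t \<otimes> y = e \<oplus> (a \<otimes> y) \<otimes> c"
      using *(3) unfolding saturation_def ideal_adjoin_def by blast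
    have tc: "t \<in> carrier R" using t S.mem_carrier by blast
    \<comment> \<open>The factor \<open>t - a c\<close> corresponds to the unit
      \<open>1 - a c\<close> in Nakayama's lemma: \<open>t\<close> is outside \<open>Q'\<close> and
      \<open>a\<close> is inside, so the difference belongs to \<open>S\<close> and can be absorbed
      by the saturation.\<close>
    have "(t \<ominus> a \<otimes> c) \<otimes> y = t \<otimes> y \<ominus> (a \<otimes> y) \<otimes> c" using tc a t(3) yc by algebra
    also have "\<dots> = e" unfolding t(4) using E.Icarr[OF t(2)] a t(3) yc by algebra
    finally have 1: "(t \<ominus> a \<otimes> c) \<otimes> y \<in> E" using t by simp
    have "t \<ominus> a \<otimes> c \<notin> Q'"
    proof
      assume "t \<ominus> a \<otimes> c \<in> Q'"
      then have "(t \<ominus> a \<otimes> c) \<oplus> a \<otimes> c \<in> Q'"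
        using Q'.a_closed Q'.I_r_closed[OF assms(7) t(3)] by blast
      also have "(t \<ominus> a \<otimes> c) \<oplus> a \<otimes> c = t" using tc a t(3) by algebra
      finally show False using t(1) unfolding S_def by blast
    qed
    then have 2: "t \<ominus> a \<otimes> c \<in> S" unfolding S_def using tc a t(3) by simp
    have "(t \<ominus> a \<otimes> c) \<otimes> (a \<otimes> y) = a \<otimes> ((t \<ominus> a \<otimes> c) \<otimes> y)" using tc a t(3) yc by algebra
    then have "(t \<ominus> a \<otimes> c) \<otimes> (a \<otimes> y) \<in> E" using E.I_l_closed[OF 1 a] by simp
    then show False using sat 2 ay unfolding saturation_def by blast
  qed
  moreover have "b [^] n \<in> D n"
  proof -
    have "\<one> \<otimes> b [^] n \<ominus> b [^] n \<otimes> \<one> = \<zero>" using bn(1)[of n] by algebra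
    then have "\<one> \<otimes> b [^] n \<ominus> b [^] n \<otimes> \<one> \<in> P" using P.zero_closed by (simp only:)
    then show ?thesis by (rule DI[OF bn(1) SQ.one_closed one_closed])
  qed
  ultimately obtain s where s: "s \<in> S" "s \<otimes> b [^] n \<in> D (Suc n)" unfolding saturation_def by blast
  then have "b [^] n \<in> D (Suc n)" using Dsat[OF bn(1)] S_SQ by blast
  then obtain t c where t: "t \<in> carrier R - Q" "c \<in> carrier R" "t \<otimes> b [^] n \<ominus> b [^] Suc n \<otimes> c \<in> P"
    unfolding D_def by blast
  have tc: "t \<in> carrier R" using t by blast
  have "b [^] Suc n \<otimes> c = b [^] n \<otimes> (b \<otimes> c)" using t bc by (simp add: m_assoc)
  \<comment> \<open>The power \<open>b^n\<close> cancels modulo the prime \<open>P\<close>. This is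
    the gain from powers of one element outside \<open>P\<close>: \<open>t - b c\<close> in
    \<open>P\<close> forces \<open>t\<close> into \<open>Q\<close> at once.\<close>
  then have "b [^] n \<otimes> (t \<ominus> b \<otimes> c) = t \<otimes> b [^] n \<ominus> b [^] Suc n \<otimes> c"
    using tc t(2) bc bn(1)[of n] by algebra
  then have "t \<ominus> b \<otimes> c \<in> P"
    using t(3) P.I_prime[of "b [^] n" "t \<ominus> b \<otimes> c"] bn tc t(2) bc by auto
  then have "(t \<ominus> b \<otimes> c) \<oplus> b \<otimes> c \<in> Q"
    using assms(5) Q.a_closed Q.I_r_closed[OF b(1) t(2)] by blast
  also have "(t \<ominus> b \<otimes> c) \<oplus> b \<otimes> c = t" using tc t(2) bc by algebra
  finally show False using t(1) by blast
qed

end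

section \<open>Prime ideals of polynomial rings\<close>

context ring
begin

lemma ideal_finsum_mem:
  assumes "ideal E R" "\<And>i. i \<in> A \<Longrightarrow> f i \<in> E"
  shows "finsum R f A \<in> E"
proof -
  interpret E: ideal E R by fact
  show ?thesis
    using assms(2)
  proof (induction A rule: infinite_finite_induct)
    case (insert x F)
    then have "f \<in> F \<rightarrow> carrier R" "f x \<in> carrier R" using E.Icarr by auto
    then show ?case using insert by (simp add: E.a_closed)
  qed auto
qed

end

context UP
begin

abbreviation "pcoeff \<equiv> up_ring.coeff P"

abbreviation "pmonom \<equiv> up_ring.monom P"

end

context UP_ring
begin

lemma UP_ex:
  assumes "\<And>i. \<phi> i \<in> carrier R" "\<And>i. i > n \<Longrightarrow> \<phi> i = \<zero>"
  shows "\<exists>h\<in>carrier P. \<forall>i. pcoeff h i = \<phi> i"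
proof -
  have "\<phi> \<in> up R" using assms by (intro mem_upI exI[of _ n] bound.intro) simp_all
  then have "\<phi> \<in> carrier P \<and> (\<forall>i. pcoeff \<phi> i = \<phi> i)" unfolding P_def UP_def by simp
  then show ?thesis by blast
qed

end

context UP_cring
begin

section \<open>Ideals of leading coefficients and Hilbert's basis theorem\<close>

lemma smult_mem_ideal:
  assumes "ideal E P" "f \<in> E" "a \<in> carrier R"
  shows "a \<odot>\<^bsub>P\<^esub> f \<in> E"
  using ideal.I_l_closed[OF assms(1,2) monom_closed[OF assms(3), of 0]]
    monom_mult_is_smult[OF assms(3) ideal.Icarr[OF assms(1,2)]] by simp

text \<open>The degree is only bounded by \<open>n\<close>, so polynomials of smaller degree
  contribute the coefficient zero. This makes the set an ideal without a case distinction for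
  cancelling leading terms.\<close>

definition lead_ideal :: "(nat \<Rightarrow> 'a) set \<Rightarrow> nat \<Rightarrow> 'a set"
  where "lead_ideal E n = {pcoeff f n | f. f \<in> E \<and> deg R f \<le> n}"

lemma lead_ideal_ideal:
  assumes "ideal E P"
  shows "ideal (lead_ideal E n) R"
proof -
  interpret E: ideal E P by fact
  show ?thesis
  proof (rule R.idealI_comm)
    show "lead_ideal E n \<subseteq> carrier R" unfolding lead_ideal_def using E.Icarr by auto
    have "\<zero> = pcoeff \<zero>\<^bsub>P\<^esub> n" by simp
    then show "\<zero> \<in> lead_ideal E n" unfolding lead_ideal_def
      using E.zero_closed deg_zero by (intro CollectI exI[of _ "\<zero>\<^bsub>P\<^esub>"]) auto
  next
    fix x y assume "x \<in> lead_ideal E n" "y \<in> lead_ideal E n"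
    then obtain f g where *: "f \<in> E" "g \<in> E" "deg R f \<le> n" "deg R g \<le> n" "x = pcoeff f n" "y = pcoeff g n"
      unfolding lead_ideal_def by auto
    moreover have c: "f \<in> carrier P" "g \<in> carrier P" using * E.Icarr by auto
    ultimately have "x \<oplus> y = pcoeff (f \<oplus>\<^bsub>P\<^esub> g) n" by simp
    moreover have "deg R (f \<oplus>\<^bsub>P\<^esub> g) \<le> n" using * by (intro order_trans[OF deg_add[OF c]]) simp
    ultimately show "x \<oplus> y \<in> lead_ideal E n"
      unfolding lead_ideal_def using E.a_closed[OF *(1,2)] by blast
  next
    fix x r assume "x \<in> lead_ideal E n" and r: "r \<in> carrier R"
    then obtain f where *: "f \<in> E" "deg R f \<le> n" "x = pcoeff f n"
      unfolding lead_ideal_def by auto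
    then have "r \<otimes> x = pcoeff (r \<odot>\<^bsub>P\<^esub> f) n" "deg R (r \<odot>\<^bsub>P\<^esub> f) \<le> n"
      using E.Icarr deg_smult_decr[of r f] r by auto
    then show "r \<otimes> x \<in> lead_ideal E n"
      unfolding lead_ideal_def using smult_mem_ideal[OF assms *(1) r] by blast
  qed
qed

lemma lead_ideal_Suc:
  assumes "ideal E P"
  shows "lead_ideal E n \<subseteq> lead_ideal E (Suc n)"
proof
  interpret E: ideal E P by fact
  fix x assume "x \<in> lead_ideal E n"
  then obtain f where *: "f \<in> E" "deg R f \<le> n" "x = pcoeff f n"
    unfolding lead_ideal_def by auto
  let ?g = "pmonom \<one> 1 \<otimes>\<^bsub>P\<^esub> f"
  have f: "f \<in> carrier P" using * E.Icarr by blast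
  have "?g \<in> E" using E.I_l_closed[OF *(1)] by simp
  moreover have "deg R ?g \<le> Suc n"
    using deg_mult_ring[OF monom_closed[OF R.one_closed, of 1] f] deg_monom_le[OF R.one_closed, of 1] *(2) by simp
  moreover have "pcoeff ?g (Suc n) = x"
    using coeff_monom_mult[OF R.one_closed f, of 1 n] *(3) f by simp
  ultimately show "x \<in> lead_ideal E (Suc n)" unfolding lead_ideal_def by blast
qed

lemma lead_ideal_le:
  assumes "ideal E P" "m \<le> n"
  shows "lead_ideal E m \<subseteq> lead_ideal E n"
  using lift_Suc_mono_le[of "lead_ideal E" m n] lead_ideal_Suc[OF assms(1)] assms(2) by blast

text \<open>Induction on a degree bound: subtracting an element of \<open>F\<close> with the same
  coefficient in the top degree lowers the bound, and \<open>F\<close> being inside \<open>E\<close>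
  keeps the difference in \<open>E\<close>.\<close>

lemma lead_ideals_determine:
  assumes "ideal E P" "ideal F P" "F \<subseteq> E" "\<And>n. lead_ideal E n \<subseteq> lead_ideal F n"
  shows "E \<subseteq> F"
proof -
  interpret E: ideal E P by fact
  interpret F: ideal F P by fact
  have "f \<in> F" if "f \<in> E" "deg R f \<le> n" for f n
    using that
  proof (induction n arbitrary: f)
    case 0
    then have "pcoeff f 0 \<in> lead_ideal F 0" using assms(4)[of 0] unfolding lead_ideal_def by blast
    then obtain g where g: "g \<in> F" "deg R g \<le> 0" "pcoeff f 0 = pcoeff g 0" unfolding lead_ideal_def by blast
    have c: "f \<in> carrier P" "g \<in> carrier P" using 0 g E.Icarr F.Icarr by auto
    have "f = g"
    proof (rule up_eqI[OF _ c])
      show "pcoeff f i = pcoeff g i" for i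
      proof (cases "i = 0")
        case True
        then show ?thesis using g(3) by simp
      next
        case False
        then show ?thesis using 0 g c deg_aboveD by simp
      qed
    qed
    then show ?case using g by simp
  next
    case (Suc n)
    then have "pcoeff f (Suc n) \<in> lead_ideal F (Suc n)" using assms(4)[of "Suc n"] unfolding lead_ideal_def by blast
    then obtain g where g: "g \<in> F" "deg R g \<le> Suc n" "pcoeff f (Suc n) = pcoeff g (Suc n)" unfolding lead_ideal_def by blast
    have c: "f \<in> carrier P" "g \<in> carrier P" using Suc g E.Icarr F.Icarr by auto
    have "f \<ominus>\<^bsub>P\<^esub> g \<in> E" using Suc.prems(1) g(1) assms(3) by (intro E.minus_mem) auto
    moreover have "deg R (f \<ominus>\<^bsub>P\<^esub> g) \<le> n"
    proof (rule deg_aboveI)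
      fix m assume m: "n < m"
      show "pcoeff (f \<ominus>\<^bsub>P\<^esub> g) m = \<zero>"
      proof (cases "m = Suc n")
        case True
        then show ?thesis using g(3) c by (simp add: R.r_right_minus_eq)
      next
        case False
        then have "pcoeff f m = \<zero>" "pcoeff g m = \<zero>" using m Suc.prems(2) g(2) c deg_aboveD by auto
        then show ?thesis using c by (simp add: R.r_right_minus_eq)
      qed
    qed (use c in auto)
    ultimately have "f \<ominus>\<^bsub>P\<^esub> g \<in> F" using Suc.IH by blast
    then have "(f \<ominus>\<^bsub>P\<^esub> g) \<oplus>\<^bsub>P\<^esub> g \<in> F" using g(1) F.a_closed by blast
    moreover have "(f \<ominus>\<^bsub>P\<^esub> g) \<oplus>\<^bsub>P\<^esub> g = f" using c by algebra
    ultimately show ?case by simp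
  qed
  then show ?thesis by blast
qed

text \<open>The Noetherian property enters twice: the ideals of leading coefficients become constant
  from some degree \<open>N\<close> on, and each of them up to \<open>N\<close> is finitely
  generated. Lifting these finitely many generators to \<open>E\<close> gives an ideal with the same
  ideals of leading coefficients.\<close>

theorem hilbert_basis:
  assumes "noetherian_ring R"
  shows "noetherian_ring P"
proof (rule P.noetherian_ringI)
  interpret N: noetherian_ring R by fact
  fix E assume E: "ideal E P"
  interpret E: ideal E P by fact
  let ?L = "lead_ideal E"
  have "subset.chain {I. ideal I R} (range ?L)"
    unfolding subset_chain_def using lead_ideal_ideal[OF E] lead_ideal_le[OF E]
    by (auto) (metis nat_le_linear subsetD)
  then have "\<Union>(range ?L) \<in> range ?L" by (intro N.ideal_chain_is_trivial) auto
  then obtain N where N: "\<Union>(range ?L) = ?L N" by blast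
  have "\<exists>A\<subseteq>carrier R. finite A \<and> ?L n = Idl\<^bsub>R\<^esub> A" for n
    using N.finetely_gen lead_ideal_ideal[OF E] by blast
  then obtain A where A: "\<And>n. A n \<subseteq> carrier R" "\<And>n. finite (A n)" "\<And>n. ?L n = Idl\<^bsub>R\<^esub> (A n)"
    by metis
  have "A n \<subseteq> ?L n" for n using R.genideal_self[OF A(1)] A(3) by simp
  then have "\<forall>n. \<forall>a\<in>A n. \<exists>f. f \<in> E \<and> deg R f \<le> n \<and> pcoeff f n = a"
    unfolding lead_ideal_def by blast
  then obtain g where g: "\<And>n a. a \<in> A n \<Longrightarrow> g n a \<in> E" "\<And>n a. a \<in> A n \<Longrightarrow> deg R (g n a) \<le> n"
    "\<And>n a. a \<in> A n \<Longrightarrow> pcoeff (g n a) n = a"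
    by metis
  define G where "G = (\<Union>n\<in>{..N}. g n ` A n)"
  have G: "G \<subseteq> E" "finite G" unfolding G_def using g A(2) by auto
  then have Gc: "G \<subseteq> carrier P" using E.Icarr by blast
  define F where "F = Idl\<^bsub>P\<^esub> G"
  have F: "ideal F P" unfolding F_def by (rule P.genideal_ideal[OF Gc])
  have GF: "G \<subseteq> F" unfolding F_def by (rule P.genideal_self[OF Gc])
  have FE: "F \<subseteq> E" unfolding F_def by (rule P.genideal_minimal[OF E G(1)])
  have le: "?L n \<subseteq> lead_ideal F n" if "n \<le> N" for n
    unfolding A(3)
  proof (rule R.genideal_minimal[OF lead_ideal_ideal[OF F]], rule subsetI)
    fix a assume a: "a \<in> A n"
    then have "g n a \<in> F" using GF that unfolding G_def by auto
    then show "a \<in> lead_ideal F n" unfolding lead_ideal_def using g(2,3)[OF a] by force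
  qed
  have "?L n \<subseteq> lead_ideal F n" for n
  proof (cases "n \<le> N")
    case False
    then have "?L n \<subseteq> lead_ideal F N" using N le[of N] by auto
    then show ?thesis using lead_ideal_le[OF F, of N n] False by auto
  qed (use le in simp)
  then have "E \<subseteq> F" by (rule lead_ideals_determine[OF E F FE])
  then have "E = Idl\<^bsub>P\<^esub> G" using FE unfolding F_def by blast
  then show "\<exists>A\<subseteq>carrier P. finite A \<and> E = Idl\<^bsub>P\<^esub> A" using Gc G(2) by blast
qed

section \<open>Extension and contraction of ideals between a ring and its polynomial ring\<close>

definition extension :: "'a set \<Rightarrow> (nat \<Rightarrow> 'a) set"
  where "extension I = {f \<in> carrier P. \<forall>i. pcoeff f i \<in> I}"

definition contraction :: "(nat \<Rightarrow> 'a) set \<Rightarrow> 'a set"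
  where "contraction Q = {a \<in> carrier R. pmonom a 0 \<in> Q}"

text \<open>So \<open>k\<close> is the degree of the image of \<open>f\<close> in
  \<open>(R/I)[X]\<close>, expressed by coefficients so that the quotient ring need not
  appear.\<close>

definition top_coeff :: "'a set \<Rightarrow> (nat \<Rightarrow> 'a) \<Rightarrow> nat \<Rightarrow> bool"
  where "top_coeff I f k \<longleftrightarrow> pcoeff f k \<notin> I \<and> (\<forall>j>k. pcoeff f j \<in> I)"

lemma contraction_prime: "primeideal Q P \<Longrightarrow> primeideal (contraction Q) R"
proof -
  assume Q: "primeideal Q P"
  interpret h: ring_hom_ring R P "\<lambda>a. pmonom a 0"
    by (rule ring_hom_ringI2[OF R.ring_axioms P.ring_axioms const_ring_hom])
  show ?thesis unfolding contraction_def by (rule h.primeideal_vimage[OF R.cring_axioms Q])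
qed

lemma contraction_mono: "Q \<subseteq> Q' \<Longrightarrow> contraction Q \<subseteq> contraction Q'"
  unfolding contraction_def by blast

lemma extension_ideal:
  assumes "ideal I R" shows "ideal (extension I) P"
proof -
  interpret I: ideal I R by fact
  show ?thesis
  proof (rule P.idealI_comm)
    fix f g assume f: "f \<in> extension I" and g: "g \<in> carrier P"
    have "(\<Oplus>i\<in>{..n}. pcoeff g i \<otimes> pcoeff f (n - i)) \<in> I" for n
      using f g unfolding extension_def
      by (intro R.ideal_finsum_mem assms I.I_l_closed) auto
    then show "g \<otimes>\<^bsub>P\<^esub> f \<in> extension I" using f g unfolding extension_def by simp
  qed (auto simp: extension_def I.a_closed I.zero_closed)
qed

text \<open>All summands of the convolution except the one for \<open>(k, l)\<close> lie in the
  prime \<open>I\<close>. The condition on the indices covers both applications: the lowest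
  coefficients outside \<open>I\<close>, which show that extensions of primes are prime, and the
  highest ones, which show that degrees modulo \<open>I\<close> add up.\<close>

lemma coeff_mult_not_mem:
  assumes I: "primeideal I R" and fg: "f \<in> carrier P" "g \<in> carrier P"
    and "pcoeff f k \<notin> I" "pcoeff g l \<notin> I"
    and "\<And>i. i \<le> k + l \<Longrightarrow> i \<noteq> k \<Longrightarrow> pcoeff f i \<in> I \<or> pcoeff g (k + l - i) \<in> I"
  shows "pcoeff (f \<otimes>\<^bsub>P\<^esub> g) (k + l) \<notin> I"
proof
  interpret I: primeideal I R by fact
  let ?t = "\<lambda>i. pcoeff f i \<otimes> pcoeff g (k + l - i)"
  assume "pcoeff (f \<otimes>\<^bsub>P\<^esub> g) (k + l) \<in> I"
  then have "(\<Oplus>i\<in>{..k+l}. ?t i) \<in> I" using fg by simp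
  also have "{..k+l} = insert k ({..k+l} - {k})" by auto
  also have "(\<Oplus>i\<in>insert k ({..k+l} - {k}). ?t i) = ?t k \<oplus> (\<Oplus>i\<in>{..k+l} - {k}. ?t i)"
    using fg by (intro R.finsum_insert) auto
  finally have 1: "?t k \<oplus> (\<Oplus>i\<in>{..k+l} - {k}. ?t i) \<in> I" .
  have 2: "(\<Oplus>i\<in>{..k+l} - {k}. ?t i) \<in> I"
  proof (rule R.ideal_finsum_mem[OF I.is_ideal])
    fix i assume "i \<in> {..k+l} - {k}"
    then show "?t i \<in> I" using assms(6)[of i] fg I.I_l_closed I.I_r_closed by auto
  qed
  have c: "?t k \<in> carrier R" "(\<Oplus>i\<in>{..k+l} - {k}. ?t i) \<in> carrier R" using fg 2 I.Icarr by auto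
  have "(?t k \<oplus> (\<Oplus>i\<in>{..k+l} - {k}. ?t i)) \<ominus> (\<Oplus>i\<in>{..k+l} - {k}. ?t i) \<in> I"
    by (rule I.minus_mem[OF 1 2])
  also have "(?t k \<oplus> (\<Oplus>i\<in>{..k+l} - {k}. ?t i)) \<ominus> (\<Oplus>i\<in>{..k+l} - {k}. ?t i) = ?t k"
    using c by (simp add: R.minus_eq R.a_assoc R.r_neg)
  finally have "pcoeff f k \<otimes> pcoeff g l \<in> I" by simp
  then show False using I.I_prime fg assms(4,5) by (meson coeff_closed)
qed

lemma extension_prime:
  assumes "primeideal I R" shows "primeideal (extension I) P"
proof (rule primeidealI)
  interpret I: primeideal I R by fact
  show "ideal (extension I) P" by (rule extension_ideal[OF I.is_ideal])
  show "cring P" by (rule P.cring_axioms)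
  have "\<one>\<^bsub>P\<^esub> \<notin> extension I"
  proof
    assume "\<one>\<^bsub>P\<^esub> \<in> extension I"
    then have "pcoeff \<one>\<^bsub>P\<^esub> 0 \<in> I" unfolding extension_def by blast
    then show False using I.one_imp_carrier I.I_notcarr by simp
  qed
  then show "carrier P \<noteq> extension I" by auto
  fix f g assume fg: "f \<in> carrier P" "g \<in> carrier P" "f \<otimes>\<^bsub>P\<^esub> g \<in> extension I"
  show "f \<in> extension I \<or> g \<in> extension I"
  proof (rule ccontr)
    assume "\<not> ?thesis"
    then have ex: "\<exists>k. pcoeff f k \<notin> I" "\<exists>l. pcoeff g l \<notin> I" using fg unfolding extension_def by auto
    define k where "k = (LEAST k. pcoeff f k \<notin> I)"
    define l where "l = (LEAST l. pcoeff g l \<notin> I)"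
    have k: "pcoeff f k \<notin> I" "\<And>i. i < k \<Longrightarrow> pcoeff f i \<in> I"
      unfolding k_def using LeastI_ex[OF ex(1)] not_less_Least by blast+
    have l: "pcoeff g l \<notin> I" "\<And>i. i < l \<Longrightarrow> pcoeff g i \<in> I"
      unfolding l_def using LeastI_ex[OF ex(2)] not_less_Least by blast+
    have "pcoeff (f \<otimes>\<^bsub>P\<^esub> g) (k + l) \<notin> I"
    proof (rule coeff_mult_not_mem[OF assms fg(1,2) k(1) l(1)])
      fix i assume "i \<le> k + l" "i \<noteq> k"
      then consider "i < k" | "k + l - i < l" by linarith
      then show "pcoeff f i \<in> I \<or> pcoeff g (k + l - i) \<in> I" using k(2) l(2) by cases auto
    qed
    then show False using fg(3) unfolding extension_def by blast
  qed
qed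

lemma contraction_extension:
  assumes "ideal I R" shows "contraction (extension I) = I"
  using ideal.Icarr[OF assms] additive_subgroup.zero_closed[OF ideal.axioms(1)[OF assms]]
  unfolding contraction_def extension_def by (force split: if_splits)

lemma extension_subset:
  assumes "ideal Q P" "I \<subseteq> contraction Q"
  shows "extension I \<subseteq> Q"
proof
  interpret Q: ideal Q P by fact
  fix f assume f: "f \<in> extension I"
  have "pmonom (pcoeff f i) i \<in> Q" for i
  proof -
    have c: "pcoeff f i \<in> carrier R" "pmonom (pcoeff f i) 0 \<in> Q"
      using f assms(2) unfolding extension_def contraction_def by auto
    have "pmonom (pcoeff f i) i = pmonom (pcoeff f i) 0 \<otimes>\<^bsub>P\<^esub> pmonom \<one> i"
      using monom_mult[OF c(1) R.one_closed, of 0 i] c(1) by simp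
    then show ?thesis using Q.I_r_closed[OF c(2)] by simp
  qed
  then have "(\<Oplus>\<^bsub>P\<^esub> i \<in> {..deg R f}. pmonom (pcoeff f i) i) \<in> Q"
    by (intro P.ideal_finsum_mem assms)
  then show "f \<in> Q" using up_repr[of f] f unfolding extension_def by simp
qed

lemma top_coeff_ex:
  assumes "f \<in> carrier P" "f \<notin> extension I" "\<zero> \<in> I"
  shows "\<exists>k\<le>deg R f. top_coeff I f k"
proof -
  have ex: "\<exists>k. pcoeff f k \<notin> I" using assms unfolding extension_def by blast
  have le: "k \<le> deg R f" if "pcoeff f k \<notin> I" for k
    using that assms(1,3) deg_aboveD by (metis not_le)
  define k where "k = Max {k. pcoeff f k \<notin> I}"
  have fin: "finite {k. pcoeff f k \<notin> I}" by (rule finite_subset[of _ "{..deg R f}"]) (use le in auto)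
  have "pcoeff f k \<notin> I" unfolding k_def using Max_in[OF fin] ex by blast
  moreover have "pcoeff f j \<in> I" if "j > k" for j
    using Max_ge[OF fin, of j] that unfolding k_def by (meson leD mem_Collect_eq)
  ultimately show ?thesis unfolding top_coeff_def using le by blast
qed

text \<open>The terms above degree \<open>k\<close> have coefficients in the contraction, so they
  already belong to \<open>Q\<close> and can be cut off. The degree modulo the contraction thereby
  becomes the degree itself.\<close>

lemma truncate:
  assumes "ideal Q P" "f \<in> Q" "top_coeff (contraction Q) f k"
  shows "\<exists>g\<in>Q. deg R g = k \<and> top_coeff (contraction Q) g k"
proof -
  interpret Q: ideal Q P by fact
  have z: "\<zero> \<in> contraction Q" unfolding contraction_def using Q.zero_closed by simp
  have f: "f \<in> carrier P" using assms(2) Q.Icarr by blast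
  obtain g where g: "g \<in> carrier P" "\<And>i. pcoeff g i = (if i \<le> k then pcoeff f i else \<zero>)"
  proof -
    have "\<exists>g\<in>carrier P. \<forall>i. pcoeff g i = (if i \<le> k then pcoeff f i else \<zero>)"
      by (rule UP_ex[where n = k]) (use f in auto)
    then show ?thesis using that by blast
  qed
  have "f \<ominus>\<^bsub>P\<^esub> g \<in> extension (contraction Q)"
    unfolding extension_def
    using f g z assms(3) unfolding top_coeff_def by (auto simp: R.minus_eq R.r_neg)
  then have "f \<ominus>\<^bsub>P\<^esub> g \<in> Q" using extension_subset[OF assms(1) order_refl] by blast
  then have "f \<ominus>\<^bsub>P\<^esub> (f \<ominus>\<^bsub>P\<^esub> g) \<in> Q" using Q.minus_mem assms(2) by blast
  also have "f \<ominus>\<^bsub>P\<^esub> (f \<ominus>\<^bsub>P\<^esub> g) = g" using f g(1) by algebra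
  finally have gQ: "g \<in> Q" .
  have top: "top_coeff (contraction Q) g k" using assms(3) z g(2) unfolding top_coeff_def by auto
  then have "pcoeff g k \<noteq> \<zero>" unfolding top_coeff_def using z by auto
  then have "deg R g = k" using g by (intro le_antisym deg_aboveI deg_belowI) auto
  then show ?thesis using gQ top by blast
qed

text \<open>A prime \<open>Q\<close> over \<open>p\<close> always contains \<open>p R[X]\<close>. It
  is upper if the inclusion is strict, that is, if \<open>Q\<close> corresponds to a nonzero prime
  of \<open>k(p)[X]\<close>, where \<open>k(p)\<close> is the residue field of
  \<open>p\<close>.\<close>

definition upper :: "(nat \<Rightarrow> 'a) set \<Rightarrow> bool"
  where "upper Q \<longleftrightarrow> \<not> Q \<subseteq> extension (contraction Q)"

text \<open>With \<open>p\<close> the contraction of \<open>Q\<close>, the element \<open>f\<close>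
  stands in for a generator of the ideal that \<open>Q\<close> generates in \<open>k(p)[X]\<close>.
  Its leading coefficient is outside \<open>p\<close>, so its degree is also its degree modulo
  \<open>p\<close>.\<close>

lemma upper_minimal:
  assumes "ideal Q P" "upper Q"
  shows "\<exists>f\<in>Q. top_coeff (contraction Q) f (deg R f) \<and>
    (\<forall>h\<in>Q. \<forall>k. top_coeff (contraction Q) h k \<longrightarrow> deg R f \<le> k)"
proof -
  interpret Q: ideal Q P by fact
  have z: "\<zero> \<in> contraction Q" unfolding contraction_def using Q.zero_closed by simp
  have ex: "\<exists>k. \<exists>h\<in>Q. top_coeff (contraction Q) h k"
    using assms(2) top_coeff_ex[OF Q.Icarr _ z] unfolding upper_def by blast
  define d where "d = (LEAST k. \<exists>h\<in>Q. top_coeff (contraction Q) h k)"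
  obtain h where "h \<in> Q" "top_coeff (contraction Q) h d"
    using LeastI_ex[OF ex] unfolding d_def by blast
  then obtain f where f: "f \<in> Q" "deg R f = d" "top_coeff (contraction Q) f d"
    using truncate[OF assms(1)] by blast
  have "d \<le> k" if "h \<in> Q" "top_coeff (contraction Q) h k" for h k
    unfolding d_def using that by (intro Least_le) blast
  then show ?thesis using f by blast
qed

text \<open>Primes over a fixed \<open>p\<close> correspond to primes of the principal ideal domain
  \<open>k(p)[X]\<close>, so a strict inclusion can only go from \<open>p R[X]\<close> to an upper
  prime. The proof carries out the Euclidean argument over \<open>R\<close>: pseudo-division by
  \<open>f'\<close> replaces division, and powers of the leading coefficient \<open>c\<close>, which
  is outside \<open>p\<close>, replace units of the field.\<close>

lemma upper_if_same_contraction: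
  assumes "primeideal Q P" "primeideal Q' P" "Q \<subset> Q'" "contraction Q = contraction Q'"
  shows "\<not> upper Q" "upper Q'"
proof -
  interpret Q: primeideal Q P by fact
  interpret Q': primeideal Q' P by fact
  define p where "p = contraction Q"
  have pQ': "contraction Q' = p" using assms(4) p_def by simp
  have p: "primeideal p R" unfolding p_def by (rule contraction_prime) fact
  interpret p: primeideal p R by fact
  have ext: "extension p \<subseteq> Q" unfolding p_def using extension_subset[OF Q.is_ideal] by blast
  show "upper Q'" unfolding upper_def pQ' using ext assms(3) by blast
  then obtain f' where f': "f' \<in> Q'" "top_coeff p f' (deg R f')"
    and min': "\<And>h k. h \<in> Q' \<Longrightarrow> top_coeff p h k \<Longrightarrow> deg R f' \<le> k"
    using upper_minimal[OF Q'.is_ideal] pQ' by auto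
  define c where "c = pcoeff f' (deg R f')"
  have f'c: "f' \<in> carrier P" using f' Q'.Icarr by blast
  have c: "c \<in> carrier R" "c \<notin> p" using f' f'c unfolding c_def top_coeff_def by auto
  have cn: "c [^] n \<in> carrier R" "c [^] n \<notin> p" for n :: nat
  proof -
    show "c [^] n \<in> carrier R" using c by simp
    show "c [^] n \<notin> p"
    proof (induction n)
      case 0
      then show ?case using p.one_imp_carrier p.I_notcarr by auto
    next
      case (Suc n)
      then show ?case using p.I_prime[of "c [^] n" c] c by auto
    qed
  qed
  have f'nz: "f' \<noteq> \<zero>\<^bsub>P\<^esub>" using c p.zero_closed unfolding c_def by auto
  have d': "deg R f' \<noteq> 0"
  proof
    assume "deg R f' = 0"
    then have "f' = pmonom c 0" using deg_zero_impl_monom[OF f'c] unfolding c_def by simp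
    then have "c \<in> contraction Q'" unfolding contraction_def using c f' by simp
    then show False using c pQ' by simp
  qed
  \<comment> \<open>The remainder lies in \<open>Q'\<close> and is zero or of smaller degree than
    \<open>f'\<close>. By minimality of \<open>f'\<close> none of its coefficients is outside
    \<open>p\<close>.\<close>
  have div: "\<exists>q r (k::nat). q \<in> carrier P \<and> r \<in> extension p \<and> r \<in> Q \<and>
     c [^] k \<odot>\<^bsub>P\<^esub> g = f' \<otimes>\<^bsub>P\<^esub> q \<oplus>\<^bsub>P\<^esub> r" if g: "g \<in> Q'" for g
  proof -
    have gc: "g \<in> carrier P" using g Q'.Icarr by blast
    obtain q r and k :: nat where *: "q \<in> carrier P" "r \<in> carrier P"
      "c [^] k \<odot>\<^bsub>P\<^esub> g = f' \<otimes>\<^bsub>P\<^esub> q \<oplus>\<^bsub>P\<^esub> r" "r = \<zero>\<^bsub>P\<^esub> \<or> deg R r < deg R f'"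
      using long_div_theorem[OF f'c gc f'nz] unfolding c_def by blast
    have 1: "c [^] k \<odot>\<^bsub>P\<^esub> g \<in> Q'" using smult_mem_ideal[OF Q'.is_ideal g cn(1)] .
    have 2: "f' \<otimes>\<^bsub>P\<^esub> q \<in> Q'" using Q'.I_r_closed[OF f'(1) *(1)] .
    have "(c [^] k \<odot>\<^bsub>P\<^esub> g) \<ominus>\<^bsub>P\<^esub> (f' \<otimes>\<^bsub>P\<^esub> q) = r" unfolding *(3) using * f'c by algebra
    then have "r \<in> Q'" using Q'.minus_mem[OF 1 2] by simp
    have "r \<in> extension p"
    proof (rule ccontr)
      assume "r \<notin> extension p"
      then obtain j where "j \<le> deg R r" "top_coeff p r j" using top_coeff_ex[OF *(2)] p.zero_closed by blast
      then have "deg R f' \<le> deg R r" using min'[OF \<open>r \<in> Q'\<close>] by fastforce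
      then have "r = \<zero>\<^bsub>P\<^esub>" using *(4) by auto
      then show False using \<open>r \<notin> extension p\<close> p.zero_closed unfolding extension_def by auto
    qed
    then show ?thesis using * ext by blast
  qed
  show "\<not> upper Q"
  proof
    assume "upper Q"
    then obtain f where f: "f \<in> Q" "top_coeff p f (deg R f)"
      and min: "\<And>h k. h \<in> Q \<Longrightarrow> top_coeff p h k \<Longrightarrow> deg R f \<le> k"
      using upper_minimal[OF Q.is_ideal] p_def by auto
    have fc: "f \<in> carrier P" using f Q.Icarr by blast
    \<comment> \<open>Otherwise, dividing the minimal element \<open>f\<close> of \<open>Q\<close>
      by \<open>f'\<close> gives a quotient \<open>q\<close> that is in \<open>Q\<close> by
      primality. Modulo \<open>p\<close> the degrees of \<open>f'\<close> and \<open>q\<close> add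
      up to at most that of \<open>f\<close>; since \<open>f'\<close> is not constant,
      \<open>q\<close> contradicts the minimality of \<open>f\<close>.\<close>
    have "f' \<in> Q"
    proof (rule ccontr)
      assume "f' \<notin> Q"
      obtain q r and k :: nat where *: "q \<in> carrier P" "r \<in> extension p" "r \<in> Q"
        "c [^] k \<odot>\<^bsub>P\<^esub> f = f' \<otimes>\<^bsub>P\<^esub> q \<oplus>\<^bsub>P\<^esub> r" using div[of f] f(1) assms(3) by blast
      have rc: "r \<in> carrier P" using * Q.Icarr by blast
      have "(c [^] k \<odot>\<^bsub>P\<^esub> f) \<ominus>\<^bsub>P\<^esub> r = f' \<otimes>\<^bsub>P\<^esub> q" unfolding *(4) using * f'c rc by algebra
      moreover have "(c [^] k \<odot>\<^bsub>P\<^esub> f) \<ominus>\<^bsub>P\<^esub> r \<in> Q"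
        using Q.minus_mem[OF smult_mem_ideal[OF Q.is_ideal f(1) cn(1)] *(3)] .
      ultimately have "q \<in> Q" using Q.I_prime[OF f'c *(1)] \<open>f' \<notin> Q\<close> by simp
      have coef: "c [^] k \<otimes> pcoeff f j \<in> p \<longleftrightarrow> pcoeff (f' \<otimes>\<^bsub>P\<^esub> q) j \<in> p" for j
      proof -
        have rj: "pcoeff r j \<in> p" using *(2) unfolding extension_def by blast
        have "c [^] k \<otimes> pcoeff f j = pcoeff (f' \<otimes>\<^bsub>P\<^esub> q) j \<oplus> pcoeff r j"
          using arg_cong[OF *(4), of "\<lambda>h. pcoeff h j"] fc cn(1) *(1) f'c rc by (simp del: coeff_mult)
        moreover have "pcoeff (f' \<otimes>\<^bsub>P\<^esub> q) j = (pcoeff (f' \<otimes>\<^bsub>P\<^esub> q) j \<oplus> pcoeff r j) \<ominus> pcoeff r j"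
          using coeff_closed[of "f' \<otimes>\<^bsub>P\<^esub> q" j] coeff_closed[OF rc, of j] f'c *(1)
          by (simp del: coeff_mult add: R.minus_eq R.a_assoc R.r_neg)
        ultimately show ?thesis using rj p.a_closed p.minus_mem by metis
      qed
      have "q \<notin> extension p"
      proof
        assume "q \<in> extension p"
        then have "f' \<otimes>\<^bsub>P\<^esub> q \<in> extension p"
          using ideal.I_l_closed[OF extension_ideal[OF p.is_ideal]] f'c by blast
        then have "c [^] k \<otimes> pcoeff f (deg R f) \<in> p" using coef unfolding extension_def by blast
        then show False using p.I_prime[of "c [^] k" "pcoeff f (deg R f)"] cn f(2) fc
          unfolding top_coeff_def by auto
      qed
      then obtain l where l: "top_coeff p q l" using top_coeff_ex[OF *(1)] p.zero_closed by blast
      have "pcoeff (f' \<otimes>\<^bsub>P\<^esub> q) (deg R f' + l) \<notin> p"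
      proof (rule coeff_mult_not_mem[OF p f'c *(1)])
        show "pcoeff f' (deg R f') \<notin> p" "pcoeff q l \<notin> p" using f'(2) l unfolding top_coeff_def by auto
        fix i assume i: "i \<le> deg R f' + l" "i \<noteq> deg R f'"
        show "pcoeff f' i \<in> p \<or> pcoeff q (deg R f' + l - i) \<in> p"
          using i f'(2) l unfolding top_coeff_def by (cases "i < deg R f'") auto
      qed
      then have "c [^] k \<otimes> pcoeff f (deg R f' + l) \<notin> p" using coef by simp
      then have "pcoeff f (deg R f' + l) \<noteq> \<zero>" using cn(1)[of k] p.zero_closed by auto
      then have "deg R f' + l \<le> deg R f" using deg_belowI fc by blast
      moreover have "deg R f \<le> l" using min[OF \<open>q \<in> Q\<close> l] .
      ultimately show False using d' by simp
    qed
    \<comment> \<open>Division by \<open>f'\<close> puts \<open>c^k g\<close> into \<open>Q\<close>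
      for every \<open>g\<close> in \<open>Q'\<close>, and \<open>c\<close> cancels because it is
      not in the contraction of \<open>Q\<close>.\<close>
    have "Q' \<subseteq> Q"
    proof
      fix g assume g: "g \<in> Q'"
      then have gc: "g \<in> carrier P" using Q'.Icarr by blast
      obtain q r and k :: nat where *: "q \<in> carrier P" "r \<in> extension p" "r \<in> Q"
        "c [^] k \<odot>\<^bsub>P\<^esub> g = f' \<otimes>\<^bsub>P\<^esub> q \<oplus>\<^bsub>P\<^esub> r" using div[OF g] by blast
      have "c [^] k \<odot>\<^bsub>P\<^esub> g \<in> Q"
        unfolding *(4) using Q.a_closed[OF Q.I_r_closed[OF \<open>f' \<in> Q\<close> *(1)] *(3)] .
      then have "pmonom (c [^] k) 0 \<otimes>\<^bsub>P\<^esub> g \<in> Q" using monom_mult_is_smult[OF cn(1) gc] by simp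
      moreover have "pmonom (c [^] k) 0 \<notin> Q"
        using cn[of k] unfolding p_def contraction_def by blast
      ultimately show "g \<in> Q" using Q.I_prime[of "pmonom (c [^] k) 0" g] gc cn(1) by auto
    qed
    then show False using assms(3) by blast
  qed
qed

text \<open>Write \<open>p\<close> and \<open>p'\<close> for the contractions, so that
  \<open>Q'\<close> is \<open>p' R[X]\<close> and \<open>p R[X]\<close>, \<open>Q\<close>,
  \<open>Q'\<close> is a strict chain. The principal ideal theorem for a constant \<open>a\<close>
  in \<open>p'\<close> but not in \<open>p\<close> yields a prime \<open>T\<close> below
  \<open>Q'\<close> that contains \<open>a\<close> and \<open>p R[X]\<close>. Its contraction
  differs from \<open>p\<close> because of \<open>a\<close>, and from \<open>p'\<close> because
  otherwise \<open>T\<close> would contain \<open>p' R[X]\<close>.\<close>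

lemma upper_then_not_upper:
  assumes "noetherian_ring R" "primeideal Q P" "primeideal Q' P" "Q \<subset> Q'" "upper Q" "\<not> upper Q'"
  shows "\<exists>T. primeideal T R \<and> contraction Q \<subset> T \<and> T \<subset> contraction Q'"
proof -
  interpret Q: primeideal Q P by fact
  interpret Q': primeideal Q' P by fact
  let ?p = "contraction Q" and ?p' = "contraction Q'"
  interpret p: primeideal ?p R by (rule contraction_prime) fact
  interpret p': primeideal ?p' R by (rule contraction_prime) fact
  have Q': "Q' = extension ?p'"
    using assms(6) extension_subset[OF Q'.is_ideal order_refl] unfolding upper_def by blast
  have sub: "extension ?p \<subset> Q"
    using assms(5) extension_subset[OF Q.is_ideal order_refl] unfolding upper_def by blast
  have "?p \<subseteq> ?p'" using contraction_mono assms(4) by blast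
  moreover have "?p \<noteq> ?p'" using upper_if_same_contraction(2)[OF assms(2-4)] assms(6) by blast
  ultimately obtain a where a: "a \<in> ?p'" "a \<notin> ?p" by blast
  then have "pmonom a 0 \<in> Q'" unfolding contraction_def by blast
  then obtain T where T: "primeideal T P" "extension ?p \<subseteq> T" "T \<subset> Q'" "pmonom a 0 \<in> T"
    using P.principal_ideal_theorem[OF hilbert_basis[OF assms(1)] extension_prime[OF p.primeideal]
      assms(2,3) sub assms(4)] by blast
  interpret T: primeideal T P by fact
  have "a \<in> contraction T" using T(4) a p'.Icarr unfolding contraction_def by blast
  moreover have "?p \<subseteq> contraction T"
    using contraction_mono[OF T(2)] contraction_extension[OF p.is_ideal] by simp
  ultimately have "?p \<subset> contraction T" using a(2) by blast
  moreover have "contraction T \<subseteq> ?p'" using contraction_mono T(3) by blast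
  moreover have "contraction T \<noteq> ?p'" using extension_subset[OF T.is_ideal, of ?p'] Q' T(3) by blast
  ultimately show ?thesis using contraction_prime[OF T(1)] by blast
qed

end

lemma prime_chain_Suc:
  assumes "prime_chain R n C" "primeideal T R" "C n \<subset> T"
  shows "prime_chain R (Suc n) (C(Suc n := T))"
  using assms unfolding prime_chain_def by (auto simp: le_Suc_eq less_Suc_eq)

theorem (in UP_cring) contract_chain:
  assumes "noetherian_ring R" "prime_chain P n Q"
  shows "\<exists>m C. prime_chain R m C \<and> C 0 = contraction (Q 0) \<and> n \<le> m + 1 \<and> (upper (Q 0) \<longrightarrow> n \<le> m)"
proof -
  \<comment> \<open>A step between primes with the same contraction turns a prime that is not upper into an upper
    one; the converse transition passes over two steps in \<open>R\<close>. Hence the loss never exceeds one.\<close>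
  have "\<exists>m C. prime_chain R m C \<and> C 0 = contraction (Q 0) \<and> C m = contraction (Q i) \<and>
      i + of_bool (upper (Q 0)) \<le> m + of_bool (upper (Q i))" if "i \<le> n" for i
    using that
  proof (induction i)
    case 0
    have "prime_chain R 0 (\<lambda>_. contraction (Q 0))"
      using assms(2) contraction_prime unfolding prime_chain_def by blast
    then show ?case by (intro exI[of _ 0] exI[of _ "\<lambda>_. contraction (Q 0)"]) auto
  next
    case (Suc i)
    then obtain m C where C: "prime_chain R m C" "C 0 = contraction (Q 0)" "C m = contraction (Q i)"
      "i + of_bool (upper (Q 0)) \<le> m + of_bool (upper (Q i))" by auto
    have Q: "primeideal (Q i) P" "primeideal (Q (Suc i)) P" "Q i \<subset> Q (Suc i)"
      using assms(2) Suc.prems unfolding prime_chain_def by auto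
    let ?p' = "contraction (Q (Suc i))"
    show ?case
    proof (cases "contraction (Q i) = ?p'")
      case True
      then show ?thesis using upper_if_same_contraction[OF Q True] C
        by (intro exI[of _ m] exI[of _ C]) (auto split: if_splits)
    next
      case False
      then have lt: "C m \<subset> ?p'" using contraction_mono Q(3) C(3) by blast
      show ?thesis
      proof (cases "upper (Q i) \<and> \<not> upper (Q (Suc i))")
        case True
        then obtain T where T: "primeideal T R" "C m \<subset> T" "T \<subset> ?p'"
          using upper_then_not_upper[OF assms(1) Q] C(3) by auto
        have "prime_chain R (Suc (Suc m)) ((C(Suc m := T))(Suc (Suc m) := ?p'))"
          using prime_chain_Suc[OF prime_chain_Suc[OF C(1) T(1,2)] contraction_prime[OF Q(2)]] T(3) by simp
        moreover have "Suc i + of_bool (upper (Q 0)) \<le> Suc (Suc m) + of_bool (upper (Q (Suc i)))"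
          using C(4) True by simp
        ultimately show ?thesis using C(2) by fastforce
      next
        case False
        then have "Suc i + of_bool (upper (Q 0)) \<le> Suc m + of_bool (upper (Q (Suc i)))"
          using C(4) by (cases "upper (Q i)"; cases "upper (Q (Suc i))") auto
        then show ?thesis using prime_chain_Suc[OF C(1) contraction_prime[OF Q(2)] lt] C(2)
          by fastforce
      qed
    qed
  qed
  \<comment> \<open>At the top of the chain the flag of \<open>Q n\<close> accounts for a loss of at
    most one, and the flag of an upper \<open>Q 0\<close> compensates for it.\<close>
  from this[of n] obtain m C where "prime_chain R m C" "C 0 = contraction (Q 0)"
    "n + of_bool (upper (Q 0)) \<le> m + of_bool (upper (Q n))" by blast
  moreover have "of_bool (upper (Q n)) \<le> (1 :: nat)" by simp
  ultimately show ?thesis by (intro exI[of _ m] exI[of _ C]) auto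
qed

section \<open>Finitely generated subrings\<close>

text \<open>Surjectivity keeps the inclusions strict: an element that separates two primes has a
  preimage.\<close>

lemma prime_chain_vimage:
  assumes "cring R" "cring S" "h \<in> ring_hom R S" "carrier S \<subseteq> h ` carrier R" "prime_chain S n Q"
  shows "prime_chain R n (\<lambda>i. {r \<in> carrier R. h r \<in> Q i})"
proof -
  interpret R: cring R by fact
  interpret S: cring S by fact
  interpret h: ring_hom_ring R S h by (rule ring_hom_ringI2[OF R.ring_axioms S.ring_axioms assms(3)])
  have "{r \<in> carrier R. h r \<in> Q i} \<subset> {r \<in> carrier R. h r \<in> Q (Suc i)}" if "i < n" for i
  proof -
    have lt: "Q i \<subset> Q (Suc i)" and "primeideal (Q (Suc i)) S"
      using assms(5) that unfolding prime_chain_def by auto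
    then interpret Q: primeideal "Q (Suc i)" S by simp
    obtain y where y: "y \<in> Q (Suc i)" "y \<notin> Q i" using lt by blast
    then obtain x where "x \<in> carrier R" "y = h x" using assms(4) Q.Icarr by blast
    then show ?thesis using y lt by blast
  qed
  then show ?thesis
    using assms(5) h.primeideal_vimage[OF assms(1)] unfolding prime_chain_def by blast
qed

lemma noetherian_ring_image:
  assumes "noetherian_ring R" "ring S" "h \<in> ring_hom R S" "carrier S \<subseteq> h ` carrier R"
  shows "noetherian_ring S"
proof -
  interpret R: noetherian_ring R by fact
  interpret S: ring S by fact
  interpret h: ring_hom_ring R S h by (rule ring_hom_ringI2[OF R.ring_axioms S.ring_axioms assms(3)])
  show ?thesis
  proof (rule S.noetherian_ringI)
    fix E assume E: "ideal E S"
    interpret E: ideal E S by fact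
    obtain A where A: "A \<subseteq> carrier R" "finite A" "{r \<in> carrier R. h r \<in> E} = Idl\<^bsub>R\<^esub> A"
      using R.finetely_gen[OF h.ideal_vimage[OF E]] by blast
    have hA: "h ` A \<subseteq> carrier S" using A(1) h.hom_closed by blast
    have "h ` A \<subseteq> E" using A(3) R.genideal_self[OF A(1)] by blast
    then have 1: "Idl\<^bsub>S\<^esub> (h ` A) \<subseteq> E" by (rule S.genideal_minimal[OF E])
    have "A \<subseteq> {r \<in> carrier R. h r \<in> Idl\<^bsub>S\<^esub> (h ` A)}" using A(1) S.genideal_self[OF hA] by blast
    then have 2: "Idl\<^bsub>R\<^esub> A \<subseteq> {r \<in> carrier R. h r \<in> Idl\<^bsub>S\<^esub> (h ` A)}"
      by (rule R.genideal_minimal[OF h.ideal_vimage[OF S.genideal_ideal[OF hA]]])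
    have "E \<subseteq> Idl\<^bsub>S\<^esub> (h ` A)"
    proof
      fix e assume e: "e \<in> E"
      then obtain r where "r \<in> carrier R" "e = h r" using assms(4) E.Icarr by blast
      then show "e \<in> Idl\<^bsub>S\<^esub> (h ` A)" using e A(3) 2 by blast
    qed
    then show "\<exists>A\<subseteq>carrier S. finite A \<and> E = Idl\<^bsub>S\<^esub> A" using 1 hA A(2) by blast
  qed
qed

context ring
begin

lemma subring_finsum:
  assumes "subring S R" "\<And>i. i \<in> A \<Longrightarrow> f i \<in> S"
  shows "finsum R f A \<in> S"
  using assms(2)
proof (induction A rule: infinite_finite_induct)
  case (insert x F)
  then have "f \<in> F \<rightarrow> carrier R" "f x \<in> carrier R" using subringE(1)[OF assms(1)] by auto
  then show ?case using insert subringE(7)[OF assms(1)] by simp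
qed (use subringE(2)[OF assms(1)] in auto)

lemma subring_nat_pow:
  assumes "subring S R" "x \<in> S"
  shows "x [^] (n :: nat) \<in> S"
  by (induction n) (use subringE[OF assms(1)] assms(2) in auto)

end

text \<open>The subring \<open>A[x]\<close> is taken as the image of the evaluation at
  \<open>x\<close>, hence as a quotient of \<open>A[X]\<close>: the Noetherian property comes from
  Hilbert's basis theorem, and chains of primes pull back to the polynomial ring.\<close>

definition ring_adjoin :: "('a, 'm) ring_scheme \<Rightarrow> 'a set \<Rightarrow> 'a \<Rightarrow> 'a set"
  where "ring_adjoin R A x =
    UnivPoly.eval (R\<lparr>carrier := A\<rparr>) R (\<lambda>a. a) x ` carrier (UP (R\<lparr>carrier := A\<rparr>))"

lemma (in cring) subring_cring: "subring A R \<Longrightarrow> cring (R\<lparr>carrier := A\<rparr>)"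
  using subcringI' subcring_iff subringE(1) by metis

locale subring_eval = cring R for R (structure) +
  fixes A x
  assumes A: "subring A R" and x: "x \<in> carrier R"
begin

sublocale U: UP_pre_univ_prop "R\<lparr>carrier := A\<rparr>" R "\<lambda>a. a" "UP (R\<lparr>carrier := A\<rparr>)"
  using subringE(1)[OF A]
  by (intro UP_pre_univ_propI subring_cring[OF A] cring_axioms) (auto simp: ring_hom_def)

abbreviation "ev \<equiv> UnivPoly.eval (R\<lparr>carrier := A\<rparr>) R (\<lambda>a. a) x"

lemma ev_hom: "ev \<in> ring_hom (UP (R\<lparr>carrier := A\<rparr>)) R"
  by (rule U.eval_ring_hom[OF x])

lemma subring_ring_adjoin: "subring (ring_adjoin R A x) R"
proof -
  interpret h: ring_hom_ring "UP (R\<lparr>carrier := A\<rparr>)" R ev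
    by (rule ring_hom_ringI2[OF U.P.ring_axioms ring_axioms ev_hom])
  show ?thesis unfolding ring_adjoin_def
    by (rule ring_incl_imp_subring[OF _ h.img_is_ring]) auto
qed

lemma ev_const: "a \<in> A \<Longrightarrow> ev (up_ring.monom (UP (R\<lparr>carrier := A\<rparr>)) a 0) = a"
  using U.eval_const[OF x] by simp

lemma ev_linear:
  assumes "a \<in> A"
  shows "ev (up_ring.monom (UP (R\<lparr>carrier := A\<rparr>)) a 1) = a \<otimes> x"
  using U.eval_monom[OF _ x, of a 1] assms x by simp

lemma ring_adjoin_contains: "A \<subseteq> ring_adjoin R A x" "x \<in> ring_adjoin R A x"
proof -
  show "A \<subseteq> ring_adjoin R A x"
  proof
    fix a assume "a \<in> A"
    then show "a \<in> ring_adjoin R A x" unfolding ring_adjoin_def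
      using ev_const[of a] U.monom_closed[of a 0] by (intro image_eqI[where x = "up_ring.monom (UP (R\<lparr>carrier := A\<rparr>)) a 0"]) simp_all
  qed
  have "\<one> \<in> A" using subringE(3)[OF A] .
  then show "x \<in> ring_adjoin R A x" unfolding ring_adjoin_def
    using ev_linear[of \<one>] U.monom_closed[of \<one> 1] x
    by (intro image_eqI[where x = "up_ring.monom (UP (R\<lparr>carrier := A\<rparr>)) \<one> 1"]) simp_all
qed

lemma ring_adjoin_minimal:
  assumes "subring S R" "A \<subseteq> S" "x \<in> S"
  shows "ring_adjoin R A x \<subseteq> S"
proof
  fix y assume "y \<in> ring_adjoin R A x"
  then obtain f where f: "f \<in> carrier (UP (R\<lparr>carrier := A\<rparr>))" "y = ev f" unfolding ring_adjoin_def by blast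
  have coef: "up_ring.coeff (UP (R\<lparr>carrier := A\<rparr>)) f i \<in> S" for i
    using U.coeff_closed[OF f(1), of i] assms(2) by auto
  then show "y \<in> S" unfolding f(2) U.eval_on_carrier[OF f(1)]
    by (intro subring_finsum[OF assms(1)] subringE(6)[OF assms(1)] subring_nat_pow[OF assms(1,3)] coef)
qed

lemma ev_hom': "ev \<in> ring_hom (UP (R\<lparr>carrier := A\<rparr>)) (R\<lparr>carrier := ring_adjoin R A x\<rparr>)"
  using ev_hom unfolding ring_hom_def ring_adjoin_def by auto

lemma ring_adjoin_noetherian:
  assumes "noetherian_ring (R\<lparr>carrier := A\<rparr>)"
  shows "noetherian_ring (R\<lparr>carrier := ring_adjoin R A x\<rparr>)"
  by (rule noetherian_ring_image[OF U.hilbert_basis[OF assms] subring_is_ring[OF subring_ring_adjoin] ev_hom'])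
    (simp add: ring_adjoin_def)

text \<open>The chain is pulled back to \<open>A[X]\<close> and contracted from there. A relation
  \<open>a x + b\<close> in the bottom with \<open>a\<close> outside puts \<open>a X + b\<close>
  into the bottom prime of \<open>A[X]\<close>, while its coefficient \<open>a\<close> is not in the
  contraction; so that prime is upper and nothing is lost. Linear relations are enough for Rees
  algebras.\<close>

lemma ring_adjoin_chain:
  assumes "noetherian_ring (R\<lparr>carrier := A\<rparr>)" "prime_chain (R\<lparr>carrier := ring_adjoin R A x\<rparr>) n Q"
  shows "\<exists>m C. prime_chain (R\<lparr>carrier := A\<rparr>) m C \<and> C 0 = A \<inter> Q 0 \<and> n \<le> m + 1 \<and>
    ((\<exists>a\<in>A. \<exists>b\<in>A. a \<notin> Q 0 \<and> a \<otimes> x \<oplus> b \<in> Q 0) \<longrightarrow> n \<le> m)"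
proof -
  let ?P = "UP (R\<lparr>carrier := A\<rparr>)"
  let ?Q = "\<lambda>i. {f \<in> carrier ?P. ev f \<in> Q i}"
  have chain: "prime_chain ?P n ?Q"
    by (rule prime_chain_vimage[OF U.P.cring_axioms subring_cring[OF subring_ring_adjoin] ev_hom' _ assms(2)])
      (simp add: ring_adjoin_def)
  have contr: "U.contraction (?Q 0) = A \<inter> Q 0"
    unfolding U.contraction_def using ev_const by auto
  have "U.upper (?Q 0)" if ab: "a \<in> A" "b \<in> A" "a \<notin> Q 0" "a \<otimes> x \<oplus> b \<in> Q 0" for a b
  proof -
    let ?f = "up_ring.monom ?P a 1 \<oplus>\<^bsub>?P\<^esub> up_ring.monom ?P b 0"
    have mc: "up_ring.monom ?P a 1 \<in> carrier ?P" "up_ring.monom ?P b 0 \<in> carrier ?P" using ab by auto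
    have "ev ?f = a \<otimes> x \<oplus> b"
      using ring_hom_add[OF ev_hom mc] ev_linear[OF ab(1)] ev_const[OF ab(2)] by simp
    then have "?f \<in> ?Q 0" using ab mc by simp
    moreover have "up_ring.coeff ?P ?f 1 = a"
      using U.coeff_add[OF mc] U.coeff_monom[of a 1 1] U.coeff_monom[of b 0 1] ab subringE(1)[OF A] by auto
    then have "?f \<notin> U.extension (U.contraction (?Q 0))"
      using ab(3) unfolding U.extension_def contr by (metis (mono_tags, lifting) IntD2 mem_Collect_eq)
    ultimately show ?thesis unfolding U.upper_def by blast
  qed
  then have up: "U.upper (?Q 0)" if "\<exists>a\<in>A. \<exists>b\<in>A. a \<notin> Q 0 \<and> a \<otimes> x \<oplus> b \<in> Q 0"
    using that by blast
  obtain m C where "prime_chain (R\<lparr>carrier := A\<rparr>) m C" "C 0 = A \<inter> Q 0" "n \<le> m + 1"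
    "U.upper (?Q 0) \<longrightarrow> n \<le> m"
    using U.contract_chain[OF assms(1) chain] unfolding contr by (elim exE conjE) (rule that)
  then show ?thesis using up by blast
qed

end

context cring
begin

abbreviation "adjoin_list A xs \<equiv> foldr (\<lambda>x B. ring_adjoin R B x) xs A"

lemma adjoin_list:
  assumes "subring A R" "noetherian_ring (R\<lparr>carrier := A\<rparr>)" "set xs \<subseteq> carrier R"
  shows "subring (adjoin_list A xs) R" "noetherian_ring (R\<lparr>carrier := adjoin_list A xs\<rparr>)"
    "A \<subseteq> adjoin_list A xs" "set xs \<subseteq> adjoin_list A xs"
    "\<And>S. subring S R \<Longrightarrow> A \<subseteq> S \<Longrightarrow> set xs \<subseteq> S \<Longrightarrow> adjoin_list A xs \<subseteq> S"
proof -
  have "subring (adjoin_list A xs) R \<and> noetherian_ring (R\<lparr>carrier := adjoin_list A xs\<rparr>) \<and>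
    A \<subseteq> adjoin_list A xs \<and> set xs \<subseteq> adjoin_list A xs \<and>
    (\<forall>S. subring S R \<and> A \<subseteq> S \<and> set xs \<subseteq> S \<longrightarrow> adjoin_list A xs \<subseteq> S)"
    using assms(3)
  proof (induction xs)
    case (Cons x xs)
    have x: "x \<in> carrier R" and xs: "set xs \<subseteq> carrier R" using Cons.prems by simp_all
    from Cons.IH[OF xs] have "subring (adjoin_list A xs) R" by (rule conjunct1)
    then interpret subring_eval R "adjoin_list A xs" x
      using x by (intro subring_eval.intro cring_axioms subring_eval_axioms.intro)
    have IH: "noetherian_ring (R\<lparr>carrier := adjoin_list A xs\<rparr>)" "A \<subseteq> adjoin_list A xs"
      "set xs \<subseteq> adjoin_list A xs"
      "\<And>S. subring S R \<Longrightarrow> A \<subseteq> S \<Longrightarrow> set xs \<subseteq> S \<Longrightarrow> adjoin_list A xs \<subseteq> S"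
      using Cons.IH[OF xs] by simp_all
    have "subring (adjoin_list A (x # xs)) R" "noetherian_ring (R\<lparr>carrier := adjoin_list A (x # xs)\<rparr>)"
      using subring_ring_adjoin ring_adjoin_noetherian[OF IH(1)] by simp_all
    moreover have "A \<subseteq> adjoin_list A (x # xs)" "set (x # xs) \<subseteq> adjoin_list A (x # xs)"
      using ring_adjoin_contains IH(2,3) by auto
    moreover have "adjoin_list A (x # xs) \<subseteq> S" if S: "subring S R" "A \<subseteq> S" "set (x # xs) \<subseteq> S" for S
      using ring_adjoin_minimal[OF S(1) IH(4)[OF S(1,2)]] S(3) by simp
    ultimately show ?case by blast
  qed (use assms in auto)
  then show "subring (adjoin_list A xs) R" "noetherian_ring (R\<lparr>carrier := adjoin_list A xs\<rparr>)"
    "A \<subseteq> adjoin_list A xs" "set xs \<subseteq> adjoin_list A xs"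
    "\<And>S. subring S R \<Longrightarrow> A \<subseteq> S \<Longrightarrow> set xs \<subseteq> S \<Longrightarrow> adjoin_list A xs \<subseteq> S" by blast+
qed

text \<open>The head of the list is the element adjoined last, so it is removed first. The relations
  have coefficients in \<open>A\<close> itself; hence they lie in every intermediate ring and remain
  in the bottom of each contracted chain.\<close>

lemma adjoin_list_chain:
  assumes "subring A R" "noetherian_ring (R\<lparr>carrier := A\<rparr>)" "set xs \<subseteq> carrier R"
    and "prime_chain (R\<lparr>carrier := adjoin_list A xs\<rparr>) n Q"
    and "\<And>x. x \<in> set xs \<Longrightarrow> \<exists>a\<in>A. \<exists>b\<in>A. a \<notin> Q 0 \<and> a \<otimes> x \<oplus> b \<in> Q 0"
  shows "\<exists>m C. prime_chain (R\<lparr>carrier := A\<rparr>) m C \<and> C 0 = A \<inter> Q 0 \<and> n \<le> m"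
  using assms(3-5)
proof (induction xs arbitrary: n Q)
  case Nil
  then have "primeideal (Q 0) (R\<lparr>carrier := A\<rparr>)" unfolding prime_chain_def by simp
  then have "ideal (Q 0) (R\<lparr>carrier := A\<rparr>)" by (simp add: primeideal_def)
  then have "Q 0 \<subseteq> A" using ideal.Icarr by fastforce
  then show ?case using Nil by (intro exI[of _ n] exI[of _ Q]) auto
next
  case (Cons x xs)
  let ?B = "adjoin_list A xs"
  have xs: "set xs \<subseteq> carrier R" using Cons.prems by simp
  note B = adjoin_list[OF assms(1,2) xs]
  interpret subring_eval R ?B x
    using Cons.prems(1) B(1) by (intro subring_eval.intro cring_axioms subring_eval_axioms.intro) simp_all
  have "\<exists>a\<in>?B. \<exists>b\<in>?B. a \<notin> Q 0 \<and> a \<otimes> x \<oplus> b \<in> Q 0" using Cons.prems(3)[of x] B(3) by auto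
  moreover have "prime_chain (R\<lparr>carrier := ring_adjoin R ?B x\<rparr>) n Q" using Cons.prems(2) by simp
  ultimately obtain m C where C: "prime_chain (R\<lparr>carrier := ?B\<rparr>) m C" "C 0 = ?B \<inter> Q 0" "n \<le> m"
    using ring_adjoin_chain[OF B(2)] by blast
  have "\<exists>a\<in>A. \<exists>b\<in>A. a \<notin> C 0 \<and> a \<otimes> y \<oplus> b \<in> C 0" if y: "y \<in> set xs" for y
  proof -
    obtain a b where ab: "a \<in> A" "b \<in> A" "a \<notin> Q 0" "a \<otimes> y \<oplus> b \<in> Q 0" using Cons.prems(3)[of y] y by auto
    have "a \<otimes> y \<oplus> b \<in> ?B" using ab y B(3,4) subringE(6,7)[OF B(1)] by blast
    then show ?thesis using ab C(2) by blast
  qed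
  then obtain m' C' where "prime_chain (R\<lparr>carrier := A\<rparr>) m' C'" "C' 0 = A \<inter> C 0" "m \<le> m'"
    using Cons.IH[OF xs C(1)] by blast
  then show ?case using C(2,3) B(3) by (intro exI[of _ m'] exI[of _ C']) auto
qed

end

section \<open>Prime ideals of the Rees algebra\<close>

locale rees_ideal = UP_cring +
  fixes I
  assumes I: "ideal I R"
begin

abbreviation "Ipow t \<equiv> I [^]\<^bsub>ideals_set R\<^esub> (t :: nat)"

abbreviation "Rees \<equiv> carrier (rees_algebra R I)"

lemma Ipow_ideal: "ideal (Ipow t) R"
proof -
  interpret S: semiring "ideals_set R" by (rule R.ideals_set_is_semiring)
  have "I \<in> carrier (ideals_set R)" using I unfolding ideals_set_def by simp
  then have "Ipow t \<in> carrier (ideals_set R)" by (rule S.nat_pow_closed)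
  then show ?thesis unfolding ideals_set_def by simp
qed

lemma Ipow_0: "Ipow 0 = carrier R"
  by (simp add: nat_pow_def ideals_set_def)

lemma Ipow_Suc: "Ipow (Suc t) = ideal_prod R (Ipow t) I"
  by (simp add: nat_pow_def ideals_set_def)

lemma Ipow_1: "Ipow (Suc 0) = I"
  using R.ideal_prod_commute[OF R.oneideal I] R.ideal_prod_one[OF I] Ipow_Suc[of 0] Ipow_0 by simp

lemma Ipow_mult:
  assumes "a \<in> Ipow s" "b \<in> Ipow t"
  shows "a \<otimes> b \<in> Ipow (s + t)"
proof -
  interpret S: semiring "ideals_set R" by (rule R.ideals_set_is_semiring)
  have "I \<in> carrier (ideals_set R)" using I unfolding ideals_set_def by simp
  then have "Ipow s \<otimes>\<^bsub>ideals_set R\<^esub> Ipow t = Ipow (s + t)" by (rule S.nat_pow_mult)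
  then show ?thesis using ideal_prod.prod[OF assms, of R] unfolding ideals_set_def by simp
qed

lemma Rees_mem: "f \<in> Rees \<longleftrightarrow> f \<in> carrier P \<and> (\<forall>t. pcoeff f t \<in> Ipow t)"
  unfolding rees_algebra_def P_def by simp

lemma rees_algebra_eq: "rees_algebra R I = P\<lparr>carrier := Rees\<rparr>"
  unfolding rees_algebra_def P_def by simp

lemma monom_Rees: "a \<in> Ipow t \<Longrightarrow> pmonom a t \<in> Rees"
  using ideal.Icarr[OF Ipow_ideal] additive_subgroup.zero_closed[OF ideal.axioms(1)[OF Ipow_ideal]]
  unfolding Rees_mem by auto

lemma const_Rees: "a \<in> carrier R \<Longrightarrow> pmonom a 0 \<in> Rees"
  using monom_Rees[of a 0] Ipow_0 by simp

lemma linear_Rees: "a \<in> I \<Longrightarrow> pmonom a 1 \<in> Rees"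
  using monom_Rees[of a 1] Ipow_1 by simp

lemma Rees_subring: "subring Rees P"
proof (rule P.subringI)
  have az: "additive_subgroup (Ipow t) R" for t using Ipow_ideal by (rule ideal.axioms(1))
  show "Rees \<subseteq> carrier P" unfolding subset_iff Rees_mem by blast
  show "\<one>\<^bsub>P\<^esub> \<in> Rees" using const_Rees[OF R.one_closed] by (simp add: monom_one)
  fix f assume f: "f \<in> Rees"
  then show "\<ominus>\<^bsub>P\<^esub> f \<in> Rees"
    unfolding Rees_mem using additive_subgroup.a_inv_closed[OF az] by simp
  fix g assume g: "g \<in> Rees"
  show "f \<oplus>\<^bsub>P\<^esub> g \<in> Rees"
    using f g additive_subgroup.a_closed[OF az] unfolding Rees_mem by simp
  have "(\<Oplus>i\<in>{..t}. pcoeff f i \<otimes> pcoeff g (t - i)) \<in> Ipow t" for t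
  proof (rule R.ideal_finsum_mem[OF Ipow_ideal])
    fix i assume "i \<in> {..t}"
    then show "pcoeff f i \<otimes> pcoeff g (t - i) \<in> Ipow t"
      using Ipow_mult[of "pcoeff f i" i "pcoeff g (t - i)" "t - i"] f g unfolding Rees_mem by simp
  qed
  then show "f \<otimes>\<^bsub>P\<^esub> g \<in> Rees" using f g unfolding Rees_mem by simp
qed

text \<open>A product \<open>i j\<close> with \<open>i\<close> in \<open>I^t\<close> and
  \<open>j\<close> in \<open>I\<close> gives the factorization of \<open>i j u^(t+1)\<close> into
  \<open>i u^t\<close> and \<open>j u\<close>, and such products generate \<open>I^(t+1)\<close>
  additively. The same statement serves for adjoining finitely many generators and for the
  surjection from the symmetric algebra.\<close>

lemma Rees_minimal:
  assumes "subring S P" "\<And>r. r \<in> carrier R \<Longrightarrow> pmonom r 0 \<in> S" "\<And>x. x \<in> I \<Longrightarrow> pmonom x 1 \<in> S"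
  shows "Rees \<subseteq> S"
proof
  fix f assume f: "f \<in> Rees"
  have "pmonom a t \<in> S" if "a \<in> Ipow t" for a t
    using that
  proof (induction t arbitrary: a)
    case 0
    then show ?case using assms(2) Ipow_0 by simp
  next
    case (Suc t)
    have "a \<in> ideal_prod R (Ipow t) I" using Suc.prems Ipow_Suc by simp
    then show ?case
    proof (induction a rule: ideal_prod.induct)
      case (prod i j)
      then have c: "i \<in> carrier R" "j \<in> carrier R"
        using ideal.Icarr[OF Ipow_ideal] ideal.Icarr[OF I] by auto
      have "pmonom (i \<otimes> j) (t + 1) = pmonom i t \<otimes>\<^bsub>P\<^esub> pmonom j 1" by (rule monom_mult[OF c])
      then show ?case using subringE(6)[OF assms(1) Suc.IH[OF prod(1)] assms(3)[OF prod(2)]] by simp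
    next
      case (sum s1 s2)
      have "s1 \<in> carrier R" "s2 \<in> carrier R"
        using sum.hyps R.ideal_prod_in_carrier[OF Ipow_ideal I] by auto
      then have "pmonom (s1 \<oplus> s2) (Suc t) = pmonom s1 (Suc t) \<oplus>\<^bsub>P\<^esub> pmonom s2 (Suc t)" by (rule monom_add)
      then show ?case using subringE(7)[OF assms(1) sum.IH] by simp
    qed
  qed
  then have "(\<Oplus>\<^bsub>P\<^esub> i \<in> {..deg R f}. pmonom (pcoeff f i) i) \<in> S"
    using f unfolding Rees_mem by (intro P.subring_finsum[OF assms(1)]) blast
  then show "f \<in> S" using up_repr[of f] f unfolding Rees_mem by simp
qed

text \<open>It matters that \<open>Q 0\<close> comes from a prime \<open>p\<close> of
  \<open>R[u]\<close>. If the constants from \<open>I\<close> all lie in \<open>p\<close>, then so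
  does every \<open>g u\<close>, as a multiple of \<open>g\<close> in \<open>R[u]\<close>; the
  element \<open>u\<close> itself need not be in the Rees algebra. All generators then vanish modulo
  the bottom, the trivial relation \<open>1 x + 0\<close> applies to them, and no step is
  lost.\<close>

lemma rees_chain_contracted:
  assumes noeth: "noetherian_ring R" and Q: "prime_chain (rees_algebra R I) n Q"
    and p: "primeideal p P" "Q 0 = p \<inter> Rees"
  shows "\<exists>m C. prime_chain R m C \<and> n \<le> m + 1"
proof -
  interpret N: noetherian_ring R by fact
  interpret p: primeideal p P by fact
  let ?c = "\<lambda>a. pmonom a 0"
  interpret h: ring_hom_ring R P ?c
    by (rule ring_hom_ringI2[OF R.ring_axioms P.ring_axioms const_ring_hom])
  \<comment> \<open>A copy of \<open>R\<close> inside \<open>R[u]\<close>, so that all intermediate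
    rings are subrings of one ring.\<close>
  define A where "A = ?c ` carrier R"
  have A: "subring A P" unfolding A_def
    by (rule P.ring_incl_imp_subring[OF _ h.img_is_ring]) auto
  have c_hom: "?c \<in> ring_hom R (P\<lparr>carrier := A\<rparr>)"
    using const_ring_hom unfolding A_def ring_hom_def by auto
  have noethA: "noetherian_ring (P\<lparr>carrier := A\<rparr>)"
    by (rule noetherian_ring_image[OF noeth P.subring_is_ring[OF A] c_hom]) (simp add: A_def)
  have chainA: "\<exists>C'. prime_chain R m C'" if "prime_chain (P\<lparr>carrier := A\<rparr>) m C" for m C
    using prime_chain_vimage[OF R.cring_axioms P.subring_cring[OF A] c_hom _ that]
    by (auto simp: A_def)
  have A_Rees: "A \<subseteq> Rees" unfolding A_def using const_Rees by blast
  obtain G where G: "G \<subseteq> carrier R" "finite G" "I = Idl\<^bsub>R\<^esub> G" using N.finetely_gen[OF I] by blast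
  have GI: "G \<subseteq> I" using G R.genideal_self by blast
  obtain gs where gs: "set gs = G" using finite_list[OF G(2)] by blast
  define xs where "xs = map (\<lambda>g. pmonom g 1) gs"
  have xs: "set xs \<subseteq> carrier P" "set xs \<subseteq> Rees"
    unfolding xs_def using gs G(1) GI linear_Rees by auto
  have adjoin: "P.adjoin_list B xs = Rees"
    if B: "subring B P" "noetherian_ring (P\<lparr>carrier := B\<rparr>)" "A \<subseteq> B" "B \<subseteq> Rees" for B
  proof
    note B' = P.adjoin_list[OF B(1,2) xs(1)]
    show "P.adjoin_list B xs \<subseteq> Rees" by (rule B'(5)[OF Rees_subring B(4) xs(2)])
    show "Rees \<subseteq> P.adjoin_list B xs"
    proof (rule Rees_minimal[OF B'(1)])
      show const: "pmonom r 0 \<in> P.adjoin_list B xs" if "r \<in> carrier R" for r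
        using that B(3) B'(3) unfolding A_def by blast
      have "ideal {j \<in> carrier R. pmonom j 1 \<in> P.adjoin_list B xs} R"
      proof (rule R.idealI_comm)
        show "\<zero> \<in> {j \<in> carrier R. pmonom j 1 \<in> P.adjoin_list B xs}"
          using subringE(2)[OF B'(1)] by simp
        fix a b assume ab: "a \<in> {j \<in> carrier R. pmonom j 1 \<in> P.adjoin_list B xs}"
        then show "r \<otimes> a \<in> {j \<in> carrier R. pmonom j 1 \<in> P.adjoin_list B xs}" if "r \<in> carrier R" for r
          using subringE(6)[OF B'(1) const[OF that]] monom_mult[OF that, of a 0 1] that by simp
        assume "b \<in> {j \<in> carrier R. pmonom j 1 \<in> P.adjoin_list B xs}"
        then show "a \<oplus> b \<in> {j \<in> carrier R. pmonom j 1 \<in> P.adjoin_list B xs}"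
          using ab subringE(7)[OF B'(1)] by simp
      qed blast
      then have "I \<subseteq> {j \<in> carrier R. pmonom j 1 \<in> P.adjoin_list B xs}"
        unfolding G(3) using B'(4) gs G(1) by (intro R.genideal_minimal) (auto simp: xs_def)
      then show "pmonom x 1 \<in> P.adjoin_list B xs" if "x \<in> I" for x using that by blast
    qed
  qed
  show ?thesis
  proof (cases "\<exists>f\<in>I. pmonom f 0 \<notin> p")
    case True
    \<comment> \<open>This \<open>f\<close> need not be among the chosen generators of
      \<open>I\<close>. Adjoining \<open>f u\<close> before the generators does not change the ring
      obtained in the end, and it is the only adjunction that may cost a step.\<close>
    then obtain f where f: "f \<in> I" "pmonom f 0 \<notin> p" by blast
    have fc: "f \<in> carrier R" using f ideal.Icarr[OF I] by blast
    interpret subring_eval P A "pmonom f 1"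
      using fc A by (intro subring_eval.intro P.cring_axioms subring_eval_axioms.intro) simp_all
    let ?B = "ring_adjoin P A (pmonom f 1)"
    have B: "subring ?B P" "noetherian_ring (P\<lparr>carrier := ?B\<rparr>)" "A \<subseteq> ?B" "pmonom f 1 \<in> ?B" "?B \<subseteq> Rees"
      using subring_ring_adjoin ring_adjoin_noetherian[OF noethA] ring_adjoin_contains
        ring_adjoin_minimal[OF Rees_subring A_Rees linear_Rees[OF f(1)]] by blast+
    have chain: "prime_chain (P\<lparr>carrier := P.adjoin_list ?B xs\<rparr>) n Q"
      using Q unfolding adjoin[OF B(1,2,3,5)] by (subst (asm) rees_algebra_eq)
    have "\<exists>a\<in>?B. \<exists>b\<in>?B. a \<notin> Q 0 \<and> a \<otimes>\<^bsub>P\<^esub> x \<oplus>\<^bsub>P\<^esub> b \<in> Q 0" if x: "x \<in> set xs" for x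
    proof -
      obtain g where g: "g \<in> G" "x = pmonom g 1" using x gs unfolding xs_def by auto
      have gc: "g \<in> carrier R" using g G(1) by blast
      let ?a = "pmonom f 0" and ?b = "\<ominus>\<^bsub>P\<^esub> (pmonom g 0 \<otimes>\<^bsub>P\<^esub> pmonom f 1)"
      have ab: "?a \<in> ?B" "?b \<in> ?B"
        using subringE(5,6)[OF B(1)] B(3,4) fc gc unfolding A_def by blast+
      have "?a \<otimes>\<^bsub>P\<^esub> x = pmonom g 0 \<otimes>\<^bsub>P\<^esub> pmonom f 1"
        unfolding g(2) using monom_mult[OF fc gc, of 0 1] monom_mult[OF gc fc, of 0 1] R.m_comm[OF fc gc] by simp
      then have "?a \<otimes>\<^bsub>P\<^esub> x \<oplus>\<^bsub>P\<^esub> ?b = \<zero>\<^bsub>P\<^esub>" using gc fc by (simp add: P.r_neg)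
      moreover have "\<zero>\<^bsub>P\<^esub> \<in> Q 0" unfolding p(2) using p.zero_closed subringE(2)[OF Rees_subring] by blast
      moreover have "?a \<notin> Q 0" using f(2) p(2) by blast
      ultimately show ?thesis using ab by (metis (no_types, lifting))
    qed
    from P.adjoin_list_chain[OF B(1,2) xs(1) chain this]
    obtain m C where C: "prime_chain (P\<lparr>carrier := ?B\<rparr>) m C" "n \<le> m" by blast
    obtain m' C' where "prime_chain (P\<lparr>carrier := A\<rparr>) m' C'" "m \<le> m' + 1"
      using ring_adjoin_chain[OF noethA C(1)] by blast
    then show ?thesis using chainA C(2) le_trans by blast
  next
    case False
    have chain: "prime_chain (P\<lparr>carrier := P.adjoin_list A xs\<rparr>) n Q"
      using Q unfolding adjoin[OF A noethA order_refl A_Rees] by (subst (asm) rees_algebra_eq)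
    have "\<exists>a\<in>A. \<exists>b\<in>A. a \<notin> Q 0 \<and> a \<otimes>\<^bsub>P\<^esub> x \<oplus>\<^bsub>P\<^esub> b \<in> Q 0" if x: "x \<in> set xs" for x
    proof -
      obtain g where g: "g \<in> G" "x = pmonom g 1" using x gs unfolding xs_def by auto
      have gc: "g \<in> carrier R" using g G(1) by blast
      have "pmonom g 0 \<otimes>\<^bsub>P\<^esub> pmonom \<one> 1 \<in> p"
        using False g(1) GI by (intro p.I_r_closed) auto
      then have "x \<in> p" unfolding g(2) using monom_mult[OF gc R.one_closed, of 0 1] gc by simp
      then have "x \<in> Q 0" unfolding p(2) using x xs(2) by blast
      moreover have "\<one>\<^bsub>P\<^esub> \<otimes>\<^bsub>P\<^esub> x \<oplus>\<^bsub>P\<^esub> \<zero>\<^bsub>P\<^esub> = x" unfolding g(2) using gc by simp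
      moreover have "\<one>\<^bsub>P\<^esub> \<notin> Q 0" unfolding p(2) using p.one_imp_carrier p.I_notcarr by blast
      ultimately show ?thesis using subringE(2,3)[OF A] by metis
    qed
    from P.adjoin_list_chain[OF A noethA xs(1) chain this]
    obtain m C where C: "prime_chain (P\<lparr>carrier := A\<rparr>) m C" "n \<le> m" by blast
    then show ?thesis using chainA le_SucI by fastforce
  qed
qed

text \<open>The prime \<open>p\<close> is chosen disjoint from all products \<open>a^k s\<close>
  with \<open>s\<close> in the Rees algebra outside \<open>Q 0\<close>. Products with
  \<open>k = 0\<close> force the intersection of \<open>p\<close> with the Rees algebra into
  \<open>Q 0\<close>, and \<open>s = 1\<close> keeps \<open>a\<close> out of \<open>p\<close>. Zero
  is not such a product, because \<open>a\<close> remains regular in \<open>R[u]\<close>.\<close>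

theorem rees_chain:
  assumes noeth: "noetherian_ring R" and Q: "prime_chain (rees_algebra R I) n Q"
    and a: "regular_element R a"
  shows "\<exists>m C. prime_chain R m C \<and> n \<le> m + 1 \<and> (pmonom a 0 \<in> Q 0 \<longrightarrow> n \<le> m)"
proof -
  let ?T = "rees_algebra R I"
  have T: "cring ?T" by (subst rees_algebra_eq) (rule P.subring_cring[OF Rees_subring])
  interpret T: cring ?T by (rule T)
  interpret Q0: primeideal "Q 0" ?T using Q unfolding prime_chain_def by simp
  have sub: "Rees \<subseteq> carrier P" using subringE(1)[OF Rees_subring] .
  have ops: "x \<otimes>\<^bsub>?T\<^esub> y = x \<otimes>\<^bsub>P\<^esub> y" "\<one>\<^bsub>?T\<^esub> = \<one>\<^bsub>P\<^esub>" "\<zero>\<^bsub>?T\<^esub> = \<zero>\<^bsub>P\<^esub>" for x y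
    unfolding rees_algebra_def P_def by simp_all
  have ac: "a \<in> carrier R" and areg: "\<And>x. x \<in> carrier R \<Longrightarrow> a \<otimes> x = \<zero> \<Longrightarrow> x = \<zero>"
    using a unfolding regular_element_def by auto
  let ?c = "pmonom a 0"
  have cc: "?c \<in> carrier P" using ac by simp
  have reg: "h = \<zero>\<^bsub>P\<^esub>" if h: "h \<in> carrier P" "?c \<otimes>\<^bsub>P\<^esub> h = \<zero>\<^bsub>P\<^esub>" for h
  proof (rule up_eqI[OF _ h(1) UP_zero_closed])
    fix i
    have "?c \<otimes>\<^bsub>P\<^esub> h = a \<odot>\<^bsub>P\<^esub> h" by (rule monom_mult_is_smult[OF ac h(1)])
    then have "pcoeff (a \<odot>\<^bsub>P\<^esub> h) i = pcoeff \<zero>\<^bsub>P\<^esub> i" using h(2) by simp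
    then have "a \<otimes> pcoeff h i = \<zero>" using coeff_smult[OF ac h(1), of i] by simp
    then show "pcoeff h i = pcoeff \<zero>\<^bsub>P\<^esub> i" using areg[of "pcoeff h i"] h(1) by simp
  qed
  have regn: "h = \<zero>\<^bsub>P\<^esub>" if h: "h \<in> carrier P" "(?c [^]\<^bsub>P\<^esub> (k::nat)) \<otimes>\<^bsub>P\<^esub> h = \<zero>\<^bsub>P\<^esub>" for h k
    using h
  proof (induction k arbitrary: h)
    case (Suc k)
    have "(?c [^]\<^bsub>P\<^esub> k) \<otimes>\<^bsub>P\<^esub> (?c \<otimes>\<^bsub>P\<^esub> h) = \<zero>\<^bsub>P\<^esub>" using Suc.prems cc by (simp add: P.m_assoc)
    then have "?c \<otimes>\<^bsub>P\<^esub> h = \<zero>\<^bsub>P\<^esub>" using Suc.IH[of "?c \<otimes>\<^bsub>P\<^esub> h"] Suc.prems cc by simp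
    then show ?case using reg Suc.prems by blast
  qed simp
  define S where "S = {(?c [^]\<^bsub>P\<^esub> (k::nat)) \<otimes>\<^bsub>P\<^esub> s | k s. s \<in> Rees - Q 0}"
  have SI: "(?c [^]\<^bsub>P\<^esub> (k::nat)) \<otimes>\<^bsub>P\<^esub> s \<in> S" if "s \<in> Rees" "s \<notin> Q 0" for k s
    unfolding S_def using that by blast
  have one: "\<one>\<^bsub>P\<^esub> \<in> Rees" "\<one>\<^bsub>P\<^esub> \<notin> Q 0"
    using T.one_closed Q0.one_imp_carrier Q0.I_notcarr ops(2) by auto
  have S: "submonoid S P"
  proof (rule submonoid.intro)
    show "S \<subseteq> carrier P" unfolding S_def using sub cc by auto
    show "\<one>\<^bsub>P\<^esub> \<in> S" using SI[OF one, of 0] by simp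
    fix x y assume "x \<in> S" "y \<in> S"
    then obtain k s l t where *: "x = (?c [^]\<^bsub>P\<^esub> (k::nat)) \<otimes>\<^bsub>P\<^esub> s" "y = (?c [^]\<^bsub>P\<^esub> (l::nat)) \<otimes>\<^bsub>P\<^esub> t"
      "s \<in> Rees" "s \<notin> Q 0" "t \<in> Rees" "t \<notin> Q 0" unfolding S_def by blast
    have "s \<otimes>\<^bsub>P\<^esub> t \<in> Rees" "s \<otimes>\<^bsub>P\<^esub> t \<notin> Q 0"
      using Q0.I_prime[OF *(3,5)] * T.m_closed[OF *(3,5)] unfolding ops by blast+
    moreover have "x \<otimes>\<^bsub>P\<^esub> y = (?c [^]\<^bsub>P\<^esub> (k + l)) \<otimes>\<^bsub>P\<^esub> (s \<otimes>\<^bsub>P\<^esub> t)"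
      unfolding *(1,2) P.nat_pow_mult[OF cc, symmetric] using * sub cc
      by (simp add: P.m_ac subsetD)
    ultimately show "x \<otimes>\<^bsub>P\<^esub> y \<in> S" using SI[of "s \<otimes>\<^bsub>P\<^esub> t" "k + l"] by simp
  qed
  have "\<zero>\<^bsub>P\<^esub> \<notin> S"
  proof
    assume "\<zero>\<^bsub>P\<^esub> \<in> S"
    then obtain k s where "(?c [^]\<^bsub>P\<^esub> (k::nat)) \<otimes>\<^bsub>P\<^esub> s = \<zero>\<^bsub>P\<^esub>" "s \<in> Rees" "s \<notin> Q 0" unfolding S_def by auto
    then show False using regn[of s k] sub Q0.zero_closed ops(3) by auto
  qed
  then obtain p where p: "primeideal p P" "p \<inter> S = {}"
    using P.prime_ideal_avoiding[OF hilbert_basis[OF noeth] P.zeroideal S] by blast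
  have le: "p \<inter> Rees \<subseteq> Q 0"
  proof
    fix s assume s: "s \<in> p \<inter> Rees"
    then have "s \<in> carrier P" using sub by blast
    then show "s \<in> Q 0" using s SI[of s 0] p(2) by (cases "s \<in> Q 0") auto
  qed
  have cp: "?c \<notin> p" using SI[OF one, of 1] p(2) cc by auto
  have inc: "ring_hom_ring ?T P (\<lambda>x. x)"
    using sub by (intro ring_hom_ringI2 T.ring_axioms P.ring_axioms) (auto simp: ring_hom_def rees_algebra_def P_def)
  have prime: "primeideal (p \<inter> Rees) ?T"
    using ring_hom_ring.primeideal_vimage[OF inc T p(1)] by (simp add: Int_def conj_commute)
  \<comment> \<open>If \<open>Q 0\<close> is already contracted from \<open>p\<close>, then
    \<open>a\<close> is not in \<open>Q 0\<close> and the sharper claim is vacuous. Otherwise the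
    longer chain of length \<open>n + 1\<close> loses at most one step, so that \<open>n\<close>
    steps remain.\<close>
  show ?thesis
  proof (cases "Q 0 = p \<inter> Rees")
    case True
    then show ?thesis using rees_chain_contracted[OF noeth Q p(1) True] cp by blast
  next
    case False
    let ?Q = "\<lambda>i. case i of 0 \<Rightarrow> p \<inter> Rees | Suc j \<Rightarrow> Q j"
    have "prime_chain ?T (Suc n) ?Q"
      using Q prime le False unfolding prime_chain_def by (auto split: nat.splits)
    from rees_chain_contracted[OF noeth this p(1)]
    obtain m C where "prime_chain R m C" "Suc n \<le> m + 1" by auto
    then show ?thesis by (intro exI[of _ m] exI[of _ C]) auto
  qed
qed

end

section \<open>Monoid rings\<close>

locale comm_monoid_ring = R?: cring R + G: comm_monoid G
  for R (structure) and G (structure) +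
  fixes M
  defines M_def: "M \<equiv> monoid_ring R G"
begin

abbreviation "single \<equiv> mr_single R"

abbreviation supp where "supp p \<equiv> {g. p g \<noteq> \<zero>}"

lemma M_simps:
  "\<zero>\<^bsub>M\<^esub> = (\<lambda>g. \<zero>)" "\<one>\<^bsub>M\<^esub> = single \<one> \<one>\<^bsub>G\<^esub>" "p \<oplus>\<^bsub>M\<^esub> q = (\<lambda>g. p g \<oplus> q g)"
  unfolding M_def monoid_ring_def mr_single_def by simp_all

lemma M_carrier:
  "p \<in> carrier M \<longleftrightarrow> (\<forall>g. p g \<in> carrier R) \<and> supp p \<subseteq> carrier G \<and> finite (supp p)"
proof -
  have "p g \<in> carrier R" if "\<forall>g\<in>carrier G. p g \<in> carrier R" "\<forall>g. g \<notin> carrier G \<longrightarrow> p g = \<zero>" for g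
    using that by (cases "g \<in> carrier G") auto
  then show ?thesis unfolding M_def monoid_ring_def by auto
qed

lemma M_closed: "p \<in> carrier M \<Longrightarrow> p g \<in> carrier R"
  using M_carrier by blast

lemma single_closed: "a \<in> carrier R \<Longrightarrow> g \<in> carrier G \<Longrightarrow> single a g \<in> carrier M"
  unfolding M_carrier mr_single_def by (auto intro: finite_subset[of _ "{g}"])

lemma M_add_closed:
  assumes "p \<in> carrier M" "q \<in> carrier M"
  shows "p \<oplus>\<^bsub>M\<^esub> q \<in> carrier M"
proof -
  have "supp (\<lambda>g. p g \<oplus> q g) \<subseteq> supp p \<union> supp q" by auto
  then have "supp (\<lambda>g. p g \<oplus> q g) \<subseteq> carrier G" "finite (supp (\<lambda>g. p g \<oplus> q g))"
    using assms finite_subset[of _ "supp p \<union> supp q"] unfolding M_carrier by auto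
  then show ?thesis using assms unfolding M_carrier M_simps by auto
qed

text \<open>Finitely supported functions are finite sums of monomials. Ring axioms and
  multiplicativity of maps are additive in each argument, so this induction reduces them to
  monomials.\<close>

lemma M_induct [consumes 1, case_names zero add]:
  assumes "p \<in> carrier M" "\<phi> \<zero>\<^bsub>M\<^esub>"
    and "\<And>p a g. p \<in> carrier M \<Longrightarrow> \<phi> p \<Longrightarrow> a \<in> carrier R \<Longrightarrow> g \<in> carrier G \<Longrightarrow> \<phi> (p \<oplus>\<^bsub>M\<^esub> single a g)"
  shows "\<phi> p"
  using assms(1)
proof (induction "card (supp p)" arbitrary: p)
  case 0
  then have "supp p = {}" unfolding M_carrier by simp
  then have "p = \<zero>\<^bsub>M\<^esub>" unfolding M_simps by auto
  then show ?case using assms(2) by simp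
next
  case (Suc n)
  then obtain g where g: "g \<in> supp p" by (metis card.empty ex_in_conv nat.distinct(1))
  let ?q = "p(g := \<zero>)"
  have supp: "supp ?q = supp p - {g}" by auto
  have q: "?q \<in> carrier M" using Suc.prems unfolding M_carrier supp by auto
  have "card (supp ?q) = n" using Suc g unfolding supp M_carrier by simp
  then have "\<phi> ?q" using Suc q by simp
  moreover have "g \<in> carrier G" "p g \<in> carrier R" using g Suc.prems unfolding M_carrier by auto
  moreover have "p = ?q \<oplus>\<^bsub>M\<^esub> single (p g) g"
    using M_closed[OF Suc.prems] unfolding M_simps mr_single_def by auto
  ultimately show ?case using assms(3)[OF q] by metis
qed

text \<open>The defining sum has an index set that depends on the supports and on \<open>g\<close>.
  Padding with zeros to a fixed finite rectangle makes sums for different factors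
  comparable.\<close>

lemma M_mult:
  assumes "p \<in> carrier M" "q \<in> carrier M" "finite A" "finite B" "supp p \<subseteq> A" "supp q \<subseteq> B"
  shows "(p \<otimes>\<^bsub>M\<^esub> q) g = (\<Oplus>x\<in>A \<times> B. if fst x \<otimes>\<^bsub>G\<^esub> snd x = g then p (fst x) \<otimes> q (snd x) else \<zero>)"
proof -
  let ?S = "{(h, k). p h \<noteq> \<zero> \<and> q k \<noteq> \<zero> \<and> h \<otimes>\<^bsub>G\<^esub> k = g}"
  have "(p \<otimes>\<^bsub>M\<^esub> q) g = (\<Oplus>x\<in>?S. (\<lambda>(h, k). p h \<otimes> q k) x)"
    unfolding M_def monoid_ring_def by simp
  also have "\<dots> = (\<Oplus>x\<in>A \<times> B. if fst x \<otimes>\<^bsub>G\<^esub> snd x = g then p (fst x) \<otimes> q (snd x) else \<zero>)"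
  proof (rule R.add.finprod_mono_neutral_cong_left)
    show "finite (A \<times> B)" "?S \<subseteq> A \<times> B" using assms by auto
    show "(if fst i \<otimes>\<^bsub>G\<^esub> snd i = g then p (fst i) \<otimes> q (snd i) else \<zero>) = \<zero>" if "i \<in> A \<times> B - ?S" for i
      using that M_closed[OF assms(1)] M_closed[OF assms(2)] by auto
  qed (use M_closed[OF assms(1)] M_closed[OF assms(2)] in auto)
  finally show ?thesis .
qed

lemma M_mult_single:
  assumes "a \<in> carrier R" "g \<in> carrier G" "b \<in> carrier R" "h \<in> carrier G"
  shows "single a g \<otimes>\<^bsub>M\<^esub> single b h = single (a \<otimes> b) (g \<otimes>\<^bsub>G\<^esub> h)"
proof
  fix k
  have "(single a g \<otimes>\<^bsub>M\<^esub> single b h) k =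
    (\<Oplus>x\<in>{g} \<times> {h}. if fst x \<otimes>\<^bsub>G\<^esub> snd x = k then single a g (fst x) \<otimes> single b h (snd x) else \<zero>)"
    using assms by (intro M_mult single_closed) (auto simp: mr_single_def)
  also have "{g} \<times> {h} = {(g, h)}" by simp
  also have "(\<Oplus>x\<in>{(g, h)}. if fst x \<otimes>\<^bsub>G\<^esub> snd x = k then single a g (fst x) \<otimes> single b h (snd x) else \<zero>)
    = single (a \<otimes> b) (g \<otimes>\<^bsub>G\<^esub> h) k"
    using assms by (subst R.finsum_insert) (auto simp: mr_single_def)
  finally show "(single a g \<otimes>\<^bsub>M\<^esub> single b h) k = single (a \<otimes> b) (g \<otimes>\<^bsub>G\<^esub> h) k" .
qed

lemma M_mult_zero:
  assumes "p \<in> carrier M"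
  shows "\<zero>\<^bsub>M\<^esub> \<otimes>\<^bsub>M\<^esub> p = \<zero>\<^bsub>M\<^esub>" "p \<otimes>\<^bsub>M\<^esub> \<zero>\<^bsub>M\<^esub> = \<zero>\<^bsub>M\<^esub>"
  unfolding M_simps by (auto simp: M_def monoid_ring_def)

lemma M_l_distr:
  assumes "p \<in> carrier M" "q \<in> carrier M" "r \<in> carrier M"
  shows "(p \<oplus>\<^bsub>M\<^esub> q) \<otimes>\<^bsub>M\<^esub> r = p \<otimes>\<^bsub>M\<^esub> r \<oplus>\<^bsub>M\<^esub> q \<otimes>\<^bsub>M\<^esub> r"
proof
  fix g
  let ?A = "supp p \<union> supp q" and ?B = "supp r"
  have fin: "finite ?A" "finite ?B" using assms unfolding M_carrier by auto
  note c = M_closed[OF assms(1)] M_closed[OF assms(2)] M_closed[OF assms(3)]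
  have sub: "supp (p \<oplus>\<^bsub>M\<^esub> q) \<subseteq> ?A" unfolding M_simps by auto
  let ?t = "\<lambda>p x. if fst x \<otimes>\<^bsub>G\<^esub> snd x = g then p (fst x) \<otimes> r (snd x) else \<zero>"
  have "((p \<oplus>\<^bsub>M\<^esub> q) \<otimes>\<^bsub>M\<^esub> r) g = (\<Oplus>x\<in>?A \<times> ?B. ?t (p \<oplus>\<^bsub>M\<^esub> q) x)"
    by (rule M_mult[OF M_add_closed[OF assms(1,2)] assms(3) fin sub order_refl])
  also have "\<dots> = (\<Oplus>x\<in>?A \<times> ?B. ?t p x \<oplus> ?t q x)"
    using c by (intro R.finsum_cong') (auto simp: M_simps R.l_distr)
  also have "\<dots> = (\<Oplus>x\<in>?A \<times> ?B. ?t p x) \<oplus> (\<Oplus>x\<in>?A \<times> ?B. ?t q x)"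
    using c by (intro R.finsum_addf) auto
  also have "(\<Oplus>x\<in>?A \<times> ?B. ?t p x) = (p \<otimes>\<^bsub>M\<^esub> r) g"
    using fin by (intro M_mult[symmetric] assms) auto
  also have "(\<Oplus>x\<in>?A \<times> ?B. ?t q x) = (q \<otimes>\<^bsub>M\<^esub> r) g"
    using fin by (intro M_mult[symmetric] assms) auto
  finally show "((p \<oplus>\<^bsub>M\<^esub> q) \<otimes>\<^bsub>M\<^esub> r) g = (p \<otimes>\<^bsub>M\<^esub> r \<oplus>\<^bsub>M\<^esub> q \<otimes>\<^bsub>M\<^esub> r) g" unfolding M_simps .
qed

lemma M_m_comm:
  assumes "p \<in> carrier M" "q \<in> carrier M"
  shows "p \<otimes>\<^bsub>M\<^esub> q = q \<otimes>\<^bsub>M\<^esub> p"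
proof
  fix g
  have comm: "h \<otimes>\<^bsub>G\<^esub> k = k \<otimes>\<^bsub>G\<^esub> h" if "p h \<noteq> \<zero>" "q k \<noteq> \<zero>" for h k
    using that assms unfolding M_carrier by (intro G.m_comm) auto
  have img: "{(h, k). p h \<noteq> \<zero> \<and> q k \<noteq> \<zero> \<and> h \<otimes>\<^bsub>G\<^esub> k = g} =
    prod.swap ` {(h, k). q h \<noteq> \<zero> \<and> p k \<noteq> \<zero> \<and> h \<otimes>\<^bsub>G\<^esub> k = g}" (is "?A = prod.swap ` ?B")
  proof
    show "?A \<subseteq> prod.swap ` ?B"
    proof
      fix x assume "x \<in> ?A"
      then show "x \<in> prod.swap ` ?B" using comm by (intro image_eqI[of _ _ "prod.swap x"]) (auto intro: comm[symmetric])
    qed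
    show "prod.swap ` ?B \<subseteq> ?A" using comm by auto
  qed
  have "(p \<otimes>\<^bsub>M\<^esub> q) g = (\<Oplus>x\<in>{(h, k). p h \<noteq> \<zero> \<and> q k \<noteq> \<zero> \<and> h \<otimes>\<^bsub>G\<^esub> k = g}. (\<lambda>(h, k). p h \<otimes> q k) x)"
    unfolding M_def monoid_ring_def by simp
  also have "\<dots> = (\<Oplus>x\<in>{(h, k). q h \<noteq> \<zero> \<and> p k \<noteq> \<zero> \<and> h \<otimes>\<^bsub>G\<^esub> k = g}. (\<lambda>(h, k). p h \<otimes> q k) (prod.swap x))"
    unfolding img using M_closed[OF assms(1)] M_closed[OF assms(2)]
    by (intro R.finsum_reindex) (auto simp: inj_on_def)
  also have "\<dots> = (\<Oplus>x\<in>{(h, k). q h \<noteq> \<zero> \<and> p k \<noteq> \<zero> \<and> h \<otimes>\<^bsub>G\<^esub> k = g}. (\<lambda>(h, k). q h \<otimes> p k) x)"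
    using M_closed[OF assms(1)] M_closed[OF assms(2)] R.m_comm by (intro R.finsum_cong') auto
  also have "\<dots> = (q \<otimes>\<^bsub>M\<^esub> p) g"
    unfolding M_def monoid_ring_def by simp
  finally show "(p \<otimes>\<^bsub>M\<^esub> q) g = (q \<otimes>\<^bsub>M\<^esub> p) g" .
qed

lemma M_abelian_group: "abelian_group M"
proof (rule abelian_groupI)
  show "\<zero>\<^bsub>M\<^esub> \<in> carrier M" unfolding M_carrier M_simps by simp
  fix x assume x: "x \<in> carrier M"
  then have "(\<lambda>g. \<ominus> x g) \<in> carrier M"
    unfolding M_carrier using R.minus_minus R.minus_zero
    by auto
  then show "\<exists>y\<in>carrier M. y \<oplus>\<^bsub>M\<^esub> x = \<zero>\<^bsub>M\<^esub>"
    using M_closed[OF x] by (intro bexI[of _ "\<lambda>g. \<ominus> x g"]) (auto simp: M_simps R.l_neg)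
qed (simp_all add: M_add_closed, simp_all add: M_simps M_closed R.a_ac)

lemma M_mult_closed:
  assumes "p \<in> carrier M" "q \<in> carrier M"
  shows "p \<otimes>\<^bsub>M\<^esub> q \<in> carrier M"
proof -
  interpret M: abelian_group M by (rule M_abelian_group)
  have "single a g \<otimes>\<^bsub>M\<^esub> q \<in> carrier M" if ag: "a \<in> carrier R" "g \<in> carrier G" for a g
    using assms(2)
  proof (induction rule: M_induct)
    case zero
    then show ?case using M_mult_zero(2)[OF single_closed[OF ag]] by simp
  next
    case (add p b h)
    have "single a g \<otimes>\<^bsub>M\<^esub> (p \<oplus>\<^bsub>M\<^esub> single b h) = (p \<oplus>\<^bsub>M\<^esub> single b h) \<otimes>\<^bsub>M\<^esub> single a g"
      using add ag by (intro M_m_comm single_closed M.a_closed)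
    also have "\<dots> = p \<otimes>\<^bsub>M\<^esub> single a g \<oplus>\<^bsub>M\<^esub> single b h \<otimes>\<^bsub>M\<^esub> single a g"
      using add ag by (intro M_l_distr single_closed)
    also have "p \<otimes>\<^bsub>M\<^esub> single a g = single a g \<otimes>\<^bsub>M\<^esub> p" using add ag by (intro M_m_comm single_closed)
    finally show ?case using add ag by (simp add: M_mult_single single_closed M.a_closed)
  qed
  note * = this
  show ?thesis
    using assms(1)
  proof (induction rule: M_induct)
    case zero
    then show ?case using M_mult_zero(1)[OF assms(2)] by simp
  next
    case (add p b h)
    then show ?case using assms(2) * by (simp add: M_l_distr single_closed)
  qed
qed

lemma M_r_distr:
  assumes "p \<in> carrier M" "q \<in> carrier M" "r \<in> carrier M"
  shows "r \<otimes>\<^bsub>M\<^esub> (p \<oplus>\<^bsub>M\<^esub> q) = r \<otimes>\<^bsub>M\<^esub> p \<oplus>\<^bsub>M\<^esub> r \<otimes>\<^bsub>M\<^esub> q"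
  using M_l_distr[OF assms] assms by (simp add: M_m_comm[of r] M_add_closed)

lemma M_m_assoc:
  assumes "p \<in> carrier M" "q \<in> carrier M" "r \<in> carrier M"
  shows "(p \<otimes>\<^bsub>M\<^esub> q) \<otimes>\<^bsub>M\<^esub> r = p \<otimes>\<^bsub>M\<^esub> (q \<otimes>\<^bsub>M\<^esub> r)"
  using assms(1)
proof (induction rule: M_induct)
  case zero
  then show ?case using assms by (simp add: M_mult_zero M_mult_closed)
next
  case (add p a g)
  have "(single a g \<otimes>\<^bsub>M\<^esub> q) \<otimes>\<^bsub>M\<^esub> r = single a g \<otimes>\<^bsub>M\<^esub> (q \<otimes>\<^bsub>M\<^esub> r)"
    using assms(2)
  proof (induction rule: M_induct)
    case zero
    then show ?case using assms add by (simp add: M_mult_zero M_mult_closed single_closed)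
  next
    case (add q b h)
    have "(single a g \<otimes>\<^bsub>M\<^esub> single b h) \<otimes>\<^bsub>M\<^esub> r = single a g \<otimes>\<^bsub>M\<^esub> (single b h \<otimes>\<^bsub>M\<^esub> r)"
      using assms(3)
    proof (induction rule: M_induct)
      case zero
      then show ?case using \<open>a \<in> carrier R\<close> \<open>g \<in> carrier G\<close> add by (simp add: M_mult_zero M_mult_closed single_closed)
    next
      case (add r c k)
      then show ?case using \<open>a \<in> carrier R\<close> \<open>g \<in> carrier G\<close> \<open>b \<in> carrier R\<close> \<open>h \<in> carrier G\<close>
        by (simp add: M_r_distr M_mult_single M_mult_closed single_closed R.m_assoc G.m_assoc)
    qed
    then show ?case using add assms(3) \<open>a \<in> carrier R\<close> \<open>g \<in> carrier G\<close>
      by (simp add: M_r_distr M_l_distr M_mult_closed single_closed)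
  qed
  then show ?case using add assms
    by (simp add: M_l_distr M_mult_closed single_closed)
qed

theorem M_cring: "cring M"
proof (rule cringI[OF M_abelian_group])
  have one: "\<one>\<^bsub>M\<^esub> \<in> carrier M" unfolding M_simps(2) by (intro single_closed) auto
  have l_one: "\<one>\<^bsub>M\<^esub> \<otimes>\<^bsub>M\<^esub> p = p" if "p \<in> carrier M" for p
    using that
  proof (induction rule: M_induct)
    case zero
    then show ?case using M_mult_zero(2)[OF one] .
  next
    case (add p a g)
    then have "\<one>\<^bsub>M\<^esub> \<otimes>\<^bsub>M\<^esub> single a g = single a g" unfolding M_simps(2) by (simp add: M_mult_single)
    then show ?case using add one by (simp add: M_r_distr single_closed)
  qed
  show "comm_monoid M"
    by (intro comm_monoidI one l_one M_m_comm M_mult_closed M_m_assoc)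
qed (rule M_l_distr)

sublocale M: cring M by (rule M_cring)

end

text \<open>The data of the universal property of a monoid ring: a map on coefficients and a monoid
  homomorphism on the basis. Since \<open>hom\<close> only asks for multiplicativity, preservation
  of the unit is a separate assumption.\<close>

locale comm_monoid_ring_hom = comm_monoid_ring + T: cring T for T (structure) +
  fixes h \<mu>
  assumes h: "h \<in> ring_hom R T" and \<mu>: "\<mu> \<in> hom G T" and \<mu>_one: "\<mu> \<one>\<^bsub>G\<^esub> = \<one>\<^bsub>T\<^esub>"
begin

sublocale h: ring_hom_ring R T h
  by (rule ring_hom_ringI2[OF R.ring_axioms T.ring_axioms h])

definition M_eval where "M_eval p = (\<Oplus>\<^bsub>T\<^esub>g\<in>supp p. h (p g) \<otimes>\<^bsub>T\<^esub> \<mu> g)"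

lemma \<mu>_closed: "g \<in> carrier G \<Longrightarrow> \<mu> g \<in> carrier T"
  using \<mu> unfolding hom_def by auto

lemma M_eval_eq:
  assumes "p \<in> carrier M" "finite A" "supp p \<subseteq> A" "A \<subseteq> carrier G"
  shows "M_eval p = (\<Oplus>\<^bsub>T\<^esub>g\<in>A. h (p g) \<otimes>\<^bsub>T\<^esub> \<mu> g)"
  unfolding M_eval_def
  using assms M_closed[OF assms(1)] \<mu>_closed
  by (intro T.add.finprod_mono_neutral_cong_left) auto

lemma M_eval_add:
  assumes "p \<in> carrier M" "q \<in> carrier M"
  shows "M_eval (p \<oplus>\<^bsub>M\<^esub> q) = M_eval p \<oplus>\<^bsub>T\<^esub> M_eval q"
proof -
  let ?A = "supp p \<union> supp q"
  have A: "finite ?A" "?A \<subseteq> carrier G" using assms unfolding M_carrier by auto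
  note c = M_closed[OF assms(1)] M_closed[OF assms(2)] \<mu>_closed[OF subsetD[OF A(2)]]
  have "M_eval (p \<oplus>\<^bsub>M\<^esub> q) = (\<Oplus>\<^bsub>T\<^esub>g\<in>?A. h ((p \<oplus>\<^bsub>M\<^esub> q) g) \<otimes>\<^bsub>T\<^esub> \<mu> g)"
    using A M_add_closed[OF assms] by (intro M_eval_eq) (auto simp: M_simps)
  also have "\<dots> = (\<Oplus>\<^bsub>T\<^esub>g\<in>?A. h (p g) \<otimes>\<^bsub>T\<^esub> \<mu> g \<oplus>\<^bsub>T\<^esub> h (q g) \<otimes>\<^bsub>T\<^esub> \<mu> g)"
    using c by (intro T.finsum_cong') (auto simp: M_simps T.l_distr)
  also have "\<dots> = (\<Oplus>\<^bsub>T\<^esub>g\<in>?A. h (p g) \<otimes>\<^bsub>T\<^esub> \<mu> g) \<oplus>\<^bsub>T\<^esub> (\<Oplus>\<^bsub>T\<^esub>g\<in>?A. h (q g) \<otimes>\<^bsub>T\<^esub> \<mu> g)"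
    using c by (intro T.finsum_addf) auto
  also have "\<dots> = M_eval p \<oplus>\<^bsub>T\<^esub> M_eval q"
    using A M_eval_eq[OF assms(1), of ?A] M_eval_eq[OF assms(2), of ?A] by simp
  finally show ?thesis .
qed

lemma M_eval_single:
  assumes "a \<in> carrier R" "g \<in> carrier G"
  shows "M_eval (single a g) = h a \<otimes>\<^bsub>T\<^esub> \<mu> g"
proof -
  have "M_eval (single a g) = (\<Oplus>\<^bsub>T\<^esub>k\<in>{g}. h (single a g k) \<otimes>\<^bsub>T\<^esub> \<mu> k)"
    using assms by (intro M_eval_eq single_closed) (auto simp: mr_single_def)
  also have "\<dots> = h a \<otimes>\<^bsub>T\<^esub> \<mu> g"
    using assms \<mu>_closed by (subst T.finsum_insert) (auto simp: mr_single_def)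
  finally show ?thesis .
qed

lemma M_eval_closed: "p \<in> carrier M \<Longrightarrow> M_eval p \<in> carrier T"
  unfolding M_eval_def using M_closed \<mu>_closed M_carrier by (intro T.finsum_closed) auto

lemma M_eval_zero: "M_eval \<zero>\<^bsub>M\<^esub> = \<zero>\<^bsub>T\<^esub>"
  unfolding M_eval_def M_simps by simp

theorem M_eval_hom: "M_eval \<in> ring_hom M T"
proof (rule ring_hom_memI)
  show "M_eval \<one>\<^bsub>M\<^esub> = \<one>\<^bsub>T\<^esub>" unfolding M_simps(2) by (simp add: M_eval_single \<mu>_one)
  fix p q assume p: "p \<in> carrier M" and q: "q \<in> carrier M"
  show "M_eval (p \<otimes>\<^bsub>M\<^esub> q) = M_eval p \<otimes>\<^bsub>T\<^esub> M_eval q"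
    using p
  proof (induction rule: M_induct)
    case zero
    then show ?case using q by (simp add: M_eval_zero M_eval_closed)
  next
    case (add p a g)
    note ag = \<open>a \<in> carrier R\<close> \<open>g \<in> carrier G\<close>
    have "M_eval (single a g \<otimes>\<^bsub>M\<^esub> q) = M_eval (single a g) \<otimes>\<^bsub>T\<^esub> M_eval q"
      using q
    proof (induction rule: M_induct)
      case zero
      then show ?case using ag by (simp add: single_closed M_eval_zero M_eval_closed)
    next
      case (add q b k)
      have "M_eval (single a g \<otimes>\<^bsub>M\<^esub> single b k) = M_eval (single a g) \<otimes>\<^bsub>T\<^esub> M_eval (single b k)"
        using add ag \<mu>_closed hom_mult[OF \<mu>, of g k]
        by (simp add: M_mult_single M_eval_single T.m_ac)
      then show ?case using add ag
        by (simp add: M.r_distr single_closed M_eval_add T.r_distr M_eval_closed)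
    qed
    then show ?case using add q
      by (simp add: M.l_distr single_closed M_eval_add T.l_distr M_eval_closed)
  qed
qed (rule M_eval_closed M_eval_add; assumption)+

end

text \<open>The induced map is written with \<open>the_elem\<close> so that it matches the form of
  \<open>sym_lift\<close>.\<close>

lemma quotient_ring_hom:
  assumes "ring R" "ring T" "\<phi> \<in> ring_hom R T" "ideal K R" "\<And>x. x \<in> K \<Longrightarrow> \<phi> x = \<zero>\<^bsub>T\<^esub>"
  shows "(\<lambda>c. the_elem (\<phi> ` c)) \<in> ring_hom (R Quot K) T"
    and "\<And>x. x \<in> carrier R \<Longrightarrow> the_elem (\<phi> ` (K +>\<^bsub>R\<^esub> x)) = \<phi> x"
proof -
  interpret R: ring R by fact
  interpret T: ring T by fact
  interpret K: ideal K R by fact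
  show coset: "the_elem (\<phi> ` (K +>\<^bsub>R\<^esub> x)) = \<phi> x" if x: "x \<in> carrier R" for x
  proof -
    have "\<phi> y = \<phi> x" if y: "y \<in> K +>\<^bsub>R\<^esub> x" for y
    proof -
      obtain k where k: "k \<in> K" "y = k \<oplus>\<^bsub>R\<^esub> x" using y unfolding a_r_coset_def' by blast
      have "\<phi> y = \<phi> k \<oplus>\<^bsub>T\<^esub> \<phi> x" unfolding k(2) by (rule ring_hom_add[OF assms(3) K.Icarr[OF k(1)] x])
      then show ?thesis using assms(5)[OF k(1)] ring_hom_closed[OF assms(3) x] by simp
    qed
    moreover have "x \<in> K +>\<^bsub>R\<^esub> x" using K.a_rcos_self[OF x] .
    ultimately have "\<phi> ` (K +>\<^bsub>R\<^esub> x) = {\<phi> x}" by blast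
    then show ?thesis by (simp only: the_elem_eq)
  qed
  have rep: "\<exists>x\<in>carrier R. c = K +>\<^bsub>R\<^esub> x" if "c \<in> carrier (R Quot K)" for c
    using that unfolding FactRing_def A_RCOSETS_def' partial_object.select_convs by blast
  show "(\<lambda>c. the_elem (\<phi> ` c)) \<in> ring_hom (R Quot K) T"
  proof (rule ring_hom_memI)
    have "\<one>\<^bsub>R Quot K\<^esub> = K +>\<^bsub>R\<^esub> \<one>\<^bsub>R\<^esub>" unfolding FactRing_def by simp
    then show "the_elem (\<phi> ` \<one>\<^bsub>R Quot K\<^esub>) = \<one>\<^bsub>T\<^esub>"
      using coset[OF R.one_closed] ring_hom_one[OF assms(3)] by (simp only:)
    fix c d assume c: "c \<in> carrier (R Quot K)" and d: "d \<in> carrier (R Quot K)"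
    obtain x y where xy: "x \<in> carrier R" "y \<in> carrier R" "c = K +>\<^bsub>R\<^esub> x" "d = K +>\<^bsub>R\<^esub> y"
      using rep[OF c] rep[OF d] by blast
    note hom = ring_hom_mult[OF K.rcos_ring_hom xy(1,2)] ring_hom_add[OF K.rcos_ring_hom xy(1,2)]
    show "the_elem (\<phi> ` c) \<in> carrier T"
      unfolding xy(3) coset[OF xy(1)] by (rule ring_hom_closed[OF assms(3) xy(1)])
    show "the_elem (\<phi> ` (c \<otimes>\<^bsub>R Quot K\<^esub> d)) = the_elem (\<phi> ` c) \<otimes>\<^bsub>T\<^esub> the_elem (\<phi> ` d)"
      unfolding xy(3,4) hom[symmetric] coset[OF xy(1)] coset[OF xy(2)] coset[OF R.m_closed[OF xy(1,2)]]
      by (rule ring_hom_mult[OF assms(3) xy(1,2)])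
    show "the_elem (\<phi> ` (c \<oplus>\<^bsub>R Quot K\<^esub> d)) = the_elem (\<phi> ` c) \<oplus>\<^bsub>T\<^esub> the_elem (\<phi> ` d)"
      unfolding xy(3,4) hom[symmetric] coset[OF xy(1)] coset[OF xy(2)] coset[OF R.a_closed[OF xy(1,2)]]
      by (rule ring_hom_add[OF assms(3) xy(1,2)])
  qed
qed

section \<open>Symmetric algebras and tensor products\<close>

lemma (in ring_hom_ring) kernel_minus_mem:
  assumes "x \<in> carrier R" "y \<in> carrier R" "h x = h y"
  shows "x \<ominus>\<^bsub>R\<^esub> y \<in> a_kernel R S h"
proof -
  have "h (x \<ominus>\<^bsub>R\<^esub> y) = h x \<ominus>\<^bsub>S\<^esub> h y" using assms(1,2) by (simp add: R.minus_eq S.minus_eq)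
  also have "\<dots> = \<zero>\<^bsub>S\<^esub>" unfolding assms(3) S.minus_eq by (rule S.r_neg[OF hom_closed[OF assms(2)]])
  finally show ?thesis unfolding a_kernel_def' using R.minus_closed[OF assms(1,2)] by blast
qed

section \<open>Symmetric algebras and their universal property\<close>

lemma free_comm_monoid: "comm_monoid (free_comm_monoid V)"
  by (rule comm_monoidI) (auto simp: free_comm_monoid_def ac_simps)

lemma free_comm_monoid_simps:
  "m \<in> carrier (free_comm_monoid V) \<longleftrightarrow> set_mset m \<subseteq> V"
  "\<one>\<^bsub>free_comm_monoid V\<^esub> = {#}" "m \<otimes>\<^bsub>free_comm_monoid V\<^esub> n = m + n"
  unfolding free_comm_monoid_def by simp_all

lemma (in comm_monoid) mset_eval_hom:
  assumes "v \<in> V \<rightarrow> carrier G"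
  shows "(\<lambda>m. \<Otimes>x\<in>set_mset m. v x [^] count m x) \<in> hom (free_comm_monoid V) G"
proof (rule homI)
  \<comment> \<open>The supports of \<open>m\<close>, \<open>n\<close> and \<open>m + n\<close>
    differ. Enlarging an index set only adds factors with exponent zero.\<close>
  have wider: "(\<Otimes>x\<in>set_mset m. v x [^] count m x) = (\<Otimes>x\<in>A. v x [^] count m x)"
    if "finite A" "set_mset m \<subseteq> A" "A \<subseteq> V" for m A
    using that assms by (intro finprod_mono_neutral_cong_left) (auto simp: not_in_iff)
  fix m n assume mn: "m \<in> carrier (free_comm_monoid V)" "n \<in> carrier (free_comm_monoid V)"
  let ?A = "set_mset (m + n)"
  have A: "?A \<subseteq> V" using mn by (simp add: free_comm_monoid_simps)
  have v: "v x \<in> carrier G" if "x \<in> ?A" for x using that A assms by blast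
  show "(\<Otimes>x\<in>set_mset m. v x [^] count m x) \<in> carrier G"
    using v by (intro finprod_closed) auto
  have "(\<Otimes>x\<in>?A. v x [^] count (m + n) x) = (\<Otimes>x\<in>?A. v x [^] count m x \<otimes> v x [^] count n x)"
    using v by (intro finprod_cong') (auto simp: nat_pow_mult)
  also have "\<dots> = (\<Otimes>x\<in>?A. v x [^] count m x) \<otimes> (\<Otimes>x\<in>?A. v x [^] count n x)"
    using v by (intro finprod_multf) auto
  also have "\<dots> = (\<Otimes>x\<in>set_mset m. v x [^] count m x) \<otimes> (\<Otimes>x\<in>set_mset n. v x [^] count n x)"
    using wider[of ?A m] wider[of ?A n] A by simp
  finally show "(\<Otimes>x\<in>set_mset (m \<otimes>\<^bsub>free_comm_monoid V\<^esub> n). v x [^] count (m \<otimes>\<^bsub>free_comm_monoid V\<^esub> n) x) =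
    (\<Otimes>x\<in>set_mset m. v x [^] count m x) \<otimes> (\<Otimes>x\<in>set_mset n. v x [^] count n x)"
    unfolding free_comm_monoid_simps .
qed

locale symmetric_algebra = R: cring R for R :: "('a, 'm) ring_scheme" +
  fixes N :: "('a, 'x, 'n) module_scheme"
  assumes N_add: "x \<in> carrier N \<Longrightarrow> y \<in> carrier N \<Longrightarrow> x \<oplus>\<^bsub>N\<^esub> y \<in> carrier N"
    and N_smult: "r \<in> carrier R \<Longrightarrow> x \<in> carrier N \<Longrightarrow> r \<odot>\<^bsub>N\<^esub> x \<in> carrier N"
begin

sublocale F: comm_monoid_ring R "free_comm_monoid (carrier N)" "sym_poly R N"
  by (intro comm_monoid_ring.intro R.cring_axioms free_comm_monoid) (simp add: sym_poly_def)

abbreviation "K \<equiv> sym_ideal R N"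
abbreviation "coset p \<equiv> K +>\<^bsub>sym_poly R N\<^esub> p"

lemma var_closed: "r \<in> carrier R \<Longrightarrow> x \<in> carrier N \<Longrightarrow> mr_single R r {#x#} \<in> carrier (sym_poly R N)"
  by (rule F.single_closed) (simp_all add: free_comm_monoid_simps)

lemma scalar_closed: "r \<in> carrier R \<Longrightarrow> mr_single R r {#} \<in> carrier (sym_poly R N)"
  by (rule F.single_closed) (simp_all add: free_comm_monoid_simps)

abbreviation "relations \<equiv> {mr_single R \<one>\<^bsub>R\<^esub> {#x \<oplus>\<^bsub>N\<^esub> y#} \<ominus>\<^bsub>sym_poly R N\<^esub>
        (mr_single R \<one>\<^bsub>R\<^esub> {#x#} \<oplus>\<^bsub>sym_poly R N\<^esub> mr_single R \<one>\<^bsub>R\<^esub> {#y#})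
        | x y. x \<in> carrier N \<and> y \<in> carrier N} \<union>
     {mr_single R \<one>\<^bsub>R\<^esub> {#r \<odot>\<^bsub>N\<^esub> x#} \<ominus>\<^bsub>sym_poly R N\<^esub> mr_single R r {#x#}
        | r x. r \<in> carrier R \<and> x \<in> carrier N}"

lemma relations_closed: "relations \<subseteq> carrier (sym_poly R N)"
  using var_closed N_add N_smult by (auto intro!: F.M.minus_closed F.M.a_closed)

lemma K_ideal: "ideal K (sym_poly R N)"
  unfolding sym_ideal_def by (rule F.M.genideal_ideal[OF relations_closed])

sublocale K: ideal K "sym_poly R N" by (rule K_ideal)

lemma relations_K: "relations \<subseteq> K"
  unfolding sym_ideal_def by (rule F.M.genideal_self[OF relations_closed])

lemma sym_alg_cring: "cring (sym_alg R N)"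
  unfolding sym_alg_def by (rule K.quotient_is_cring[OF F.M.cring_axioms])

lemma coset_hom: "coset \<in> ring_hom (sym_poly R N) (sym_alg R N)"
  unfolding sym_alg_def by (rule K.rcos_ring_hom)

lemma coset_eqI:
  "p \<in> carrier (sym_poly R N) \<Longrightarrow> q \<in> carrier (sym_poly R N) \<Longrightarrow> p \<ominus>\<^bsub>sym_poly R N\<^esub> q \<in> K \<Longrightarrow> coset p = coset q"
  using F.M.quotient_eq_iff_same_a_r_cos[OF K_ideal] by blast

lemma sym_scalar_hom: "sym_scalar R N \<in> ring_hom R (sym_alg R N)"
proof -
  have "(\<lambda>r. mr_single R r {#}) \<in> ring_hom R (sym_poly R N)"
  proof (rule ring_hom_memI)
    fix r s assume rs: "r \<in> carrier R" "s \<in> carrier R"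
    show "mr_single R (r \<otimes>\<^bsub>R\<^esub> s) {#} = mr_single R r {#} \<otimes>\<^bsub>sym_poly R N\<^esub> mr_single R s {#}"
      using F.M_mult_single[of r "{#}" s "{#}"] rs by (simp add: free_comm_monoid_simps)
    show "mr_single R (r \<oplus>\<^bsub>R\<^esub> s) {#} = mr_single R r {#} \<oplus>\<^bsub>sym_poly R N\<^esub> mr_single R s {#}"
      unfolding F.M_simps by (auto simp: mr_single_def)
  qed (simp_all add: scalar_closed F.M_simps(2) free_comm_monoid_simps)
  from ring_hom_trans[OF this coset_hom] show ?thesis by (simp add: sym_scalar_def[abs_def] o_def)
qed

lemma sym_gen_closed: "x \<in> carrier N \<Longrightarrow> sym_gen R N x \<in> carrier (sym_alg R N)"
  unfolding sym_gen_def by (intro ring_hom_closed[OF coset_hom] var_closed) auto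

lemma sym_gen_add:
  assumes "x \<in> carrier N" "y \<in> carrier N"
  shows "sym_gen R N (x \<oplus>\<^bsub>N\<^esub> y) = sym_gen R N x \<oplus>\<^bsub>sym_alg R N\<^esub> sym_gen R N y"
proof -
  note c = var_closed[OF R.one_closed]
  have "coset (mr_single R \<one>\<^bsub>R\<^esub> {#x \<oplus>\<^bsub>N\<^esub> y#}) =
    coset (mr_single R \<one>\<^bsub>R\<^esub> {#x#} \<oplus>\<^bsub>sym_poly R N\<^esub> mr_single R \<one>\<^bsub>R\<^esub> {#y#})"
    using relations_K assms by (intro coset_eqI F.M.a_closed c N_add) auto
  then show ?thesis
    unfolding sym_gen_def using ring_hom_add[OF coset_hom c[OF assms(1)] c[OF assms(2)]] by simp
qed

lemma single_factor:
  assumes "r \<in> carrier R" "x \<in> carrier N" "set_mset m \<subseteq> carrier N"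
  shows "mr_single R r (m + {#x#}) = mr_single R r m \<otimes>\<^bsub>sym_poly R N\<^esub> mr_single R \<one>\<^bsub>R\<^esub> {#x#}"
  using F.M_mult_single[of r m "\<one>\<^bsub>R\<^esub>" "{#x#}"] assms by (simp add: free_comm_monoid_simps)

lemma sym_gen_smult:
  assumes "r \<in> carrier R" "x \<in> carrier N"
  shows "sym_gen R N (r \<odot>\<^bsub>N\<^esub> x) = sym_scalar R N r \<otimes>\<^bsub>sym_alg R N\<^esub> sym_gen R N x"
proof -
  have "coset (mr_single R \<one>\<^bsub>R\<^esub> {#r \<odot>\<^bsub>N\<^esub> x#}) = coset (mr_single R r {#x#})"
    using relations_K assms by (intro coset_eqI var_closed N_smult) auto
  then show ?thesis
    unfolding sym_gen_def sym_scalar_def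
    using single_factor[OF assms, of "{#}"]
      ring_hom_mult[OF coset_hom scalar_closed[OF assms(1)] var_closed[OF R.one_closed assms(2)]] by simp
qed

text \<open>Monomials are products of variables with a scalar. Both the surjectivity of maps onto
  the algebra and the equality of two maps on it follow from this, applied to an image and to an
  equalizer.\<close>

lemma sym_alg_generated:
  assumes S: "subring S (sym_alg R N)" "\<And>r. r \<in> carrier R \<Longrightarrow> sym_scalar R N r \<in> S"
    "\<And>x. x \<in> carrier N \<Longrightarrow> sym_gen R N x \<in> S"
  shows "carrier (sym_alg R N) \<subseteq> S"
proof
  have single: "coset (mr_single R r m) \<in> S" if "r \<in> carrier R" "set_mset m \<subseteq> carrier N" for r m
    using that(2)
  proof (induction m)
    case empty
    then show ?case using S(2)[OF that(1)] unfolding sym_scalar_def by simp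
  next
    case (add x m)
    have c: "mr_single R r m \<in> carrier (sym_poly R N)" "mr_single R \<one>\<^bsub>R\<^esub> {#x#} \<in> carrier (sym_poly R N)"
      using add.prems that(1) var_closed by (auto intro: F.single_closed simp: free_comm_monoid_simps)
    have "coset (mr_single R r (m + {#x#})) = coset (mr_single R r m) \<otimes>\<^bsub>sym_alg R N\<^esub> sym_gen R N x"
      using single_factor[OF that(1), of x m] add.prems ring_hom_mult[OF coset_hom c] unfolding sym_gen_def by simp
    also have "\<dots> \<in> S" using add by (intro subringE(6)[OF S(1)] S(3)) auto
    finally show ?case by simp
  qed
  fix c assume "c \<in> carrier (sym_alg R N)"
  then obtain p where p: "p \<in> carrier (sym_poly R N)" "c = coset p"
    unfolding sym_alg_def FactRing_def A_RCOSETS_def' by auto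
  have "coset p \<in> S"
    using p(1)
  proof (induction rule: F.M_induct)
    case zero
    have "coset \<zero>\<^bsub>sym_poly R N\<^esub> = \<zero>\<^bsub>sym_alg R N\<^esub>"
      using ring_hom_zero[OF coset_hom F.M.ring_axioms cring.axioms(1)[OF sym_alg_cring]] .
    then show ?case using subringE(2)[OF S(1)] by simp
  next
    case (add p r m)
    then have c: "mr_single R r m \<in> carrier (sym_poly R N)" by (intro F.single_closed)
    show ?case
      unfolding ring_hom_add[OF coset_hom add(1) c]
      using add by (intro subringE(7)[OF S(1)] single) (auto simp: free_comm_monoid_simps)
  qed
  then show "c \<in> S" using p by simp
qed

text \<open>Additivity and linearity of \<open>v\<close> say exactly that the evaluation takes equal
  values on the two sides of each defining relation, so its kernel contains the ideal that they
  generate.\<close>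

lemma sym_lift:
  fixes T :: "('s, 'k) ring_scheme"
  assumes T: "cring T" and h: "h \<in> ring_hom R T"
    and v: "\<And>x. x \<in> carrier N \<Longrightarrow> v x \<in> carrier T"
    and v_add: "\<And>x y. x \<in> carrier N \<Longrightarrow> y \<in> carrier N \<Longrightarrow> v (x \<oplus>\<^bsub>N\<^esub> y) = v x \<oplus>\<^bsub>T\<^esub> v y"
    and v_smult: "\<And>r x. r \<in> carrier R \<Longrightarrow> x \<in> carrier N \<Longrightarrow> v (r \<odot>\<^bsub>N\<^esub> x) = h r \<otimes>\<^bsub>T\<^esub> v x"
  shows "sym_lift R T h v \<in> ring_hom (sym_alg R N) T"
    and "\<And>r. r \<in> carrier R \<Longrightarrow> sym_lift R T h v (sym_scalar R N r) = h r"
    and "\<And>x. x \<in> carrier N \<Longrightarrow> sym_lift R T h v (sym_gen R N x) = v x"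
proof -
  interpret T: cring T by (rule T)
  let ?\<mu> = "\<lambda>m. \<Otimes>\<^bsub>T\<^esub>x\<in>set_mset m. v x [^]\<^bsub>T\<^esub> count m x"
  have v': "v \<in> carrier N \<rightarrow> carrier T" using v by blast
  interpret E: comm_monoid_ring_hom R "free_comm_monoid (carrier N)" "sym_poly R N" T h ?\<mu>
    using T.mset_eval_hom[OF v'] h
    by (intro comm_monoid_ring_hom.intro F.comm_monoid_ring_axioms T comm_monoid_ring_hom_axioms.intro)
      (auto simp: free_comm_monoid_simps sym_poly_def)
  have eval: "sym_eval R T h v = E.M_eval"
    unfolding sym_eval_def[abs_def] E.M_eval_def[abs_def] by simp
  have \<mu>1: "?\<mu> {#x#} = v x" if "x \<in> carrier N" for x
    using v[OF that] T.finprod_insert[of "{}" x "\<lambda>y. v y [^]\<^bsub>T\<^esub> count {#x#} y"] by simp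
  have ev_var: "E.M_eval (mr_single R r {#x#}) = h r \<otimes>\<^bsub>T\<^esub> v x" if "r \<in> carrier R" "x \<in> carrier N" for r x
    using E.M_eval_single[OF that(1), of "{#x#}"] that(2) \<mu>1 by (simp add: free_comm_monoid_simps)
  have ev_var1: "E.M_eval (mr_single R \<one>\<^bsub>R\<^esub> {#x#}) = v x" if "x \<in> carrier N" for x
    using ev_var[OF R.one_closed that] ring_hom_one[OF h] v[OF that] by simp
  interpret eh: ring_hom_ring "sym_poly R N" T E.M_eval
    by (rule ring_hom_ringI2[OF F.M.ring_axioms T.ring_axioms E.M_eval_hom])
  have "relations \<subseteq> a_kernel (sym_poly R N) T E.M_eval"
  proof (safe intro!: eh.kernel_minus_mem)
    fix x y assume xy: "x \<in> carrier N" "y \<in> carrier N"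
    note c = var_closed[OF R.one_closed]
    show "mr_single R \<one>\<^bsub>R\<^esub> {#x \<oplus>\<^bsub>N\<^esub> y#} \<in> carrier (sym_poly R N)"
      "mr_single R \<one>\<^bsub>R\<^esub> {#x#} \<oplus>\<^bsub>sym_poly R N\<^esub> mr_single R \<one>\<^bsub>R\<^esub> {#y#} \<in> carrier (sym_poly R N)"
      using xy by (auto intro!: F.M.a_closed c N_add)
    show "E.M_eval (mr_single R \<one>\<^bsub>R\<^esub> {#x \<oplus>\<^bsub>N\<^esub> y#}) =
      E.M_eval (mr_single R \<one>\<^bsub>R\<^esub> {#x#} \<oplus>\<^bsub>sym_poly R N\<^esub> mr_single R \<one>\<^bsub>R\<^esub> {#y#})"
      using xy by (simp add: E.M_eval_add c ev_var1 N_add v_add)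
  next
    fix r x assume rx: "r \<in> carrier R" "x \<in> carrier N"
    then show "mr_single R \<one>\<^bsub>R\<^esub> {#r \<odot>\<^bsub>N\<^esub> x#} \<in> carrier (sym_poly R N)"
      "mr_single R r {#x#} \<in> carrier (sym_poly R N)"
      by (auto intro!: var_closed N_smult)
    show "E.M_eval (mr_single R \<one>\<^bsub>R\<^esub> {#r \<odot>\<^bsub>N\<^esub> x#}) = E.M_eval (mr_single R r {#x#})"
      using rx ring_hom_closed[OF h rx(1)] v[OF rx(2)] by (simp add: ev_var ev_var1 N_smult v_smult)
  qed
  then have "K \<subseteq> a_kernel (sym_poly R N) T E.M_eval"
    unfolding sym_ideal_def by (rule F.M.genideal_minimal[OF eh.kernel_is_ideal])
  then have ker: "E.M_eval p = \<zero>\<^bsub>T\<^esub>" if "p \<in> K" for p using that unfolding a_kernel_def' by blast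
  note q = quotient_ring_hom[OF F.M.ring_axioms T.ring_axioms E.M_eval_hom K_ideal]
  show "sym_lift R T h v \<in> ring_hom (sym_alg R N) T"
    unfolding sym_lift_def[abs_def] eval sym_alg_def by (rule q(1)) (rule ker)
  have lift: "sym_lift R T h v (coset p) = E.M_eval p" if "p \<in> carrier (sym_poly R N)" for p
    unfolding sym_lift_def eval by (rule q(2)[OF ker that])
  show "sym_lift R T h v (sym_scalar R N r) = h r" if "r \<in> carrier R" for r
    unfolding sym_scalar_def lift[OF scalar_closed[OF that]]
    using E.M_eval_single[OF that, of "{#}"] ring_hom_closed[OF h that] by (simp add: free_comm_monoid_simps)
  show "sym_lift R T h v (sym_gen R N x) = v x" if "x \<in> carrier N" for x
    unfolding sym_gen_def lift[OF var_closed[OF R.one_closed that]] by (rule ev_var1[OF that])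
qed

end

section \<open>Tensor products of commutative algebras and their universal property\<close>

locale tensor_product = A: cring A + B: cring B + C: cring C
  for A :: "('a, 'm) ring_scheme" and B :: "('b, 'n) ring_scheme" and C :: "('c, 'k) ring_scheme" +
  fixes f g
  assumes f: "f \<in> ring_hom A B" and g: "g \<in> ring_hom A C"
begin

lemma BC: "comm_monoid (B \<times>\<times> C)"
  by (rule comm_monoidI) (auto simp: B.m_ac C.m_ac)

sublocale F: comm_monoid_ring A "B \<times>\<times> C" "tensor_free A B C"
  by (intro comm_monoid_ring.intro A.cring_axioms BC) (simp add: tensor_free_def)

abbreviation "K \<equiv> tensor_ideal A B C f g"
abbreviation "T \<equiv> tensor_alg A B C f g"
abbreviation "coset p \<equiv> K +>\<^bsub>tensor_free A B C\<^esub> p"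
abbreviation "single a b c \<equiv> mr_single A a (b, c)"

definition "tens b c = coset (single \<one>\<^bsub>A\<^esub> b c)"

abbreviation "relations \<equiv>
    {single \<one>\<^bsub>A\<^esub> (b \<oplus>\<^bsub>B\<^esub> b') c \<ominus>\<^bsub>tensor_free A B C\<^esub>
        (single \<one>\<^bsub>A\<^esub> b c \<oplus>\<^bsub>tensor_free A B C\<^esub> single \<one>\<^bsub>A\<^esub> b' c)
        | b b' c. b \<in> carrier B \<and> b' \<in> carrier B \<and> c \<in> carrier C} \<union>
     {single \<one>\<^bsub>A\<^esub> b (c \<oplus>\<^bsub>C\<^esub> c') \<ominus>\<^bsub>tensor_free A B C\<^esub>
        (single \<one>\<^bsub>A\<^esub> b c \<oplus>\<^bsub>tensor_free A B C\<^esub> single \<one>\<^bsub>A\<^esub> b c')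
        | b c c'. b \<in> carrier B \<and> c \<in> carrier C \<and> c' \<in> carrier C} \<union>
     {single \<one>\<^bsub>A\<^esub> (f a \<otimes>\<^bsub>B\<^esub> b) c \<ominus>\<^bsub>tensor_free A B C\<^esub> single a b c
        | a b c. a \<in> carrier A \<and> b \<in> carrier B \<and> c \<in> carrier C} \<union>
     {single \<one>\<^bsub>A\<^esub> b (g a \<otimes>\<^bsub>C\<^esub> c) \<ominus>\<^bsub>tensor_free A B C\<^esub> single a b c
        | a b c. a \<in> carrier A \<and> b \<in> carrier B \<and> c \<in> carrier C}"

lemma single_closed: "a \<in> carrier A \<Longrightarrow> b \<in> carrier B \<Longrightarrow> c \<in> carrier C \<Longrightarrow> single a b c \<in> carrier (tensor_free A B C)"
  by (rule F.single_closed) auto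

lemma f_closed: "a \<in> carrier A \<Longrightarrow> f a \<in> carrier B" and g_closed: "a \<in> carrier A \<Longrightarrow> g a \<in> carrier C"
  using ring_hom_closed f g by metis+

lemma relations_closed: "relations \<subseteq> carrier (tensor_free A B C)"
  using f_closed g_closed by (auto intro!: F.M.minus_closed F.M.a_closed single_closed)

lemma K_ideal: "ideal K (tensor_free A B C)"
  unfolding tensor_ideal_def by (rule F.M.genideal_ideal[OF relations_closed])

sublocale K: ideal K "tensor_free A B C" by (rule K_ideal)

lemma relations_K: "relations \<subseteq> K"
  unfolding tensor_ideal_def by (rule F.M.genideal_self[OF relations_closed])

lemma T_cring: "cring T"
  unfolding tensor_alg_def by (rule K.quotient_is_cring[OF F.M.cring_axioms])

sublocale T: cring T by (rule T_cring)

lemma coset_hom: "coset \<in> ring_hom (tensor_free A B C) T"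
  unfolding tensor_alg_def by (rule K.rcos_ring_hom)

lemma coset_eqI:
  "p \<in> carrier (tensor_free A B C) \<Longrightarrow> q \<in> carrier (tensor_free A B C) \<Longrightarrow>
    p \<ominus>\<^bsub>tensor_free A B C\<^esub> q \<in> K \<Longrightarrow> coset p = coset q"
  using F.M.quotient_eq_iff_same_a_r_cos[OF K_ideal] by blast

lemma tens_closed: "b \<in> carrier B \<Longrightarrow> c \<in> carrier C \<Longrightarrow> tens b c \<in> carrier T"
  unfolding tens_def by (intro ring_hom_closed[OF coset_hom] single_closed) auto

lemma tens_add_l:
  assumes "b \<in> carrier B" "b' \<in> carrier B" "c \<in> carrier C"
  shows "tens (b \<oplus>\<^bsub>B\<^esub> b') c = tens b c \<oplus>\<^bsub>T\<^esub> tens b' c"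
  unfolding tens_def
  apply (subst ring_hom_add[OF coset_hom, symmetric])
    apply (use assms in \<open>auto intro: single_closed\<close>)[2]
proof (rule coset_eqI)
  show "single \<one>\<^bsub>A\<^esub> (b \<oplus>\<^bsub>B\<^esub> b') c \<ominus>\<^bsub>tensor_free A B C\<^esub>
    (single \<one>\<^bsub>A\<^esub> b c \<oplus>\<^bsub>tensor_free A B C\<^esub> single \<one>\<^bsub>A\<^esub> b' c) \<in> K"
    by (rule subsetD[OF relations_K]) (use assms in blast)
qed (use assms in \<open>auto intro!: single_closed F.M.a_closed\<close>)

lemma tens_add_r:
  assumes "b \<in> carrier B" "c \<in> carrier C" "c' \<in> carrier C"
  shows "tens b (c \<oplus>\<^bsub>C\<^esub> c') = tens b c \<oplus>\<^bsub>T\<^esub> tens b c'"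
  unfolding tens_def
  apply (subst ring_hom_add[OF coset_hom, symmetric])
    apply (use assms in \<open>auto intro: single_closed\<close>)[2]
proof (rule coset_eqI)
  show "single \<one>\<^bsub>A\<^esub> b (c \<oplus>\<^bsub>C\<^esub> c') \<ominus>\<^bsub>tensor_free A B C\<^esub>
    (single \<one>\<^bsub>A\<^esub> b c \<oplus>\<^bsub>tensor_free A B C\<^esub> single \<one>\<^bsub>A\<^esub> b c') \<in> K"
    by (rule subsetD[OF relations_K]) (use assms in blast)
qed (use assms in \<open>auto intro!: single_closed F.M.a_closed\<close>)

lemma tens_scalar_l:
  assumes "a \<in> carrier A" "b \<in> carrier B" "c \<in> carrier C"
  shows "tens (f a \<otimes>\<^bsub>B\<^esub> b) c = coset (single a b c)"
  unfolding tens_def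
proof (rule coset_eqI)
  show "single \<one>\<^bsub>A\<^esub> (f a \<otimes>\<^bsub>B\<^esub> b) c \<ominus>\<^bsub>tensor_free A B C\<^esub> single a b c \<in> K"
    by (rule subsetD[OF relations_K]) (use assms in blast)
qed (use assms f_closed in \<open>auto intro!: single_closed\<close>)

lemma tens_scalar_r:
  assumes "a \<in> carrier A" "b \<in> carrier B" "c \<in> carrier C"
  shows "tens b (g a \<otimes>\<^bsub>C\<^esub> c) = coset (single a b c)"
  unfolding tens_def
proof (rule coset_eqI)
  show "single \<one>\<^bsub>A\<^esub> b (g a \<otimes>\<^bsub>C\<^esub> c) \<ominus>\<^bsub>tensor_free A B C\<^esub> single a b c \<in> K"
    by (rule subsetD[OF relations_K]) (use assms in blast)
qed (use assms g_closed in \<open>auto intro!: single_closed\<close>)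

lemma tens_mult:
  assumes "b \<in> carrier B" "c \<in> carrier C" "b' \<in> carrier B" "c' \<in> carrier C"
  shows "tens b c \<otimes>\<^bsub>T\<^esub> tens b' c' = tens (b \<otimes>\<^bsub>B\<^esub> b') (c \<otimes>\<^bsub>C\<^esub> c')"
  unfolding tens_def
  apply (subst ring_hom_mult[OF coset_hom, symmetric])
    apply (use assms in \<open>auto intro: single_closed\<close>)[2]
  using assms by (simp add: F.M_mult_single)

lemma tens_one: "tens \<one>\<^bsub>B\<^esub> \<one>\<^bsub>C\<^esub> = \<one>\<^bsub>T\<^esub>"
  using ring_hom_one[OF coset_hom] unfolding tens_def F.M_simps(2) by simp

lemma incl_l_hom: "(\<lambda>b. tens b \<one>\<^bsub>C\<^esub>) \<in> ring_hom B T"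
  by (rule ring_hom_memI) (auto simp: tens_closed tens_mult tens_add_l tens_one)

lemma incl_r_hom: "(\<lambda>c. tens \<one>\<^bsub>B\<^esub> c) \<in> ring_hom C T"
  by (rule ring_hom_memI) (auto simp: tens_closed tens_mult tens_add_r tens_one)

lemma incl_eq: "a \<in> carrier A \<Longrightarrow> tens (f a) \<one>\<^bsub>C\<^esub> = tens \<one>\<^bsub>B\<^esub> (g a)"
  using tens_scalar_l[of a "\<one>\<^bsub>B\<^esub>" "\<one>\<^bsub>C\<^esub>"] tens_scalar_r[of a "\<one>\<^bsub>B\<^esub>" "\<one>\<^bsub>C\<^esub>"] f_closed g_closed by simp

text \<open>A coefficient \<open>a\<close> of a basis element is absorbed into the left factor as
  \<open>f a\<close>, so pure tensors without coefficients suffice.\<close>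

lemma T_generated:
  assumes S: "subring S T" "\<And>b c. b \<in> carrier B \<Longrightarrow> c \<in> carrier C \<Longrightarrow> tens b c \<in> S"
  shows "carrier T \<subseteq> S"
proof
  fix x assume "x \<in> carrier T"
  then obtain p where p: "p \<in> carrier (tensor_free A B C)" "x = coset p"
    unfolding tensor_alg_def FactRing_def A_RCOSETS_def' by auto
  have "coset p \<in> S"
    using p(1)
  proof (induction rule: F.M_induct)
    case zero
    have "coset \<zero>\<^bsub>tensor_free A B C\<^esub> = \<zero>\<^bsub>T\<^esub>"
      using ring_hom_zero[OF coset_hom F.M.ring_axioms T.ring_axioms] .
    then show ?case using subringE(2)[OF S(1)] by simp
  next
    case (add p a bc)
    obtain b c where bc: "bc = (b, c)" "b \<in> carrier B" "c \<in> carrier C" using add.hyps(3) by (cases bc) auto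
    have s: "single a b c \<in> carrier (tensor_free A B C)" using single_closed add.hyps(2) bc by blast
    have "coset (single a b c) \<in> S"
      unfolding tens_scalar_l[OF add.hyps(2) bc(2,3), symmetric]
      using add.hyps(2) bc f_closed by (intro S(2)) auto
    then show ?case
      unfolding bc(1) ring_hom_add[OF coset_hom add.hyps(1) s] by (rule subringE(7)[OF S(1) add.IH])
  qed
  then show "x \<in> S" using p by simp
qed

text \<open>Base change preserves surjections: if \<open>c = g a\<close>, then \<open>b\<close>
  tensor \<open>c\<close> equals \<open>(f a) b\<close> tensor \<open>1\<close>.\<close>

lemma incl_l_surj:
  assumes "carrier C \<subseteq> g ` carrier A"
  shows "carrier T \<subseteq> (\<lambda>b. tens b \<one>\<^bsub>C\<^esub>) ` carrier B"
proof (rule T_generated)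
  interpret i: ring_hom_ring B T "\<lambda>b. tens b \<one>\<^bsub>C\<^esub>"
    by (rule ring_hom_ringI2[OF B.ring_axioms T.ring_axioms incl_l_hom])
  show "subring ((\<lambda>b. tens b \<one>\<^bsub>C\<^esub>) ` carrier B) T"
    by (rule T.ring_incl_imp_subring[OF _ i.img_is_ring]) auto
  fix b c assume bc: "b \<in> carrier B" "c \<in> carrier C"
  then obtain a where a: "a \<in> carrier A" "c = g a" using assms by blast
  have "tens b c = tens (f a \<otimes>\<^bsub>B\<^esub> b) \<one>\<^bsub>C\<^esub>"
    using tens_scalar_l[OF a(1) bc(1), of "\<one>\<^bsub>C\<^esub>"] tens_scalar_r[OF a(1) bc(1), of "\<one>\<^bsub>C\<^esub>"] a g_closed by simp
  then show "tens b c \<in> (\<lambda>b. tens b \<one>\<^bsub>C\<^esub>) ` carrier B"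
    by (rule image_eqI) (use a bc f_closed in simp)
qed

lemma incl_r_surj:
  assumes "carrier B \<subseteq> f ` carrier A"
  shows "carrier T \<subseteq> (\<lambda>c. tens \<one>\<^bsub>B\<^esub> c) ` carrier C"
proof (rule T_generated)
  interpret i: ring_hom_ring C T "\<lambda>c. tens \<one>\<^bsub>B\<^esub> c"
    by (rule ring_hom_ringI2[OF C.ring_axioms T.ring_axioms incl_r_hom])
  show "subring ((\<lambda>c. tens \<one>\<^bsub>B\<^esub> c) ` carrier C) T"
    by (rule T.ring_incl_imp_subring[OF _ i.img_is_ring]) auto
  fix b c assume bc: "b \<in> carrier B" "c \<in> carrier C"
  then obtain a where a: "a \<in> carrier A" "b = f a" using assms by blast
  have "tens b c = tens \<one>\<^bsub>B\<^esub> (g a \<otimes>\<^bsub>C\<^esub> c)"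
    using tens_scalar_l[OF a(1) B.one_closed bc(2)] tens_scalar_r[OF a(1) B.one_closed bc(2)] a f_closed by simp
  then show "tens b c \<in> (\<lambda>c. tens \<one>\<^bsub>B\<^esub> c) ` carrier C"
    by (rule image_eqI) (use a bc g_closed in simp)
qed

text \<open>The evaluation of the free module along \<open>\<beta> b \<otimes> \<gamma> c\<close>
  kills the four families of relations; agreement of \<open>\<beta>\<close> and
  \<open>\<gamma>\<close> on \<open>A\<close> is used for the last one. Later arguments need only
  the values on pure tensors, hence the existential form.\<close>

lemma T_lift:
  fixes U :: "('u, 'v) ring_scheme"
  assumes U: "cring U" and \<beta>: "\<beta> \<in> ring_hom B U" and \<gamma>: "\<gamma> \<in> ring_hom C U"
    and eq: "\<And>a. a \<in> carrier A \<Longrightarrow> \<beta> (f a) = \<gamma> (g a)"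
  shows "\<exists>\<phi>\<in>ring_hom T U. (\<forall>b\<in>carrier B. \<forall>c\<in>carrier C. \<phi> (tens b c) = \<beta> b \<otimes>\<^bsub>U\<^esub> \<gamma> c)"
proof -
  interpret U: cring U by (rule U)
  note cl = ring_hom_closed[OF \<beta>] ring_hom_closed[OF \<gamma>] f_closed g_closed
  have \<mu>: "(\<lambda>(b, c). \<beta> b \<otimes>\<^bsub>U\<^esub> \<gamma> c) \<in> hom (B \<times>\<times> C) U"
    by (rule homI) (auto simp: cl ring_hom_mult[OF \<beta>] ring_hom_mult[OF \<gamma>] U.m_ac)
  have h: "(\<lambda>a. \<beta> (f a)) \<in> ring_hom A U" using ring_hom_trans[OF f \<beta>] by (simp add: o_def)
  interpret E: comm_monoid_ring_hom A "B \<times>\<times> C" "tensor_free A B C" U "\<lambda>a. \<beta> (f a)" "\<lambda>(b, c). \<beta> b \<otimes>\<^bsub>U\<^esub> \<gamma> c"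
    by (intro comm_monoid_ring_hom.intro F.comm_monoid_ring_axioms U comm_monoid_ring_hom_axioms.intro h \<mu>)
      (simp_all add: ring_hom_one[OF \<beta>] ring_hom_one[OF \<gamma>] tensor_free_def)
  interpret eh: ring_hom_ring "tensor_free A B C" U E.M_eval
    by (rule ring_hom_ringI2[OF F.M.ring_axioms U.ring_axioms E.M_eval_hom])
  have ev: "E.M_eval (single a b c) = \<beta> (f a) \<otimes>\<^bsub>U\<^esub> (\<beta> b \<otimes>\<^bsub>U\<^esub> \<gamma> c)"
    if "a \<in> carrier A" "b \<in> carrier B" "c \<in> carrier C" for a b c
    using E.M_eval_single[OF that(1), of "(b, c)"] that by simp
  have ev1: "E.M_eval (single \<one>\<^bsub>A\<^esub> b c) = \<beta> b \<otimes>\<^bsub>U\<^esub> \<gamma> c" if "b \<in> carrier B" "c \<in> carrier C" for b c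
    using ev[OF A.one_closed that] ring_hom_one[OF h] cl that by simp
  let ?k = "a_kernel (tensor_free A B C) U E.M_eval"
  have 1: "single \<one>\<^bsub>A\<^esub> (b \<oplus>\<^bsub>B\<^esub> b') c \<ominus>\<^bsub>tensor_free A B C\<^esub>
      (single \<one>\<^bsub>A\<^esub> b c \<oplus>\<^bsub>tensor_free A B C\<^esub> single \<one>\<^bsub>A\<^esub> b' c) \<in> ?k"
    if "b \<in> carrier B" "b' \<in> carrier B" "c \<in> carrier C" for b b' c
  proof (rule eh.kernel_minus_mem)
    show "E.M_eval (single \<one>\<^bsub>A\<^esub> (b \<oplus>\<^bsub>B\<^esub> b') c) =
      E.M_eval (single \<one>\<^bsub>A\<^esub> b c \<oplus>\<^bsub>tensor_free A B C\<^esub> single \<one>\<^bsub>A\<^esub> b' c)"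
      using that by (simp add: E.M_eval_add single_closed ev1 cl ring_hom_add[OF \<beta>] U.l_distr)
  qed (use that in \<open>auto intro!: single_closed F.M.a_closed\<close>)
  have 2: "single \<one>\<^bsub>A\<^esub> b (c \<oplus>\<^bsub>C\<^esub> c') \<ominus>\<^bsub>tensor_free A B C\<^esub>
      (single \<one>\<^bsub>A\<^esub> b c \<oplus>\<^bsub>tensor_free A B C\<^esub> single \<one>\<^bsub>A\<^esub> b c') \<in> ?k"
    if "b \<in> carrier B" "c \<in> carrier C" "c' \<in> carrier C" for b c c'
  proof (rule eh.kernel_minus_mem)
    show "E.M_eval (single \<one>\<^bsub>A\<^esub> b (c \<oplus>\<^bsub>C\<^esub> c')) =
      E.M_eval (single \<one>\<^bsub>A\<^esub> b c \<oplus>\<^bsub>tensor_free A B C\<^esub> single \<one>\<^bsub>A\<^esub> b c')"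
      using that by (simp add: E.M_eval_add single_closed ev1 cl ring_hom_add[OF \<gamma>] U.r_distr)
  qed (use that in \<open>auto intro!: single_closed F.M.a_closed\<close>)
  have 3: "single \<one>\<^bsub>A\<^esub> (f a \<otimes>\<^bsub>B\<^esub> b) c \<ominus>\<^bsub>tensor_free A B C\<^esub> single a b c \<in> ?k"
    if "a \<in> carrier A" "b \<in> carrier B" "c \<in> carrier C" for a b c
  proof (rule eh.kernel_minus_mem)
    show "E.M_eval (single \<one>\<^bsub>A\<^esub> (f a \<otimes>\<^bsub>B\<^esub> b) c) = E.M_eval (single a b c)"
      using that by (simp add: ev ev1 cl ring_hom_mult[OF \<beta>] U.m_assoc)
  qed (use that f_closed in \<open>auto intro!: single_closed\<close>)
  have 4: "single \<one>\<^bsub>A\<^esub> b (g a \<otimes>\<^bsub>C\<^esub> c) \<ominus>\<^bsub>tensor_free A B C\<^esub> single a b c \<in> ?k"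
    if "a \<in> carrier A" "b \<in> carrier B" "c \<in> carrier C" for a b c
  proof (rule eh.kernel_minus_mem)
    show "E.M_eval (single \<one>\<^bsub>A\<^esub> b (g a \<otimes>\<^bsub>C\<^esub> c)) = E.M_eval (single a b c)"
      using that by (simp add: ev ev1 cl ring_hom_mult[OF \<gamma>] eq U.m_lcomm)
  qed (use that g_closed in \<open>auto intro!: single_closed\<close>)
  have "relations \<subseteq> ?k"
    by (intro Un_least subsetI; elim CollectE exE conjE; hypsubst; (rule 1 | rule 2 | rule 3 | rule 4); assumption)
  then have "K \<subseteq> a_kernel (tensor_free A B C) U E.M_eval"
    unfolding tensor_ideal_def by (rule F.M.genideal_minimal[OF eh.kernel_is_ideal])
  then have ker: "E.M_eval p = \<zero>\<^bsub>U\<^esub>" if "p \<in> K" for p using that unfolding a_kernel_def' by blast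
  note q = quotient_ring_hom[OF F.M.ring_axioms U.ring_axioms E.M_eval_hom K_ideal]
  show ?thesis
  proof (intro bexI ballI)
    show "(\<lambda>c. the_elem (E.M_eval ` c)) \<in> ring_hom T U" unfolding tensor_alg_def by (rule q(1)) (rule ker)
    fix b c assume bc: "b \<in> carrier B" "c \<in> carrier C"
    show "the_elem (E.M_eval ` tens b c) = \<beta> b \<otimes>\<^bsub>U\<^esub> \<gamma> c"
      unfolding tens_def by (rule trans[OF q(2)[OF ker single_closed[OF A.one_closed bc]] ev1[OF bc]])
  qed
qed

end

section \<open>The Aluffi algebra\<close>

text \<open>The comparison is made chain by chain and then passed to suprema, which covers infinite
  dimensions as well. The slack \<open>k\<close> is 0 for quotients and for a regular element in
  \<open>J\<close>, and 1 for the general bound.\<close>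

lemma krull_dim_le:
  assumes "\<And>n Q. prime_chain S n Q \<Longrightarrow> \<exists>m C. prime_chain R m C \<and> n \<le> m + k"
  shows "krull_dim S \<le> krull_dim R + enat k"
  unfolding krull_dim_def[of S]
proof (rule SUP_least)
  fix n assume "n \<in> {n. \<exists>P. prime_chain S n P}"
  then obtain m C where C: "prime_chain R m C" "n \<le> m + k" using assms by blast
  then have "enat m \<le> krull_dim R" unfolding krull_dim_def by (intro SUP_upper) auto
  then have "enat m + enat k \<le> krull_dim R + enat k" by (rule add_right_mono)
  then show "enat n \<le> krull_dim R + enat k" using C(2) by (simp add: order_trans[of "enat n" "enat (m + k)"])
qed

text \<open>The existence of some chain excludes a supremum over the empty set: that supremum is 0,
  and the conclusion would then demand a chain of length one from nothing.\<close>

lemma krull_dim_Suc_le: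
  assumes "\<And>n P. prime_chain R n P \<Longrightarrow> \<exists>Q. prime_chain S (Suc n) Q" "\<exists>n P. prime_chain R n P"
  shows "krull_dim R + 1 \<le> krull_dim S"
proof (cases "krull_dim S")
  case (enat d)
  have le: "Suc n \<le> d" if "prime_chain R n P" for n P
  proof -
    have "enat (Suc n) \<le> krull_dim S"
      unfolding krull_dim_def using assms(1)[OF that] by (intro SUP_upper) auto
    then show ?thesis using enat by simp
  qed
  then have "1 \<le> d" using assms(2) by fastforce
  have "krull_dim R \<le> enat (d - 1)"
    unfolding krull_dim_def using le by (intro SUP_least) fastforce
  then have "krull_dim R + 1 \<le> enat (d - 1) + 1" by (rule add_right_mono)
  also have "\<dots> = enat d" using \<open>1 \<le> d\<close> by (simp add: one_enat_def)
  finally show ?thesis using enat by simp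
qed simp

text \<open>The products \<open>b^k s\<close> with \<open>s\<close> outside \<open>P\<close> form a
  multiplicative set without zero, since \<open>b\<close> is regular. A prime disjoint from it lies
  inside \<open>P\<close>, by \<open>k = 0\<close>, and misses \<open>b\<close>, by
  \<open>s = 1\<close>.\<close>

lemma (in cring) prime_below_avoiding_regular:
  assumes "noetherian_ring R" "primeideal P R" "regular_element R b"
  shows "\<exists>p. primeideal p R \<and> p \<subseteq> P \<and> b \<notin> p"
proof -
  interpret P: primeideal P R by fact
  have b: "b \<in> carrier R" "\<And>x. x \<in> carrier R \<Longrightarrow> b \<otimes> x = \<zero> \<Longrightarrow> x = \<zero>"
    using assms(3) unfolding regular_element_def by auto
  define S where "S = {b [^] (k::nat) \<otimes> s | k s. s \<in> carrier R - P}"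
  have SI: "b [^] (k::nat) \<otimes> s \<in> S" if "s \<in> carrier R" "s \<notin> P" for k s
    unfolding S_def using that by blast
  have one: "\<one> \<notin> P" using P.one_imp_carrier P.I_notcarr by blast
  have S: "submonoid S R"
  proof (rule submonoid.intro)
    show "S \<subseteq> carrier R" unfolding S_def using b by auto
    show "\<one> \<in> S" using SI[OF one_closed one, of 0] by simp
    fix x y assume "x \<in> S" "y \<in> S"
    then obtain k s l t where *: "x = b [^] (k::nat) \<otimes> s" "y = b [^] (l::nat) \<otimes> t"
      "s \<in> carrier R" "s \<notin> P" "t \<in> carrier R" "t \<notin> P" unfolding S_def by blast
    have "s \<otimes> t \<notin> P" using P.I_prime[OF *(3,5)] * by blast
    moreover have "x \<otimes> y = b [^] (k + l) \<otimes> (s \<otimes> t)"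
      unfolding *(1,2) nat_pow_mult[OF b(1), symmetric] using * b(1) by (simp add: m_ac)
    ultimately show "x \<otimes> y \<in> S" using SI[of "s \<otimes> t" "k + l"] * by simp
  qed
  have "x = \<zero>" if "x \<in> carrier R" "b [^] (k::nat) \<otimes> x = \<zero>" for x k
    using that
  proof (induction k arbitrary: x)
    case (Suc k)
    have "b [^] k \<otimes> (b \<otimes> x) = \<zero>" using Suc.prems b(1) by (simp add: m_assoc)
    then have "b \<otimes> x = \<zero>" using Suc.IH[of "b \<otimes> x"] Suc.prems b(1) by simp
    then show ?case using b(2) Suc.prems by blast
  qed simp
  then have "\<zero> \<notin> S" unfolding S_def using P.zero_closed by force
  then obtain p where p: "primeideal p R" "p \<inter> S = {}"
    using prime_ideal_avoiding[OF assms(1) zeroideal S] by blast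
  interpret p: primeideal p R by (rule p(1))
  have "p \<subseteq> P"
  proof
    fix s assume s: "s \<in> p"
    then have "s \<in> carrier R" using p.Icarr by blast
    then show "s \<in> P" using s SI[of s 0] p(2) by (cases "s \<in> P") auto
  qed
  moreover have "b \<notin> p" using SI[OF one_closed one, of 1] p(2) b(1) by auto
  ultimately show ?thesis using p(1) by blast
qed

lemma (in ring) ring_hom_equalizer:
  assumes "ring S" "h \<in> ring_hom R S" "k \<in> ring_hom R S"
  shows "subring {x \<in> carrier R. h x = k x} R"
proof -
  interpret h: ring_hom_ring R S h by (rule ring_hom_ringI2[OF ring_axioms assms(1,2)])
  interpret k: ring_hom_ring R S k by (rule ring_hom_ringI2[OF ring_axioms assms(1,3)])
  show ?thesis
    by (rule subringI) auto
qed

section \<open>The natural maps into and out of the Aluffi algebra\<close>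

locale aluffi = cring R for R :: "('a, 'm) ring_scheme" (structure) +
  fixes I J :: "'a set"
  assumes I: "ideal I R" and J: "ideal J R"
begin

interpretation I: ideal I R by (rule I)
interpretation J: ideal J R by (rule J)

abbreviation "Rq \<equiv> R Quot J"
abbreviation "Iq \<equiv> quot_ideal R I J"
abbreviation "q x \<equiv> J +> x"
abbreviation "N \<equiv> ideal_module R I"
abbreviation "Nq \<equiv> ideal_module Rq Iq"
abbreviation "SQ \<equiv> sym_quot_alg R I J"
abbreviation "SI \<equiv> sym_ideal_alg R I"
abbreviation "RA \<equiv> rees_algebra R I"

lemma q_hom: "q \<in> ring_hom R Rq"
  by (rule J.rcos_ring_hom)

lemma q_surj: "carrier Rq \<subseteq> q ` carrier R"
  unfolding FactRing_def A_RCOSETS_def' by auto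

lemma Rq_cring: "cring Rq"
  by (rule J.quotient_is_cring[OF cring_axioms])

sublocale Rq: cring Rq by (rule Rq_cring)

lemma ideal_module_simps:
  "carrier (ideal_module S E) = E" "x \<oplus>\<^bsub>ideal_module S E\<^esub> y = x \<oplus>\<^bsub>S\<^esub> y" "x \<odot>\<^bsub>ideal_module S E\<^esub> y = x \<otimes>\<^bsub>S\<^esub> y"
  for S :: "('b, 'n) ring_scheme"
  unfolding ideal_module_def by simp_all

sublocale N: symmetric_algebra R N
  by unfold_locales (simp_all add: ideal_module_simps I.a_closed I.I_l_closed)

lemma Iq_iff: "y \<in> Iq \<longleftrightarrow> (\<exists>x\<in>I. y = q x)"
  unfolding quot_ideal_def by blast

lemma Iq_carrier: "Iq \<subseteq> carrier Rq"
  unfolding quot_ideal_def using ring_hom_closed[OF q_hom] I.Icarr by blast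

sublocale Nq: symmetric_algebra Rq Nq
proof
  fix x y assume "x \<in> carrier Nq" "y \<in> carrier Nq"
  then obtain a b where "a \<in> I" "b \<in> I" "x = q a" "y = q b"
    unfolding ideal_module_simps Iq_iff by blast
  then show "x \<oplus>\<^bsub>Nq\<^esub> y \<in> carrier Nq"
    unfolding ideal_module_simps Iq_iff
    using ring_hom_add[OF q_hom I.Icarr I.Icarr, of a b] I.a_closed by metis
next
  fix r x assume r: "r \<in> carrier Rq" and "x \<in> carrier Nq"
  then obtain a where a: "a \<in> I" "x = q a" unfolding ideal_module_simps Iq_iff by blast
  obtain s where s: "s \<in> carrier R" "r = q s" using r q_surj by blast
  show "r \<odot>\<^bsub>Nq\<^esub> x \<in> carrier Nq"
    unfolding ideal_module_simps Iq_iff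
    using ring_hom_mult[OF q_hom s(1) I.Icarr[OF a(1)]] a s I.I_l_closed by metis
qed

lemma SQ_eq: "SQ = sym_alg Rq Nq"
  unfolding sym_quot_alg_def sym_ideal_alg_def by simp

lemma SI_eq: "SI = sym_alg R N"
  unfolding sym_ideal_alg_def by simp

sublocale SI: cring SI unfolding SI_eq by (rule N.sym_alg_cring)
sublocale SQ: cring SQ unfolding SQ_eq by (rule Nq.sym_alg_cring)

sublocale W: rees_ideal R "UP R" I
  by (intro rees_ideal.intro UP_cring.intro cring_axioms rees_ideal_axioms.intro I)

lemma RA_cring: "cring RA"
  by (subst W.rees_algebra_eq) (rule W.P.subring_cring[OF W.Rees_subring])

sublocale RA: cring RA by (rule RA_cring)

lemma RA_incl: "(\<lambda>x. x) \<in> ring_hom RA (UP R)"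
  using subringE(1)[OF W.Rees_subring] by (auto simp: ring_hom_def rees_algebra_def)

lemma RA_simps: "x \<otimes>\<^bsub>RA\<^esub> y = x \<otimes>\<^bsub>UP R\<^esub> y" "x \<oplus>\<^bsub>RA\<^esub> y = x \<oplus>\<^bsub>UP R\<^esub> y" "\<one>\<^bsub>RA\<^esub> = \<one>\<^bsub>UP R\<^esub>"
  unfolding rees_algebra_def by simp_all

lemma sym_to_sym_quot:
  shows sym_to_sym_quot_hom: "sym_to_sym_quot R I J \<in> ring_hom SI SQ"
    and sym_to_sym_quot_scalar: "\<And>r. r \<in> carrier R \<Longrightarrow> sym_to_sym_quot R I J (sym_scalar R N r) = sym_scalar Rq Nq (q r)"
    and sym_to_sym_quot_gen: "\<And>x. x \<in> I \<Longrightarrow> sym_to_sym_quot R I J (sym_gen R N x) = sym_gen Rq Nq (q x)"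
proof -
  have h: "(\<lambda>r. sym_scalar Rq Nq (q r)) \<in> ring_hom R SQ"
    using ring_hom_trans[OF q_hom Nq.sym_scalar_hom] unfolding SQ_eq o_def .
  have qI: "q x \<in> carrier Nq" if "x \<in> I" for x unfolding ideal_module_simps Iq_iff using that by blast
  have v: "sym_gen Rq Nq (q x) \<in> carrier SQ" if "x \<in> carrier N" for x
    unfolding SQ_eq using Nq.sym_gen_closed[OF qI] that by (simp only: ideal_module_simps)
  have add: "sym_gen Rq Nq (q (x \<oplus>\<^bsub>N\<^esub> y)) = sym_gen Rq Nq (q x) \<oplus>\<^bsub>SQ\<^esub> sym_gen Rq Nq (q y)"
    if "x \<in> carrier N" "y \<in> carrier N" for x y
  proof -
    have xy: "x \<in> I" "y \<in> I" using that by (simp_all only: ideal_module_simps)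
    have "q (x \<oplus>\<^bsub>N\<^esub> y) = q x \<oplus>\<^bsub>Nq\<^esub> q y"
      unfolding ideal_module_simps by (rule ring_hom_add[OF q_hom I.Icarr[OF xy(1)] I.Icarr[OF xy(2)]])
    then show ?thesis using Nq.sym_gen_add[OF qI[OF xy(1)] qI[OF xy(2)]] unfolding SQ_eq by (simp only:)
  qed
  have smult: "sym_gen Rq Nq (q (r \<odot>\<^bsub>N\<^esub> x)) = sym_scalar Rq Nq (q r) \<otimes>\<^bsub>SQ\<^esub> sym_gen Rq Nq (q x)"
    if "r \<in> carrier R" "x \<in> carrier N" for r x
  proof -
    have x: "x \<in> I" using that by (simp only: ideal_module_simps)
    have "q (r \<odot>\<^bsub>N\<^esub> x) = q r \<odot>\<^bsub>Nq\<^esub> q x"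
      unfolding ideal_module_simps by (rule ring_hom_mult[OF q_hom that(1) I.Icarr[OF x]])
    then show ?thesis using Nq.sym_gen_smult[OF ring_hom_closed[OF q_hom that(1)] qI[OF x]] unfolding SQ_eq by (simp only:)
  qed
  note L = N.sym_lift[OF SQ.cring_axioms h v add smult]
  show "sym_to_sym_quot R I J \<in> ring_hom SI SQ"
    unfolding sym_to_sym_quot_def SI_eq by (rule L(1))
  show "sym_to_sym_quot R I J (sym_scalar R N r) = sym_scalar Rq Nq (q r)" if "r \<in> carrier R" for r
    unfolding sym_to_sym_quot_def by (rule L(2)) (assumption | rule that)+
  show "sym_to_sym_quot R I J (sym_gen R N x) = sym_gen Rq Nq (q x)" if "x \<in> I" for x
    unfolding sym_to_sym_quot_def by (rule L(3)) (simp_all only: ideal_module_simps that)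
qed

lemma sym_to_rees:
  shows sym_to_rees_hom: "sym_to_rees R I \<in> ring_hom SI RA"
    and sym_to_rees_scalar: "\<And>r. r \<in> carrier R \<Longrightarrow> sym_to_rees R I (sym_scalar R N r) = W.pmonom r 0"
    and sym_to_rees_gen: "\<And>x. x \<in> I \<Longrightarrow> sym_to_rees R I (sym_gen R N x) = W.pmonom x 1"
proof -
  have h: "(\<lambda>r. W.pmonom r 0) \<in> ring_hom R RA"
    using W.const_ring_hom W.const_Rees unfolding ring_hom_def RA_simps by auto
  have v: "W.pmonom x 1 \<in> carrier RA" if "x \<in> carrier N" for x
    using that W.linear_Rees by (simp only: ideal_module_simps)
  have add: "W.pmonom (x \<oplus>\<^bsub>N\<^esub> y) 1 = W.pmonom x 1 \<oplus>\<^bsub>RA\<^esub> W.pmonom y 1"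
    if "x \<in> carrier N" "y \<in> carrier N" for x y
    using that I.Icarr unfolding ideal_module_simps RA_simps by (intro W.monom_add) auto
  have smult: "W.pmonom (r \<odot>\<^bsub>N\<^esub> x) 1 = W.pmonom r 0 \<otimes>\<^bsub>RA\<^esub> W.pmonom x 1"
    if "r \<in> carrier R" "x \<in> carrier N" for r x
    using that I.Icarr W.monom_mult[of r x 0 1] unfolding ideal_module_simps RA_simps by simp
  note L = N.sym_lift[OF RA.cring_axioms h v add smult]
  show "sym_to_rees R I \<in> ring_hom SI RA"
    unfolding sym_to_rees_def SI_eq by (rule L(1))
  show "sym_to_rees R I (sym_scalar R N r) = W.pmonom r 0" if "r \<in> carrier R" for r
    unfolding sym_to_rees_def by (rule L(2)) (assumption | rule that)+
  show "sym_to_rees R I (sym_gen R N x) = W.pmonom x 1" if "x \<in> I" for x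
    unfolding sym_to_rees_def by (rule L(3)) (simp_all only: ideal_module_simps that)
qed

sublocale T: tensor_product SI SQ RA "sym_to_sym_quot R I J" "sym_to_rees R I"
  by (intro tensor_product.intro SI.cring_axioms SQ.cring_axioms RA.cring_axioms
      tensor_product_axioms.intro sym_to_sym_quot_hom sym_to_rees_hom)

lemma aluffi_eq: "aluffi_algebra R I J = T.T"
  unfolding aluffi_algebra_def by simp

lemma scalar_closed: "r \<in> carrier R \<Longrightarrow> sym_scalar R N r \<in> carrier SI"
  unfolding SI_eq by (rule ring_hom_closed[OF N.sym_scalar_hom])

lemma gen_closed: "x \<in> I \<Longrightarrow> sym_gen R N x \<in> carrier SI"
  unfolding SI_eq by (rule N.sym_gen_closed) (simp only: ideal_module_simps)

lemma sym_to_sym_quot_surj: "carrier SQ \<subseteq> sym_to_sym_quot R I J ` carrier SI"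
proof -
  interpret h: ring_hom_ring SI SQ "sym_to_sym_quot R I J"
    by (rule ring_hom_ringI2[OF SI.ring_axioms SQ.ring_axioms sym_to_sym_quot_hom])
  have "subring (sym_to_sym_quot R I J ` carrier SI) SQ"
    by (rule SQ.ring_incl_imp_subring[OF _ h.img_is_ring]) auto
  then show ?thesis
    unfolding SQ_eq
  proof (rule Nq.sym_alg_generated)
    fix r assume "r \<in> carrier Rq"
    then obtain s where "s \<in> carrier R" "r = q s" using q_surj by blast
    then show "sym_scalar Rq Nq r \<in> sym_to_sym_quot R I J ` carrier SI"
      using sym_to_sym_quot_scalar scalar_closed by (metis image_eqI)
  next
    fix x assume "x \<in> carrier Nq"
    then obtain s where "s \<in> I" "x = q s" unfolding ideal_module_simps Iq_iff by blast
    then show "sym_gen Rq Nq x \<in> sym_to_sym_quot R I J ` carrier SI"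
      using sym_to_sym_quot_gen gen_closed by (metis image_eqI)
  qed
qed

lemma sym_to_rees_surj: "carrier RA \<subseteq> sym_to_rees R I ` carrier SI"
proof (rule W.Rees_minimal)
  have "sym_to_rees R I \<in> ring_hom SI (UP R)"
    using ring_hom_trans[OF sym_to_rees_hom RA_incl] by (simp add: o_def)
  then interpret h: ring_hom_ring SI "UP R" "sym_to_rees R I"
    by (rule ring_hom_ringI2[OF SI.ring_axioms W.P.ring_axioms])
  show "subring (sym_to_rees R I ` carrier SI) (UP R)"
    by (rule W.P.ring_incl_imp_subring[OF _ h.img_is_ring]) auto
  show "W.pmonom r 0 \<in> sym_to_rees R I ` carrier SI" if "r \<in> carrier R" for r
    using sym_to_rees_scalar[OF that] scalar_closed[OF that] by (metis image_eqI)
  show "W.pmonom x 1 \<in> sym_to_rees R I ` carrier SI" if "x \<in> I" for x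
    using sym_to_rees_gen[OF that] gen_closed[OF that] by (metis image_eqI)
qed

text \<open>Since \<open>S_R(I)\<close> maps onto the Rees algebra, its base change maps the
  symmetric algebra of \<open>I/J\<close> onto the Aluffi algebra, and chains of primes pull back
  without loss.\<close>

theorem krull_dim_aluffi_le_sym: "krull_dim (aluffi_algebra R I J) \<le> krull_dim SQ"
proof -
  have "\<exists>m C. prime_chain SQ m C \<and> n \<le> m + 0" if "prime_chain (aluffi_algebra R I J) n Q" for n Q
    using prime_chain_vimage[OF SQ.cring_axioms T.T.cring_axioms T.incl_l_hom
        T.incl_l_surj[OF sym_to_rees_surj]] that unfolding aluffi_eq by fastforce
  from krull_dim_le[OF this] show ?thesis by (simp add: zero_enat_def[symmetric])
qed

text \<open>The Rees algebra maps onto the Aluffi algebra. A constant \<open>a\<close> from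
  \<open>J\<close> can be moved across the tensor sign, where it becomes the class of
  \<open>a\<close> in \<open>R/J\<close>, which is zero; so \<open>a\<close> lies in the bottom of
  the pulled back chain, as the sharper bound requires.\<close>

lemma aluffi_chain:
  assumes "noetherian_ring R" "regular_element R a" "prime_chain (aluffi_algebra R I J) n Q"
  shows "\<exists>m C. prime_chain R m C \<and> n \<le> m + 1 \<and> (a \<in> J \<longrightarrow> n \<le> m)"
proof -
  let ?i = "\<lambda>c. T.tens \<one>\<^bsub>SQ\<^esub> c"
  let ?Q = "\<lambda>i. {c \<in> carrier RA. ?i c \<in> Q i}"
  have Q: "prime_chain T.T n Q" using assms(3) aluffi_eq by simp
  then interpret Q0: primeideal "Q 0" T.T unfolding prime_chain_def by simp
  have "prime_chain RA n ?Q"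
    by (rule prime_chain_vimage[OF RA.cring_axioms T.T.cring_axioms T.incl_r_hom
        T.incl_r_surj[OF sym_to_sym_quot_surj] Q])
  from W.rees_chain[OF assms(1) this assms(2)] obtain m C where
    C: "prime_chain R m C" "n \<le> m + 1" "W.pmonom a 0 \<in> ?Q 0 \<longrightarrow> n \<le> m" by blast
  have "W.pmonom a 0 \<in> ?Q 0" if "a \<in> J"
  proof -
    have ac: "a \<in> carrier R" using J.Icarr[OF that] .
    have "q a = \<zero>\<^bsub>Rq\<^esub>" using a_rcos_zero[OF J that] by (simp add: FactRing_def)
    then have "sym_scalar Rq Nq (q a) = \<zero>\<^bsub>SQ\<^esub>"
      using ring_hom_zero[OF Nq.sym_scalar_hom Rq.ring_axioms SQ.ring_axioms[unfolded SQ_eq]]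
      unfolding SQ_eq by simp
    then have "?i (W.pmonom a 0) = T.tens \<zero>\<^bsub>SQ\<^esub> \<one>\<^bsub>RA\<^esub>"
      using T.incl_eq[OF scalar_closed[OF ac]] sym_to_rees_scalar[OF ac] sym_to_sym_quot_scalar[OF ac] by simp
    also have "\<dots> = \<zero>\<^bsub>T.T\<^esub>" using ring_hom_zero[OF T.incl_l_hom SQ.ring_axioms T.T.ring_axioms] .
    finally show ?thesis using Q0.zero_closed W.const_Rees[OF ac] by simp
  qed
  then show ?thesis using C by blast
qed

theorem krull_dim_quot_le_aluffi:
  assumes noeth: "noetherian_ring R" and proper: "J \<subset> carrier R"
    and b: "b \<in> Iq" "regular_element Rq b"
  shows "krull_dim Rq + 1 \<le> krull_dim (aluffi_algebra R I J)"
proof -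
  have noethq: "noetherian_ring Rq"
    by (rule noetherian_ring_image[OF noeth Rq.ring_axioms q_hom q_surj])
  interpret V: UP_cring Rq "UP Rq" by (rule UP_cring.intro) (rule Rq.cring_axioms)
  have bc: "b \<in> carrier Rq" using b Iq_carrier by blast

  let ?h = "\<lambda>r. V.pmonom r 0" and ?v = "\<lambda>x. V.pmonom x 1"
  note L = Nq.sym_lift[of "UP Rq" ?h ?v, OF V.P.cring_axioms V.const_ring_hom]
  have v: "?v x \<in> carrier (UP Rq)" if "x \<in> carrier Nq" for x
    using that Iq_carrier unfolding ideal_module_simps by auto
  have v_add: "?v (x \<oplus>\<^bsub>Nq\<^esub> y) = ?v x \<oplus>\<^bsub>UP Rq\<^esub> ?v y" if "x \<in> carrier Nq" "y \<in> carrier Nq" for x y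
    using that Iq_carrier unfolding ideal_module_simps by (intro V.monom_add) auto
  have v_smult: "?v (r \<odot>\<^bsub>Nq\<^esub> x) = ?h r \<otimes>\<^bsub>UP Rq\<^esub> ?v x" if "r \<in> carrier Rq" "x \<in> carrier Nq" for r x
    using that Iq_carrier V.monom_mult[of r x 0 1] unfolding ideal_module_simps by auto
  define \<beta> where "\<beta> = sym_lift Rq (UP Rq) ?h ?v"
  have \<beta>: "\<beta> \<in> ring_hom SQ (UP Rq)" "\<And>r. r \<in> carrier Rq \<Longrightarrow> \<beta> (sym_scalar Rq Nq r) = V.pmonom r 0"
    "\<And>x. x \<in> Iq \<Longrightarrow> \<beta> (sym_gen Rq Nq x) = V.pmonom x 1"
    using L[OF v v_add v_smult] unfolding \<beta>_def SQ_eq ideal_module_simps by blast+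

  have hR: "(\<lambda>r. V.pmonom (q r) 0) \<in> ring_hom R (UP Rq)"
    using ring_hom_trans[OF q_hom V.const_ring_hom] by (simp add: o_def)
  interpret E: UP_pre_univ_prop R "UP Rq" "\<lambda>r. V.pmonom (q r) 0" "UP R"
    by (rule UP_pre_univ_propI[OF cring_axioms V.P.cring_axioms hR])
  let ?X = "V.pmonom \<one>\<^bsub>Rq\<^esub> 1"
  have X: "?X \<in> carrier (UP Rq)" by simp
  \<comment> \<open>Evaluation of \<open>R[u]\<close> at \<open>u\<close> along
    \<open>R -> (R/J)[u]\<close>, that is, reduction of coefficients modulo \<open>J\<close>; on the
    Rees algebra it is used by restriction.\<close>
  define \<gamma> where "\<gamma> = UnivPoly.eval R (UP Rq) (\<lambda>r. V.pmonom (q r) 0) ?X"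
  have \<gamma>: "\<gamma> \<in> ring_hom RA (UP Rq)"
    using ring_hom_trans[OF RA_incl E.eval_ring_hom[OF X]] unfolding \<gamma>_def o_def .
  have \<gamma>0: "\<gamma> (W.pmonom r 0) = V.pmonom (q r) 0" if "r \<in> carrier R" for r
    unfolding \<gamma>_def by (rule E.eval_const[OF X that])
  have \<gamma>1: "\<gamma> (W.pmonom r 1) = V.pmonom (q r) 1" if "r \<in> carrier R" for r
    using E.eval_monom[OF that X, of 1] X ring_hom_closed[OF q_hom that]
      V.monom_mult[of "q r" "\<one>\<^bsub>Rq\<^esub>" 0 1]
    unfolding \<gamma>_def by simp

  \<comment> \<open>The equalizer of the two composites is a subring of \<open>S_R(I)\<close>. It
    contains the scalars and, since both composites send the generator of \<open>x\<close> to the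
    class of \<open>x\<close> times \<open>u\<close>, also the generators.\<close>
  have agree: "\<beta> (sym_to_sym_quot R I J s) = \<gamma> (sym_to_rees R I s)" if "s \<in> carrier SI" for s
  proof -
    have "(\<lambda>s. \<beta> (sym_to_sym_quot R I J s)) \<in> ring_hom SI (UP Rq)"
      "(\<lambda>s. \<gamma> (sym_to_rees R I s)) \<in> ring_hom SI (UP Rq)"
      using ring_hom_trans[OF sym_to_sym_quot_hom \<beta>(1)] ring_hom_trans[OF sym_to_rees_hom \<gamma>]
      by (simp_all add: o_def)
    from SI.ring_hom_equalizer[OF V.P.ring_axioms this]
    have "carrier SI \<subseteq> {s \<in> carrier SI. \<beta> (sym_to_sym_quot R I J s) = \<gamma> (sym_to_rees R I s)}"
      unfolding SI_eq
    proof (rule N.sym_alg_generated)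
      fix r assume r: "r \<in> carrier R"
      show "sym_scalar R N r \<in> {s \<in> carrier (sym_alg R N). \<beta> (sym_to_sym_quot R I J s) = \<gamma> (sym_to_rees R I s)}"
        using sym_to_sym_quot_scalar[OF r] sym_to_rees_scalar[OF r] \<beta>(2)[OF ring_hom_closed[OF q_hom r]]
          \<gamma>0[OF r] scalar_closed[OF r] unfolding SI_eq by simp
    next
      fix x assume "x \<in> carrier N"
      then have x: "x \<in> I" by (simp only: ideal_module_simps)
      have "q x \<in> Iq" using x Iq_iff by blast
      then show "sym_gen R N x \<in> {s \<in> carrier (sym_alg R N). \<beta> (sym_to_sym_quot R I J s) = \<gamma> (sym_to_rees R I s)}"
        using sym_to_sym_quot_gen[OF x] sym_to_rees_gen[OF x] \<beta>(3) \<gamma>1[OF I.Icarr[OF x]] gen_closed[OF x]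
        unfolding SI_eq by simp
    qed
    then show ?thesis using that by blast
  qed
  obtain \<phi> where \<phi>: "\<phi> \<in> ring_hom T.T (UP Rq)"
    and \<phi>_tens: "\<And>s c. s \<in> carrier SQ \<Longrightarrow> c \<in> carrier RA \<Longrightarrow> \<phi> (T.tens s c) = \<beta> s \<otimes>\<^bsub>UP Rq\<^esub> \<gamma> c"
    using T.T_lift[OF V.P.cring_axioms \<beta>(1) \<gamma> agree] by blast
  interpret \<phi>: ring_hom_ring T.T "UP Rq" \<phi>
    by (rule ring_hom_ringI2[OF T.T.ring_axioms V.P.ring_axioms \<phi>])
  have \<phi>_l: "\<phi> (T.tens s \<one>\<^bsub>RA\<^esub>) = \<beta> s" if "s \<in> carrier SQ" for s
    using \<phi>_tens[OF that RA.one_closed] ring_hom_one[OF \<gamma>] ring_hom_closed[OF \<beta>(1) that] by simp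
  have scalar_q: "sym_scalar Rq Nq r \<in> carrier SQ" if "r \<in> carrier Rq" for r
    unfolding SQ_eq by (rule ring_hom_closed[OF Nq.sym_scalar_hom that])
  have gen_q: "sym_gen Rq Nq b \<in> carrier SQ"
    unfolding SQ_eq by (rule Nq.sym_gen_closed) (simp only: ideal_module_simps b(1))

  have c0: "(\<lambda>F. V.pcoeff F 0) \<in> ring_hom (UP Rq) Rq"
    by (rule ring_hom_memI) simp_all
  interpret c0: ring_hom_ring "UP Rq" Rq "\<lambda>F. V.pcoeff F 0"
    by (rule ring_hom_ringI2[OF V.P.ring_axioms Rq.ring_axioms c0])

  have "\<exists>Q. prime_chain T.T (Suc n) Q" if P: "prime_chain Rq n P" for n P
  proof -
    have P0: "primeideal (P i) Rq" if "i \<le> n" for i using P that unfolding prime_chain_def by blast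
    obtain p where p: "primeideal p Rq" "p \<subseteq> P 0" "b \<notin> p"
      using Rq.prime_below_avoiding_regular[OF noethq P0[of 0] b(2)] by blast
    define D where "D i = (case i of 0 \<Rightarrow> V.extension p
      | Suc j \<Rightarrow> {F \<in> carrier (UP Rq). V.pcoeff F 0 \<in> P j})" for i
    have D: "primeideal (D i) (UP Rq)" if "i \<le> Suc n" for i
      using that V.extension_prime[OF p(1)] c0.primeideal_vimage[OF V.P.cring_axioms P0]
      unfolding D_def by (cases i) auto
    define Q where "Q i = {t \<in> carrier T.T. \<phi> t \<in> D i}" for i
    have "primeideal (Q i) T.T" if "i \<le> Suc n" for i
      unfolding Q_def by (rule \<phi>.primeideal_vimage[OF T.T.cring_axioms D[OF that]])
    \<comment> \<open>The map \<open>\<phi>\<close> need not be onto \<open>(R/J)[u]\<close>, so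
      strict inclusions do not pull back automatically. Each one needs a witness in the image:
      \<open>b u\<close> for the first, a constant from \<open>P (Suc j)\<close> outside
      \<open>P j\<close> for the others.\<close>
    moreover have "Q i \<subset> Q (Suc i)" if "i < Suc n" for i
    proof (cases i)
      case 0
      let ?t = "T.tens (sym_gen Rq Nq b) \<one>\<^bsub>RA\<^esub>"
      have t: "?t \<in> carrier T.T" "\<phi> ?t = V.pmonom b 1"
        using T.tens_closed[OF gen_q RA.one_closed] \<phi>_l[OF gen_q] \<beta>(3)[OF b(1)] by simp_all
      have "\<zero>\<^bsub>Rq\<^esub> \<in> P 0"
        using additive_subgroup.zero_closed[OF ideal.axioms(1)] P0[of 0] unfolding primeideal_def by blast
      then have "?t \<in> Q 1" unfolding Q_def D_def using t bc by simp
      moreover have "V.pcoeff (V.pmonom b 1) 1 = b" using bc by simp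
      then have "?t \<notin> Q 0" unfolding Q_def D_def V.extension_def using t(2) p(3)
        by (metis (mono_tags, lifting) mem_Collect_eq nat.case(1))
      moreover have "D 0 \<subseteq> D 1" unfolding D_def V.extension_def using p(2) by auto
      ultimately show ?thesis unfolding 0 Q_def by auto
    next
      case (Suc j)
      then have lt: "P j \<subset> P (Suc j)" using P that unfolding prime_chain_def by auto
      then obtain r where r: "r \<in> P (Suc j)" "r \<notin> P j" by blast
      have rc: "r \<in> carrier Rq"
        using r(1) P0[of "Suc j"] Suc that ideal.Icarr unfolding primeideal_def by fastforce
      let ?t = "T.tens (sym_scalar Rq Nq r) \<one>\<^bsub>RA\<^esub>"
      have t: "?t \<in> carrier T.T" "\<phi> ?t = V.pmonom r 0"
        using T.tens_closed[OF scalar_q[OF rc] RA.one_closed] \<phi>_l[OF scalar_q[OF rc]] \<beta>(2)[OF rc] by simp_all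
      have "?t \<in> Q (Suc (Suc j))" "?t \<notin> Q (Suc j)"
        unfolding Q_def D_def using t r rc by simp_all
      moreover have "D (Suc j) \<subseteq> D (Suc (Suc j))" unfolding D_def using lt by auto
      ultimately show ?thesis unfolding Suc Q_def by auto
    qed
    ultimately have "prime_chain T.T (Suc n) Q" unfolding prime_chain_def by blast
    then show ?thesis by blast
  qed
  \<comment> \<open>A prime of \<open>R/J\<close> arises as an ideal that avoids 1, which is
    possible because \<open>J\<close> is proper.\<close>
  moreover have "\<exists>n P. prime_chain Rq n P"
  proof -
    have "q \<one> \<noteq> J"
    proof
      assume "q \<one> = J"
      then have "\<one> \<in> J" using J.a_rcos_self[OF one_closed] by simp
      then show False using J.one_imp_carrier proper by blast
    qed
    then have "\<one>\<^bsub>Rq\<^esub> \<noteq> \<zero>\<^bsub>Rq\<^esub>" by (simp add: FactRing_def)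
    moreover have "submonoid {\<one>\<^bsub>Rq\<^esub>} Rq" by (rule submonoid.intro) auto
    ultimately obtain P where "primeideal P Rq"
      using Rq.prime_ideal_avoiding[OF noethq Rq.zeroideal] by blast
    then have "prime_chain Rq 0 (\<lambda>_. P)" unfolding prime_chain_def by simp
    then show ?thesis by blast
  qed
  ultimately show ?thesis unfolding aluffi_eq by (rule krull_dim_Suc_le)
qed

end

theorem proposition1p6:
  fixes R :: "('a, 'm) ring_scheme" and I J :: "'a set"
  assumes "cring R" and "noetherian_ring R"
    and "ideal I R" and "ideal J R"
    and "J \<subset> I" and "I \<subset> carrier R"
  shows "((\<exists>a\<in>J. regular_element R a) \<longrightarrow>
            krull_dim (aluffi_algebra R I J) \<le> krull_dim R) \<and>
         ((\<exists>b\<in>quot_ideal R I J. regular_element (R Quot J) b) \<longrightarrow>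
            min (krull_dim R + 1) (krull_dim (sym_quot_alg R I J)) \<ge> krull_dim (aluffi_algebra R I J) \<and>
            krull_dim (aluffi_algebra R I J) \<ge> krull_dim (R Quot J) + 1)"
proof (intro conjI impI)
  interpret aluffi R I J
    using assms(1,3,4) by (intro aluffi.intro aluffi_axioms.intro)
  assume "\<exists>a\<in>J. regular_element R a"
  then obtain a where a: "a \<in> J" "regular_element R a" by blast
  have "\<exists>m C. prime_chain R m C \<and> n \<le> m + 0" if "prime_chain (aluffi_algebra R I J) n Q" for n Q
    using aluffi_chain[OF assms(2) a(2) that] a(1) by auto
  from krull_dim_le[OF this] show "krull_dim (aluffi_algebra R I J) \<le> krull_dim R"
    by (simp add: zero_enat_def[symmetric])
next
  interpret aluffi R I J
    using assms(1,3,4) by (intro aluffi.intro aluffi_axioms.intro)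
  assume "\<exists>b\<in>quot_ideal R I J. regular_element (R Quot J) b"
  then obtain b where b: "b \<in> quot_ideal R I J" "regular_element (R Quot J) b" by blast
  \<comment> \<open>The hypothesis of this part provides a regular element of \<open>R/J\<close>,
    whereas \<open>aluffi_chain\<close> asks for one of \<open>R\<close>. The unit serves, as only
    the bound with slack one is wanted.\<close>
  have "regular_element R \<one>\<^bsub>R\<^esub>" unfolding regular_element_def by simp
  from aluffi_chain[OF assms(2) this]
  have "\<exists>m C. prime_chain R m C \<and> n \<le> m + 1" if "prime_chain (aluffi_algebra R I J) n Q" for n Q
    using that by blast
  from krull_dim_le[OF this] have "krull_dim (aluffi_algebra R I J) \<le> krull_dim R + 1"
    by (simp add: one_enat_def)
  then show "krull_dim (aluffi_algebra R I J) \<le> min (krull_dim R + 1) (krull_dim (sym_quot_alg R I J))"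
    using krull_dim_aluffi_le_sym by simp
  show "krull_dim (R Quot J) + 1 \<le> krull_dim (aluffi_algebra R I J)"
    using krull_dim_quot_le_aluffi[OF assms(2) _ b] assms(5,6) by auto
qed

end
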